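(* Let $f:X\to X$ be a continuous transformation of a compact metric space $X$ with $h_{\mathrm{top}}(f)<+\infty$. The entropy map $\mathfrak{h}_f:\mathcal{P}(X)\to\mathbb{R}\cup\{-\infty\}$, $\mu\mapsto\mathfrak{h}_\mu(f)$, given by $$\mathfrak{h}_\mu(f)=\inf_{\varphi\in C(X)}\Big\{P_{\mathrm{top}}(f,\varphi)-\int\varphi\,d\mu\Big\}\qquad\forall\,\mu\in\mathcal{P}(X)$$ is upper semi-continuous and satisfies: (a) $0\leqslant h_\mu(f)\leqslant\mathfrak{h}_\mu(f)$ for every $\mu\in\mathcal{P}_f(X)$. (b) For every continuous potential $\varphi:X\to\mathbb{R}$, $$P_{\mathrm{top}}(f,\varphi)=\max_{\mu\in\mathcal{P}(X)}\Big\{\mathfrak{h}_\mu(f)+\int\varphi\,d\mu\Big\}=\max_{\mu\in\mathcal{P}_f(X)}\Big\{\mathfrak{h}_\mu(f)+\int\varphi\,d\mu\Big\}.$$ (c) For every continuous $\varphi$, every measure $\mu\in\mathcal{P}(X)$ which attains the maximum in (b) is $f$-invariant. (d) The restriction of $\mathfrak{h}_f$ to $\mathcal{P}_f(X)$ is the upper semi-continuous concave envelope $h^{**}$ of the Kolmogorov–Sinai metric entropy.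
   Context: $C(X)$ is the space of continuous functions $X\to\mathbb{R}$. $\mathcal{P}(X)$ is the set of Borel ($\sigma$-additive) probability measures on $X$ and $\mathcal{P}_f(X)$ the subset of $f$-invariant ones, both with the weak$^*$ topology. $h_\mu(f)$ is the Kolmogorov–Sinai metric entropy of $\mu\in\mathcal{P}_f(X)$. For $n\in\mathbb{N}$ let $d_n(x,z)=\max_{0\leqslant j\leqslant n}d(f^j(x),f^j(z))$; a set $E\subset X$ is $(n,\varepsilon)$-separated if $d_n(x,z)\geqslant\varepsilon$ for all distinct $x,z\in E$. For $\varphi\in C(X)$, with $S_n\varphi=\varphi+\varphi\circ f+\cdots+\varphi\circ f^n$, the topological pressure is $$P_{\mathrm{top}}(f,\varphi)=\lim_{\varepsilon\to0^+}\limsup_{n\to+\infty}\frac1n\log\sup_E\sum_{x\in E}e^{S_n\varphi(x)},$$ the supremum being over $(n,\varepsilon)$-separated sets $E$; $h_{\mathrm{top}}(f)=P_{\mathrm{top}}(f,0)$ is the topological entropy. The upper semi-continuous concave envelope of the metric entropy is defined on $\mathcal{P}_f(X)$ by $$h^{**}=\inf\{T:\mathcal{P}_f(X)\to\mathbb{R}\ |\ T\text{ continuous, affine and }T(\mu)\geqslant h_\mu(f)\ \forall\mu\in\mathcal{P}_f(X)\}$$ (pointwise infimum). *)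

theory Defs
  imports "HOL-Probability.Probability"
begin

definition borel_probs :: "'a::topological_space measure set" where
  "borel_probs = {\<mu>. prob_space \<mu> \<and> sets \<mu> = sets borel}"

definition invariant_probs :: "('a::topological_space \<Rightarrow> 'a) \<Rightarrow> 'a measure set" where
  "invariant_probs f =
     {\<mu> \<in> borel_probs. \<forall>A\<in>sets borel. emeasure \<mu> (f -` A) = emeasure \<mu> A}"

definition weak_star :: "'a::topological_space measure topology" where
  "weak_star = topology_generated_by
     {{\<mu> \<in> borel_probs. (\<integral>x. \<phi> x \<partial>\<mu>) \<in> U} | (\<phi> :: 'a \<Rightarrow> real) U. continuous_on UNIV \<phi> \<and> open U}"

lemma topspace_weak_star: "topspace (weak_star :: 'a::topological_space measure topology) = borel_probs"
proof -
  have "\<exists>(\<phi> :: 'a \<Rightarrow> real) U.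
      borel_probs = {\<mu> \<in> borel_probs. (\<integral>x. \<phi> x \<partial>\<mu>) \<in> U} \<and> continuous_on UNIV \<phi> \<and> open U"
    by (rule exI[of _ "\<lambda>_. 0"], rule exI[of _ UNIV]) auto
  then show ?thesis
    unfolding weak_star_def topology_generated_by_topspace by blast
qed

definition upper_semicontinuous_map :: "'b topology \<Rightarrow> ('b \<Rightarrow> ereal) \<Rightarrow> bool" where
  "upper_semicontinuous_map T F \<longleftrightarrow> (\<forall>c. openin T {x \<in> topspace T. F x < c})"

definition convex_comb :: "real \<Rightarrow> 'a::topological_space measure \<Rightarrow> 'a measure \<Rightarrow> 'a measure" where
  "convex_comb t \<mu> \<nu> = measure_of UNIV (sets borel)
     (\<lambda>A. ennreal t * emeasure \<mu> A + ennreal (1 - t) * emeasure \<nu> A)"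

lemma emeasure_convex_comb:
  assumes "\<mu> \<in> borel_probs" "\<nu> \<in> borel_probs" "A \<in> sets borel"
  shows "emeasure (convex_comb t \<mu> \<nu>) A
           = ennreal t * emeasure \<mu> A + ennreal (1 - t) * emeasure \<nu> A"
proof (rule emeasure_measure_of[OF convex_comb_def])
  have s: "sets \<mu> = sets borel" "sets \<nu> = sets borel"
    using assms by (auto simp: borel_probs_def)
  have sc: "sets (convex_comb t \<mu> \<nu>) = sets borel"
    using sets.sigma_sets_eq[of borel] by (simp add: convex_comb_def)
  show "countably_additive (sets (convex_comb t \<mu> \<nu>))
      (\<lambda>A. ennreal t * emeasure \<mu> A + ennreal (1 - t) * emeasure \<nu> A)"
    unfolding countably_additive_def sc
    by (auto simp: suminf_add[symmetric] suminf_emeasure s)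
  show "A \<in> sets (convex_comb t \<mu> \<nu>)"
    by (simp add: sc assms)
qed (auto simp: positive_def)

definition affine_on_probs :: "'a::topological_space measure set \<Rightarrow> ('a measure \<Rightarrow> real) \<Rightarrow> bool" where
  "affine_on_probs K T \<longleftrightarrow>
     (\<forall>\<mu>\<in>K. \<forall>\<nu>\<in>K. \<forall>t\<in>{0..1}. T (convex_comb t \<mu> \<nu>) = t * T \<mu> + (1 - t) * T \<nu>)"

definition dyn_dist :: "('a::metric_space \<Rightarrow> 'a) \<Rightarrow> nat \<Rightarrow> 'a \<Rightarrow> 'a \<Rightarrow> real" where
  "dyn_dist f n x z = Max ((\<lambda>j. dist ((f ^^ j) x) ((f ^^ j) z)) ` {0..n})"

definition separated :: "('a::metric_space \<Rightarrow> 'a) \<Rightarrow> nat \<Rightarrow> real \<Rightarrow> 'a set \<Rightarrow> bool" where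
  "separated f n \<epsilon> E \<longleftrightarrow> (\<forall>x\<in>E. \<forall>z\<in>E. x \<noteq> z \<longrightarrow> dyn_dist f n x z \<ge> \<epsilon>)"

definition birkhoff_sum :: "('a \<Rightarrow> 'a) \<Rightarrow> nat \<Rightarrow> ('a \<Rightarrow> real) \<Rightarrow> 'a \<Rightarrow> real" where
  "birkhoff_sum f n \<phi> x = (\<Sum>j\<le>n. \<phi> ((f ^^ j) x))"

text \<open>On a compact space the sums and suprema below are genuine real numbers for \<open>\<epsilon> > 0\<close>: separated
  sets are finite, with a cardinality bound depending only on \<open>n\<close> and \<open>\<epsilon>\<close>.\<close>

lemma separated_card_bounded:
  fixes f :: "'a::metric_space \<Rightarrow> 'a"
  assumes "compact (UNIV :: 'a set)" "continuous_on UNIV f" "\<epsilon> > 0"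
  shows "\<exists>N. \<forall>E. separated f n \<epsilon> E \<longrightarrow> finite E \<and> card E \<le> N"
proof -
  define B where "B x = (\<Inter>j\<in>{0..n}. (f ^^ j) -` ball ((f ^^ j) x) (\<epsilon> / 2))" for x
  have cont: "continuous_on UNIV (f ^^ j)" for j
  proof (induction j)
    case (Suc j)
    then show ?case
      using continuous_on_compose2[OF assms(2) Suc] by (auto simp: o_def)
  qed (auto simp: id_def)
  have "open (B x)" for x
    unfolding B_def by (intro open_INT ballI open_vimage cont) auto
  moreover have "x \<in> B x" for x
    using \<open>\<epsilon> > 0\<close> by (simp add: B_def)
  ultimately obtain C where C: "finite C" "UNIV \<subseteq> (\<Union>c\<in>C. B c)"
    using compactE_image[OF assms(1), of UNIV B] by (metis UNIV_I UN_iff subsetI)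
  have "finite E \<and> card E \<le> card C" if E: "separated f n \<epsilon> E" for E
  proof -
    have "\<forall>x. \<exists>c\<in>C. x \<in> B c" using C by blast
    then obtain g where g: "\<And>x. g x \<in> C" "\<And>x. x \<in> B (g x)" by metis
    have "inj_on g E"
    proof (rule inj_onI, rule ccontr)
      fix x z assume xz: "x \<in> E" "z \<in> E" "g x = g z" "x \<noteq> z"
      have "dist ((f ^^ j) x) ((f ^^ j) z) < \<epsilon>" if "j \<in> {0..n}" for j
      proof (rule dist_triangle_half_r)
        show "dist ((f ^^ j) (g x)) ((f ^^ j) x) < \<epsilon> / 2" "dist ((f ^^ j) (g x)) ((f ^^ j) z) < \<epsilon> / 2"
          using g(2)[of x] g(2)[of z] that xz(3) unfolding B_def by auto
      qed
      then have "dyn_dist f n x z < \<epsilon>"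
        by (simp add: dyn_dist_def)
      then show False
        using E xz unfolding separated_def by (meson not_le)
    qed
    moreover have "g ` E \<subseteq> C" using g by auto
    ultimately show ?thesis
      using C(1) by (meson card_inj_on_le inj_on_finite)
  qed
  then show ?thesis by blast
qed

definition partition_sum :: "('a::metric_space \<Rightarrow> 'a) \<Rightarrow> ('a \<Rightarrow> real) \<Rightarrow> nat \<Rightarrow> real \<Rightarrow> real" where
  "partition_sum f \<phi> n \<epsilon> = (SUP E\<in>{E. separated f n \<epsilon> E}. \<Sum>x\<in>E. exp (birkhoff_sum f n \<phi> x))"

definition P_top :: "('a::metric_space \<Rightarrow> 'a) \<Rightarrow> ('a \<Rightarrow> real) \<Rightarrow> ereal" where
  "P_top f \<phi> = Lim (at_right 0)
     (\<lambda>\<epsilon>. limsup (\<lambda>n. ereal (1 / real n * ln (partition_sum f \<phi> n \<epsilon>))))"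

definition h_top :: "('a::metric_space \<Rightarrow> 'a) \<Rightarrow> ereal" where
  "h_top f = P_top f (\<lambda>_. 0)"

text \<open>Since \<open>ln 0 = 0\<close>, null sets contribute \<open>0\<close>, in accordance with the convention \<open>0 log 0 = 0\<close>.\<close>

definition partition_entropy :: "'a measure \<Rightarrow> 'a set set \<Rightarrow> real" where
  "partition_entropy \<mu> \<P> = (\<Sum>A\<in>\<P>. - measure \<mu> A * ln (measure \<mu> A))"

text \<open>The join of the partitions \<open>f\<^sup>-\<^sup>j \<P>\<close> for \<open>j < n\<close>, without empty cells.\<close>

definition dyn_refinement :: "('a \<Rightarrow> 'a) \<Rightarrow> 'a set set \<Rightarrow> nat \<Rightarrow> 'a set set" where
  "dyn_refinement f \<P> n = (\<lambda>a. \<Inter>j<n. (f ^^ j) -` a j) ` ({..<n} \<rightarrow> \<P>) - {{}}"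

definition entropy_wrt :: "'a measure \<Rightarrow> ('a \<Rightarrow> 'a) \<Rightarrow> 'a set set \<Rightarrow> ereal" where
  "entropy_wrt \<mu> f \<P> = lim (\<lambda>n. ereal (1 / real n * partition_entropy \<mu> (dyn_refinement f \<P> n)))"

definition metric_entropy :: "'a::topological_space measure \<Rightarrow> ('a \<Rightarrow> 'a) \<Rightarrow> ereal" where
  "metric_entropy \<mu> f =
     (SUP \<P>\<in>{\<P>. finite \<P> \<and> partition_on UNIV \<P> \<and> \<P> \<subseteq> sets borel}. entropy_wrt \<mu> f \<P>)"

definition entropy_envelope :: "('a::topological_space \<Rightarrow> 'a) \<Rightarrow> 'a measure \<Rightarrow> ereal" where
  "entropy_envelope f \<mu> =
     (INF T\<in>{T :: 'a measure \<Rightarrow> real.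
         continuous_map (subtopology weak_star (invariant_probs f)) euclideanreal T \<and>
         affine_on_probs (invariant_probs f) T \<and>
         (\<forall>\<nu>\<in>invariant_probs f. metric_entropy \<nu> f \<le> ereal (T \<nu>))}. ereal (T \<mu>))"

definition entropy_map :: "('a::metric_space \<Rightarrow> 'a) \<Rightarrow> 'a measure \<Rightarrow> ereal" where
  "entropy_map f \<mu> =
     (INF \<phi>\<in>{\<phi> :: 'a \<Rightarrow> real. continuous_on UNIV \<phi>}. P_top f \<phi> - ereal (\<integral>x. \<phi> x \<partial>\<mu>))"

definition is_maximum :: "'b::order set \<Rightarrow> 'b \<Rightarrow> bool" where
  "is_maximum S m \<longleftrightarrow> m \<in> S \<and> (\<forall>y\<in>S. y \<le> m)"

end

theory Submission
  imports Defs
begin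

text \<open>Write \<open>H\<^sub>\<mu>(f)\<close> for the value of the entropy map at \<open>\<mu>\<close> and \<open>P(f, \<phi>)\<close> for the pressure. By definition the entropy map is an infimum of the weak-star
continuous functions \<open>\<mu> \<mapsto> P(f, \<phi>) - \<integral>\<phi> d\<mu>\<close>, hence upper semi-continuous, and the inequality
\<open>H\<^sub>\<mu>(f) + \<integral>\<phi> d\<mu> \<le> P(f, \<phi>)\<close> holds for all \<open>\<mu>\<close> and \<open>\<phi>\<close>. Everything else rests on the variational principle, which
says that \<open>P(f, \<phi>)\<close> is the supremum of \<open>h\<^sub>\<mu>(f) + \<integral>\<phi> d\<mu>\<close> over invariant \<open>\<mu>\<close>, on weak-star compactness of the set of
invariant probability measures, and on a separation argument.

The upper half of the variational principle, \<open>variational_upper_bound\<close>, says \<open>h\<^sub>\<mu>(f) \<le> P(f, \<phi>) - \<integral>\<phi> d\<mu>\<close> for all \<open>\<phi>\<close>;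
this is the inequality \<open>h\<^sub>\<mu>(f) \<le> H\<^sub>\<mu>(f)\<close>. Disjoint closed subsets of the cells of a partition have positive mutual distance,
so that a small ball meets few of them. This turns itineraries of orbits into points of a separated set, at a bounded
cost per block of iterates, and long blocks make the cost negligible. The lower half, \<open>variational_lower_bound\<close>, follows
Misiurewicz: averages along orbits of the Gibbs weights on separated sets have a weak-star cluster point, and
this invariant measure has nearly maximal free energy.

Compactness turns the supremum into a maximum. If the free energies of invariant measures \<open>\<mu>\<^sub>n\<close> tend to \<open>P(f, \<phi>)\<close>,
the upper half for an arbitrary \<open>\<psi>\<close> passes to a cluster point \<open>\<mu>\<close> and says
\<open>P(f, \<phi>) - \<integral>\<phi> d\<mu> \<le> P(f, \<psi>) - \<integral>\<psi> d\<mu>\<close>; thus \<open>H\<^sub>\<mu>(f) = P(f, \<phi>) - \<integral>\<phi> d\<mu>\<close>. Maximising measures are invariant because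
adding a coboundary \<open>\<psi> \<circ> f - \<psi>\<close> to \<open>\<phi>\<close> does not increase the pressure, so that at a maximising measure the integral of every
coboundary vanishes.

Each \<open>\<mu> \<mapsto> P(f, \<phi>) - \<integral>\<phi> d\<mu>\<close> is a continuous affine majorant of the metric entropy, so the envelope lies below the entropy map.
Conversely let \<open>T\<close> be a continuous affine majorant and \<open>\<mu>\<close> an invariant measure. Separating the graph of \<open>T\<close> from a point
slightly above it yields a potential \<open>\<psi>\<close> such that \<open>\<nu> \<mapsto> \<integral>\<psi> d\<nu> + c\<close>, for some constant \<open>c\<close>, lies above \<open>T\<close> and is almost
equal to \<open>T\<close> at \<open>\<mu>\<close>. By the lower half of the variational principle \<open>c\<close> bounds the pressure of \<open>-\<psi>\<close>, and this potential
shows that \<open>H\<^sub>\<mu>(f)\<close> is at most \<open>\<integral>\<psi> d\<mu> + c\<close>, hence almost at most \<open>T \<mu>\<close>.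

Compactness of the set of all Borel probability measures is obtained from Tychonoff's theorem and the Riesz
representation theorem, proved here for compact metric spaces. The construction of the representing
measure also supplies the regularity of Borel measures on which the upper half of the variational principle depends.\<close>

section \<open>Continuous approximation of open sets\<close>

text \<open>A continuous function below the indicator of \<open>U\<close> that grows with slope \<open>n\<close> away from the complement until it reaches \<open>1\<close>. The
complement of \<open>UNIV\<close> is empty and \<open>infdist\<close> to the empty set is \<open>0\<close>, whence the separate case.\<close>

definition bump :: "'a::metric_space set \<Rightarrow> nat \<Rightarrow> 'a \<Rightarrow> real" where
  "bump U n x = (if U = UNIV then 1 else min 1 (real n * infdist x (- U)))"

lemma continuous_on_bump [continuous_intros]: "continuous_on S (bump U n)"
  unfolding bump_def by (cases "U = UNIV") (auto intro!: continuous_intros)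

lemma bump_range: "0 \<le> bump U n x" "bump U n x \<le> 1"
  by (auto simp: bump_def infdist_nonneg)

lemma bump_outside: "x \<notin> U \<Longrightarrow> bump U n x = 0"
  by (auto simp: bump_def)

lemma bump_le_indicator: "bump U n x \<le> indicator U x"
  by (cases "x \<in> U") (auto simp: bump_range bump_outside)

lemma bump_mono: "n \<le> m \<Longrightarrow> bump U n x \<le> bump U m x"
proof -
  assume "n \<le> m"
  then have "real n * infdist x (- U) \<le> real m * infdist x (- U)"
    by (intro mult_right_mono) (auto simp: infdist_nonneg)
  then show ?thesis by (auto simp: bump_def min_def)
qed

lemma bump_eventually_1:
  assumes "open U" "x \<in> U"
  shows "\<forall>\<^sub>F n in sequentially. bump U n x = 1"
proof (cases "U = UNIV")
  case False
  then have "infdist x (- U) \<noteq> 0"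
    using assms in_closed_iff_infdist_zero[of "- U" x] by auto
  then have pos: "infdist x (- U) > 0"
    using infdist_nonneg[of x "- U"] by linarith
  obtain N where N: "real N * infdist x (- U) > 1"
    using reals_Archimedean3[OF pos] by blast
  have "bump U n x = 1" if "n \<ge> N" for n
  proof -
    have "real N * infdist x (- U) \<le> real n * infdist x (- U)"
      using that pos by (intro mult_right_mono) auto
    then show ?thesis using N False by (simp add: bump_def)
  qed
  then show ?thesis unfolding eventually_sequentially by blast
qed (simp add: bump_def)

lemma bump_tendsto: "open U \<Longrightarrow> (\<lambda>n. bump U n x) \<longlonglongrightarrow> indicator U x"
proof (cases "x \<in> U")
  case True
  assume "open U"
  with bump_eventually_1[OF this True] True show ?thesis
    by (auto intro: tendsto_eventually)
qed (simp add: bump_outside)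

lemma borel_probsD:
  assumes "\<mu> \<in> borel_probs"
  shows "prob_space \<mu>" "sets \<mu> = sets borel" "space \<mu> = UNIV" "finite_measure \<mu>"
    "measure \<mu> UNIV = 1"
proof -
  show p: "prob_space \<mu>" and s: "sets \<mu> = sets borel" using assms by (auto simp: borel_probs_def)
  show u: "space \<mu> = UNIV" using sets_eq_imp_space_eq[OF s] by simp
  show "finite_measure \<mu>" using p by (rule prob_space.finite_measure)
  show "measure \<mu> UNIV = 1" using prob_space.prob_space[OF p] u by simp
qed

lemma continuous_measurable:
  assumes "\<mu> \<in> borel_probs" "continuous_on UNIV (\<phi> :: 'a::topological_space \<Rightarrow> real)"
  shows "\<phi> \<in> borel_measurable \<mu>"
  using borel_measurable_continuous_onI[OF assms(2)] borel_probsD(2)[OF assms(1)]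
  by (simp cong: measurable_cong_sets)

lemma continuous_bounded:
  assumes "compact (UNIV :: 'a::topological_space set)" "continuous_on UNIV (\<phi> :: 'a \<Rightarrow> real)"
  obtains B where "B > 0" "\<And>x. \<bar>\<phi> x\<bar> \<le> B"
proof -
  have "bounded (\<phi> ` UNIV)"
    using compact_continuous_image[OF assms(2,1)] compact_imp_bounded by blast
  then obtain B where "B > 0" "\<forall>y\<in>range \<phi>. norm y \<le> B"
    unfolding bounded_pos by blast
  then show thesis using that by auto
qed

lemma integrable_bounded_function:
  assumes "\<mu> \<in> borel_probs" "(\<phi> :: 'a::topological_space \<Rightarrow> real) \<in> borel_measurable borel"
    "\<And>x. \<bar>\<phi> x\<bar> \<le> B"
  shows "integrable \<mu> \<phi>"
proof -
  interpret prob_space \<mu> using borel_probsD(1)[OF assms(1)] .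
  show ?thesis
    using assms borel_probsD(2)[OF assms(1)]
    by (intro integrable_const_bound[where B=B]) (auto cong: measurable_cong_sets)
qed

lemma continuous_integrable:
  assumes "compact (UNIV :: 'a::topological_space set)" "\<mu> \<in> borel_probs"
    "continuous_on UNIV (\<phi> :: 'a \<Rightarrow> real)"
  shows "integrable \<mu> \<phi>"
  using continuous_bounded[OF assms(1,3)] integrable_bounded_function[OF assms(2)]
    borel_measurable_continuous_onI[OF assms(3)] by metis

lemma bump_integrable: "\<mu> \<in> borel_probs \<Longrightarrow> integrable \<mu> (bump U n)"
  by (rule integrable_bounded_function[where B=1])
     (auto simp: bump_range intro!: borel_measurable_continuous_onI continuous_intros)

text \<open>Integrals of continuous functions determine the measure of open sets, and by this monotone limit they do so
from below; this is how weak-star information is converted into information on sets.\<close>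

lemma bump_integral_tendsto:
  assumes "\<mu> \<in> borel_probs" "open (U :: 'a::metric_space set)"
  shows "(\<lambda>n. \<integral>x. bump U n x \<partial>\<mu>) \<longlonglongrightarrow> measure \<mu> U"
proof -
  interpret prob_space \<mu> using borel_probsD(1)[OF assms(1)] .
  have s: "sets \<mu> = sets borel" using borel_probsD(2)[OF assms(1)] .
  have "(\<lambda>n. \<integral>x. bump U n x \<partial>\<mu>) \<longlonglongrightarrow> (\<integral>x. indicator U x \<partial>\<mu>)"
    by (rule integral_dominated_convergence[where w="\<lambda>_. 1"])
       (use assms bump_integrable[OF assms(1)] bump_tendsto[OF assms(2)] in
         \<open>auto simp: bump_range s intro!: continuous_measurable continuous_intros borel_measurable_indicator\<close>)
  then show ?thesis using assms s borel_probsD(3)[OF assms(1)] by simp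
qed

lemma bump_integral_le:
  assumes "\<mu> \<in> borel_probs" "open (U :: 'a::metric_space set)"
  shows "(\<integral>x. bump U n x \<partial>\<mu>) \<le> measure \<mu> U"
proof -
  interpret prob_space \<mu> using borel_probsD(1)[OF assms(1)] .
  have U: "U \<in> sets \<mu>" using borel_probsD(2)[OF assms(1)] assms(2) by simp
  have "(\<integral>x. bump U n x \<partial>\<mu>) \<le> (\<integral>x. indicator U x \<partial>\<mu>)"
    using U by (intro integral_mono bump_integrable assms bump_le_indicator)
      (auto simp: integrable_indicator_iff emeasure_eq_measure)
  then show ?thesis using U borel_probsD(3)[OF assms(1)] by simp
qed

lemma borel_probs_eqI_open:
  assumes "\<mu> \<in> borel_probs" "\<nu> \<in> borel_probs"
    and op: "\<And>U :: 'a::topological_space set. open U \<Longrightarrow> measure \<mu> U = measure \<nu> U"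
  shows "\<mu> = \<nu>"
proof -
  interpret m: prob_space \<mu> using borel_probsD(1)[OF assms(1)] .
  interpret n: prob_space \<nu> using borel_probsD(1)[OF assms(2)] .
  show ?thesis
  proof (rule measure_eqI_generator_eq[where E="{U. open U}" and \<Omega>=UNIV and A="\<lambda>_. UNIV"])
    show "Int_stable {U :: 'a set. open U}" by (auto simp: Int_stable_def)
    show "sets \<mu> = sigma_sets UNIV {U. open U}" "sets \<nu> = sigma_sets UNIV {U. open U}"
      using borel_probsD(2) assms by (auto simp: borel_def)
    show "emeasure \<mu> U = emeasure \<nu> U" if "U \<in> {U. open U}" for U
      using op that by (simp add: m.emeasure_eq_measure n.emeasure_eq_measure)
  qed (auto simp: m.emeasure_eq_measure)
qed

lemma borel_probs_eqI:
  assumes "\<mu> \<in> borel_probs" "\<nu> \<in> borel_probs"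
    and eq: "\<And>\<phi> :: 'a::metric_space \<Rightarrow> real. continuous_on UNIV \<phi> \<Longrightarrow> (\<integral>x. \<phi> x \<partial>\<mu>) = (\<integral>x. \<phi> x \<partial>\<nu>)"
  shows "\<mu> = \<nu>"
proof (rule borel_probs_eqI_open[OF assms(1,2)])
  fix U :: "'a set" assume U: "open U"
  show "measure \<mu> U = measure \<nu> U"
    using bump_integral_tendsto[OF assms(1) U] bump_integral_tendsto[OF assms(2) U]
      eq[OF continuous_on_bump] LIMSEQ_unique by simp
qed


section \<open>Riesz representation on a compact metric space\<close>

text \<open>The axioms concern continuous arguments only, so that a functional carrying arbitrary default values at
discontinuous arguments qualifies.\<close>

locale normalised_positive_functional =
  fixes L :: "('a::metric_space \<Rightarrow> real) \<Rightarrow> real"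
  assumes compact_space_UNIV: "compact (UNIV :: 'a set)"
    and add: "\<And>\<phi> \<psi>. continuous_on UNIV \<phi> \<Longrightarrow> continuous_on UNIV \<psi> \<Longrightarrow> L (\<lambda>x. \<phi> x + \<psi> x) = L \<phi> + L \<psi>"
    and scale: "\<And>c \<phi>. continuous_on UNIV \<phi> \<Longrightarrow> L (\<lambda>x. c * \<phi> x) = c * L \<phi>"
    and nonneg: "\<And>\<phi>. continuous_on UNIV \<phi> \<Longrightarrow> (\<And>x. 0 \<le> \<phi> x) \<Longrightarrow> 0 \<le> L \<phi>"
    and one: "L (\<lambda>_. 1) = 1"
begin

lemma const: "L (\<lambda>_. c) = c"
  using scale[of "\<lambda>_. 1" c] one by simp

lemma diff:
  assumes "continuous_on UNIV \<phi>" "continuous_on UNIV \<psi>"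
  shows "L (\<lambda>x. \<phi> x - \<psi> x) = L \<phi> - L \<psi>"
  using add[OF assms(1), of "\<lambda>x. (-1) * \<psi> x"] scale[OF assms(2), of "-1"] assms
  by (simp add: continuous_on_minus)

lemma mono:
  assumes "continuous_on UNIV \<phi>" "continuous_on UNIV \<psi>" "\<And>x. \<phi> x \<le> \<psi> x"
  shows "L \<phi> \<le> L \<psi>"
  using nonneg[of "\<lambda>x. \<psi> x - \<phi> x"] diff[OF assms(2,1)] assms by (simp add: continuous_intros)

lemma sum:
  assumes "finite I" "\<And>i. i \<in> I \<Longrightarrow> continuous_on UNIV (\<phi> i)"
  shows "L (\<lambda>x. \<Sum>i\<in>I. \<phi> i x) = (\<Sum>i\<in>I. L (\<phi> i))"
  using assms by (induction rule: finite_induct) (auto simp: const add continuous_on_sum)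

definition below :: "'a set \<Rightarrow> ('a \<Rightarrow> real) set" where
  "below U = {\<phi>. continuous_on UNIV \<phi> \<and> (\<forall>x. 0 \<le> \<phi> x \<and> \<phi> x \<le> indicator U x)}"

text \<open>The classical two-step construction: functions approximate open sets from inside, and open sets approximate
arbitrary sets from outside.\<close>

definition content :: "'a set \<Rightarrow> ennreal" where
  "content U = (SUP \<phi>\<in>below U. ennreal (L \<phi>))"

definition outer :: "'a set \<Rightarrow> ennreal" where
  "outer A = (INF U\<in>{U. open U \<and> A \<subseteq> U}. content U)"

lemma below_nonneg: "\<phi> \<in> below U \<Longrightarrow> 0 \<le> L \<phi>"
  by (auto simp: below_def nonneg)

lemma content_lower: "\<phi> \<in> below U \<Longrightarrow> ennreal (L \<phi>) \<le> content U"
  unfolding content_def by (rule SUP_upper)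

lemma content_mono: "U \<subseteq> V \<Longrightarrow> content U \<le> content V"
proof -
  assume "U \<subseteq> V"
  then have "indicator U x \<le> (indicator V x :: real)" for x by (auto simp: indicator_def)
  then have "below U \<subseteq> below V" unfolding below_def by (blast intro: order_trans)
  then show ?thesis unfolding content_def by (rule SUP_subset_mono) simp
qed

lemma content_le_1: "content U \<le> 1"
  unfolding content_def
proof (rule SUP_least)
  fix \<phi> assume \<phi>: "\<phi> \<in> below U"
  then have "\<phi> x \<le> 1" for x
    by (auto simp: below_def intro: order_trans[OF _ indicator_le_1])
  then have "L \<phi> \<le> L (\<lambda>_. 1)"
    using \<phi> by (intro mono) (auto simp: below_def)
  then show "ennreal (L \<phi>) \<le> 1" by (simp add: one)
qed

lemma outer_open: "open U \<Longrightarrow> outer U = content U"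
  unfolding outer_def by (rule antisym) (auto intro!: INF_lower INF_greatest content_mono)

lemma outer_mono: "A \<subseteq> B \<Longrightarrow> outer A \<le> outer B"
  unfolding outer_def by (rule INF_superset_mono) auto

lemma outer_empty: "outer {} = 0"
proof -
  have "\<phi> = (\<lambda>_. 0)" if "\<phi> \<in> below {}" for \<phi>
    using that by (auto simp: below_def intro!: ext antisym)
  then have "content {} \<le> 0"
    unfolding content_def by (intro SUP_least) (metis const ennreal_0 order_refl)
  then show ?thesis using outer_open[of "{}"] by simp
qed

lemma UNIV_content: "content UNIV = 1"
proof -
  have "(\<lambda>_. 1) \<in> below UNIV" by (auto simp: below_def)
  then show ?thesis using content_lower[of "\<lambda>_. 1" UNIV] content_le_1[of UNIV] by (simp add: one)
qed

lemma content_close: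
  assumes "e > 0"
  obtains \<phi> where "\<phi> \<in> below U" "content U \<le> ennreal (L \<phi> + e)"
proof -
  have fin: "content U \<noteq> top" using content_le_1[of U] by (auto simp: top_unique)
  have ne: "(\<lambda>_. 0) \<in> below U" by (auto simp: below_def)
  have "\<exists>\<phi>\<in>below U. content U \<le> ennreal (L \<phi> + e)"
  proof (cases "content U = 0")
    case True then show ?thesis using ne by auto
  next
    case False
    have "content U - ennreal e < content U"
      using assms fin False by (intro ennreal_between) (auto simp: top.not_eq_extremum zero_less_iff_neq_zero)
    then obtain \<phi> where \<phi>: "\<phi> \<in> below U" "content U - ennreal e < ennreal (L \<phi>)"
      by (subst (asm) (2) content_def) (auto simp: less_SUP_iff)
    then have "content U \<le> ennreal (L \<phi>) + ennreal e"
      by (metis add.commute ennreal_minus_le_iff less_imp_le)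
    then show ?thesis using \<phi> assms below_nonneg by (auto simp: ennreal_plus)
  qed
  then show ?thesis using that by blast
qed

text \<open>If \<open>\<phi>\<close> lies below the union of the \<open>U i\<close>, the sums \<open>g n\<close> of the first
\<open>n\<close> bump functions of slope \<open>n\<close> increase with \<open>n\<close> and eventually exceed \<open>\<phi> - e\<close> at each point; by compactness one
\<open>n\<close> works everywhere, and \<open>L (g n)\<close> is at most the sum of the contents.\<close>

lemma content_countably_subadditive:
  assumes U: "\<And>i::nat. open (U i)"
  shows "content (\<Union>i. U i) \<le> (\<Sum>i. content (U i))"
  unfolding content_def[of "\<Union>i. U i"]
proof (rule SUP_least, rule ennreal_le_epsilon)
  fix \<phi> and e :: real assume \<phi>: "\<phi> \<in> below (\<Union>i. U i)" and e: "e > 0"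
  define g where "g n x = (\<Sum>i<n. bump (U i) n x)" for n x
  have gc: "continuous_on S (g n)" for n S unfolding g_def by (intro continuous_intros)
  have \<phi>c: "continuous_on UNIV \<phi>" using \<phi> by (auto simp: below_def)
  define G where "G n = {x. \<phi> x - e < g n x}" for n
  have "open (G n)" for n
    unfolding G_def by (intro open_Collect_less continuous_intros \<phi>c gc)
  moreover have "\<exists>n. x \<in> G n" for x
  proof (cases "x \<in> (\<Union>i. U i)")
    case True
    then obtain i where i: "x \<in> U i" by blast
    from bump_eventually_1[OF U this] obtain N where N: "\<And>n. n \<ge> N \<Longrightarrow> bump (U i) n x = 1"
      unfolding eventually_sequentially by blast
    define n where "n = max N (Suc i)"
    have "1 = bump (U i) n x" using N n_def by simp
    also have "\<dots> \<le> g n x" unfolding g_def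
      by (rule member_le_sum) (auto simp: n_def bump_range)
    finally have "\<phi> x - e < g n x"
      using \<phi> e unfolding below_def by (smt (verit, best) indicator_le_1 mem_Collect_eq)
    then show ?thesis by (auto simp: G_def)
  next
    case False
    then have "indicator (\<Union>i. U i) x = (0 :: real)" by (rule indicator_simps)
    then have "\<phi> x = 0" using \<phi> unfolding below_def by (metis (no_types, lifting) antisym mem_Collect_eq)
    then have "x \<in> G 0" using e by (auto simp: G_def g_def)
    then show ?thesis by blast
  qed
  ultimately obtain C where C: "finite C" "UNIV \<subseteq> (\<Union>n\<in>C. G n)"
    using compactE_image[OF compact_space_UNIV, of UNIV G] by (metis UNIV_I UN_iff subsetI)
  define n where "n = Max C"
  have gm: "g a x \<le> g b x" if "a \<le> b" for a b x
  proof -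
    have "g a x \<le> (\<Sum>i<a. bump (U i) b x)" unfolding g_def by (intro sum_mono bump_mono that)
    also have "\<dots> \<le> g b x" unfolding g_def by (intro sum_mono2) (use that in \<open>auto simp: bump_range\<close>)
    finally show ?thesis .
  qed
  have "\<phi> x \<le> g n x + e" for x
  proof -
    obtain a where "a \<in> C" "x \<in> G a" using C by blast
    then show ?thesis using gm[of a n x] C(1) unfolding G_def n_def by simp
  qed
  then have "L \<phi> \<le> L (\<lambda>x. g n x + e)" by (intro mono \<phi>c continuous_intros gc)
  also have "\<dots> = (\<Sum>i<n. L (bump (U i) n)) + e"
    using sum[of "{..<n}" "\<lambda>i. bump (U i) n"] add[OF gc, of "\<lambda>_. e"]
    by (simp add: const continuous_on_bump flip: g_def)
  finally have "ennreal (L \<phi>) \<le> ennreal ((\<Sum>i<n. L (bump (U i) n)) + e)" by (rule ennreal_leI)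
  also have "\<dots> = (\<Sum>i<n. ennreal (L (bump (U i) n))) + ennreal e"
    using e by (subst ennreal_plus)
      (auto intro!: sum_nonneg nonneg continuous_on_bump bump_range sum_ennreal[symmetric])
  also have "(\<Sum>i<n. ennreal (L (bump (U i) n))) \<le> (\<Sum>i<n. content (U i))"
    by (intro sum_mono content_lower) (auto simp: below_def continuous_on_bump bump_range bump_le_indicator)
  also have "\<dots> \<le> (\<Sum>i. content (U i))"
    by (rule sum_le_suminf) auto
  finally show "ennreal (L \<phi>) \<le> (\<Sum>i. content (U i)) + ennreal e" by (simp add: add_right_mono)
qed

lemma outer_close:
  assumes "e > 0"
  obtains U where "open U" "A \<subseteq> U" "content U \<le> outer A + ennreal e"
proof -
  have "outer A \<le> outer UNIV" by (rule outer_mono) auto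
  then have "outer A \<le> 1" by (simp add: outer_open UNIV_content)
  then have "outer A < outer A + ennreal e"
    using assms by (metis ennreal_add_left_cancel_less ennreal_less_zero_iff
       add.right_neutral ennreal_one_less_top infinity_ennreal_def leD top.not_eq_extremum)
  then obtain U where "open U" "A \<subseteq> U" "content U < outer A + ennreal e"
    by (subst (asm) (1) outer_def) (auto simp: INF_less_iff)
  then show ?thesis using that by (auto simp: less_imp_le)
qed

lemma outer_measure_space_outer: "outer_measure_space (Pow UNIV) outer"
  unfolding outer_measure_space_def
proof (intro conjI)
  show "positive (Pow UNIV) outer" by (simp add: positive_def outer_empty)
  show "increasing (Pow UNIV) outer" by (simp add: increasing_def outer_mono)
  show "countably_subadditive (Pow UNIV) outer"
    unfolding countably_subadditive_def
  proof (intro allI impI, rule ennreal_le_epsilon)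
    fix A :: "nat \<Rightarrow> 'a set" and e :: real assume e: "e > 0"
    have "\<exists>U. open U \<and> A n \<subseteq> U \<and> content U \<le> outer (A n) + ennreal (e * (1/2)^Suc n)" for n
      using outer_close[of "e * (1/2)^Suc n" "A n"] e by (metis half_gt_zero_iff mult_pos_pos zero_less_one zero_less_power)
    then obtain U where U: "\<And>n. open (U n)" "\<And>n. A n \<subseteq> U n"
      "\<And>n. content (U n) \<le> outer (A n) + ennreal (e * (1/2)^Suc n)" by metis
    have "outer (\<Union>i. A i) \<le> outer (\<Union>i. U i)" by (rule outer_mono) (use U in blast)
    also have "\<dots> \<le> (\<Sum>i. content (U i))"
      using content_countably_subadditive[of U] U(1) by (simp add: outer_open open_UN)
    also have "\<dots> \<le> (\<Sum>n. outer (A n) + e * (1/2) ^ Suc n)" by (intro suminf_le U) auto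
    also have "... = (\<Sum>n. outer (A n)) + (\<Sum>n. ennreal e * ennreal ((1/2) ^ Suc n))"
      using \<open>0 < e\<close> by (subst suminf_add[symmetric])
                       (auto simp del: ennreal_suminf_cmult simp add: ennreal_mult[symmetric])
    also have "\<dots> = (\<Sum>n. outer (A n)) + e"
      unfolding ennreal_suminf_cmult
      by (subst suminf_ennreal_eq[OF zero_le_power power_half_series]) auto
    finally show "outer (\<Union>i. A i) \<le> (\<Sum>n. outer (A n)) + ennreal e" .
  qed
qed

text \<open>The Caratheodory condition for open sets. For open \<open>V\<close> containing \<open>T\<close>, a nearly optimal \<open>\<phi>\<close> below \<open>V \<inter> U\<close> is
replaced by the positive part \<open>\<theta>\<close> of \<open>\<phi> - d\<close>. This vanishes off the closed set \<open>C = {x. d \<le> \<phi> x}\<close>, so it may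
be added to any function below \<open>V - C\<close>, and \<open>V - C\<close> still covers \<open>T - U\<close>.\<close>

lemma outer_open_split:
  assumes "open U"
  shows "outer (T \<inter> U) + outer (T - U) \<le> outer T"
proof -
  have "outer (T \<inter> U) + outer (T - U) \<le> content V" if V: "open V" "T \<subseteq> V" for V
  proof (rule ennreal_le_epsilon)
    fix e :: real assume e: "e > 0"
    define d where "d = e / 3"
    have d: "d > 0" using e by (simp add: d_def)
    obtain \<phi> where \<phi>: "\<phi> \<in> below (V \<inter> U)" "content (V \<inter> U) \<le> ennreal (L \<phi> + d)"
      using content_close[OF d] .
    have \<phi>c: "continuous_on UNIV \<phi>" using \<phi> by (auto simp: below_def)
    define C where "C = {x. d \<le> \<phi> x}"
    have C: "closed C" unfolding C_def by (intro closed_Collect_le continuous_intros \<phi>c)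
    have CU: "C \<subseteq> V \<inter> U"
    proof
      fix x assume "x \<in> C"
      moreover have "\<phi> x \<le> indicator (V \<inter> U) x" using \<phi>(1) by (auto simp: below_def)
      ultimately show "x \<in> V \<inter> U" using d by (cases "x \<in> V \<inter> U") (auto simp: C_def)
    qed
    obtain \<psi> where \<psi>: "\<psi> \<in> below (V - C)" "content (V - C) \<le> ennreal (L \<psi> + d)"
      using content_close[OF d] .
    have \<psi>c: "continuous_on UNIV \<psi>" using \<psi> by (auto simp: below_def)
    define \<theta> where "\<theta> x = max (\<phi> x - d) 0" for x
    have \<theta>c: "continuous_on UNIV \<theta>" unfolding \<theta>_def by (intro continuous_intros \<phi>c)
    have "(\<lambda>x. \<theta> x + \<psi> x) \<in> below V"
    proof -
      have "0 \<le> \<theta> x + \<psi> x \<and> \<theta> x + \<psi> x \<le> indicator V x" for x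
      proof (cases "x \<in> C")
        case True
        then have "x \<in> V" using CU by blast
        have "0 \<le> \<psi> x" "\<psi> x \<le> indicator (V - C) x" "\<phi> x \<le> indicator (V \<inter> U) x"
          using \<psi>(1) \<phi>(1) by (auto simp: below_def)
        then have "\<psi> x = 0" "\<phi> x \<le> 1"
          using True order_trans[OF \<open>\<phi> x \<le> indicator (V \<inter> U) x\<close> indicator_le_1] by auto
        then show ?thesis using d True \<open>x \<in> V\<close> by (auto simp: \<theta>_def C_def)
      next
        case False
        then have "\<theta> x = 0" by (auto simp: \<theta>_def C_def)
        moreover have "0 \<le> \<psi> x" "\<psi> x \<le> indicator (V - C) x" using \<psi>(1) by (auto simp: below_def)
        ultimately show ?thesis using False by (auto simp: indicator_def split: if_splits)
      qed
      then show ?thesis using \<theta>c \<psi>c by (auto simp: below_def intro!: continuous_intros)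
    qed
    then have le: "ennreal (L \<theta> + L \<psi>) \<le> content V"
      using content_lower[of "\<lambda>x. \<theta> x + \<psi> x" V] by (simp add: add[OF \<theta>c \<psi>c])
    have "L \<phi> - d \<le> L \<theta>"
      using mono[of "\<lambda>x. \<phi> x - d" \<theta>] diff[OF \<phi>c, of "\<lambda>_. d"] \<phi>c \<theta>c
      by (simp add: const \<theta>_def continuous_intros)
    have n: "0 \<le> L \<phi>" "0 \<le> L \<psi>" "0 \<le> L \<theta>"
      using below_nonneg \<phi> \<psi> nonneg[OF \<theta>c] by (auto simp: \<theta>_def)
    have "outer (T \<inter> U) \<le> content (V \<inter> U)"
      using outer_mono[of "T \<inter> U" "V \<inter> U"] V assms by (auto simp: outer_open open_Int)
    moreover have "outer (T - U) \<le> content (V - C)"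
      using outer_mono[of "T - U" "V - C"] V C CU by (auto simp: outer_open open_Diff)
    ultimately have "outer (T \<inter> U) + outer (T - U) \<le> ennreal (L \<phi> + d) + ennreal (L \<psi> + d)"
      using \<phi>(2) \<psi>(2) by (meson add_mono order_trans)
    also have "\<dots> = ennreal (L \<phi> + L \<psi> + 2 * d)"
      using n d by (simp flip: ennreal_plus add: algebra_simps)
    also have "\<dots> \<le> ennreal ((L \<theta> + L \<psi>) + e)"
      using \<open>L \<phi> - d \<le> L \<theta>\<close> by (intro ennreal_leI) (simp add: d_def)
    also have "\<dots> = ennreal (L \<theta> + L \<psi>) + ennreal e" using n e by (subst ennreal_plus) auto
    also have "\<dots> \<le> content V + ennreal e" using le by (simp add: add_right_mono)
    finally show "outer (T \<inter> U) + outer (T - U) \<le> content V + ennreal e" .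
  qed
  then show ?thesis unfolding outer_def[of T] by (intro INF_greatest) auto
qed

definition riesz_measure :: "'a measure" where
  "riesz_measure = measure_of UNIV (sets borel) outer"

lemma sets_riesz: "sets riesz_measure = sets borel"
  using sets.sigma_sets_eq[of borel] by (simp add: riesz_measure_def)

lemma emeasure_riesz: "A \<in> sets borel \<Longrightarrow> emeasure riesz_measure A = outer A"
proof -
  let ?S = "lambda_system UNIV (Pow UNIV) outer"
  have ms: "measure_space UNIV ?S outer"
    using sigma_algebra.caratheodory_lemma[OF sigma_algebra_Pow outer_measure_space_outer] .
  have op: "U \<in> ?S" if "open U" for U
  proof -
    have "outer (U \<inter> T) + outer ((UNIV - U) \<inter> T) = outer T" for T
    proof (rule antisym)
      show "outer (U \<inter> T) + outer ((UNIV - U) \<inter> T) \<le> outer T"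
        using outer_open_split[OF that, of T] by (simp add: Int_commute Diff_eq)
      have "subadditive (Pow UNIV) outer"
        using outer_measure_space_outer
          ring_of_sets.countably_subadditive_subadditive[of UNIV "Pow UNIV" outer]
          algebra.axioms(1)[OF algebra_Pow[of UNIV]]
        by (simp add: outer_measure_space_def)
      then have "outer ((U \<inter> T) \<union> ((UNIV - U) \<inter> T)) \<le> outer (U \<inter> T) + outer ((UNIV - U) \<inter> T)"
        by (rule subadditiveD) auto
      then show "outer T \<le> outer (U \<inter> T) + outer ((UNIV - U) \<inter> T)"
        by (simp flip: Int_Un_distrib2 add: Diff_eq)
    qed
    then show ?thesis by (auto simp: lambda_system_def)
  qed
  have sub: "sets borel \<subseteq> ?S"
    unfolding borel_def using ms op
    by (auto simp: measure_space_def intro: sigma_algebra.sigma_sets_subset[THEN subsetD, rotated 2])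
  have "measure_space UNIV (sets borel) outer"
    using ms sub sets.sigma_algebra_axioms[of "borel :: 'a measure"]
    by (auto simp: measure_space_def positive_def countably_additive_def; blast)
  then show "A \<in> sets borel \<Longrightarrow> emeasure riesz_measure A = outer A"
    unfolding riesz_measure_def
    by (intro emeasure_measure_of_sigma) (auto simp: measure_space_def)
qed

lemma riesz_borel_probs: "riesz_measure \<in> borel_probs"
  using emeasure_riesz[of UNIV] sets_riesz sets_eq_imp_space_eq[OF sets_riesz]
  by (auto simp: borel_probs_def outer_open UNIV_content intro!: prob_spaceI)

lemma riesz_open: "\<phi> \<in> below U \<Longrightarrow> open U \<Longrightarrow> L \<phi> \<le> measure riesz_measure U"
proof -
  interpret prob_space riesz_measure using borel_probsD(1)[OF riesz_borel_probs] .
  assume "\<phi> \<in> below U" "open U"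
  then have "ennreal (L \<phi>) \<le> emeasure riesz_measure U"
    by (simp add: emeasure_riesz outer_open content_lower)
  then show ?thesis by (simp add: emeasure_eq_measure)
qed

text \<open>Cut \<open>\<phi>\<close> into \<open>n\<close> horizontal layers of height \<open>1 / n\<close>. The layer \<open>k\<close>, rescaled to height \<open>1\<close>, lies below the open set
where \<open>\<phi>\<close> exceeds \<open>k / n\<close>, and the average of the indicators of these sets exceeds \<open>\<phi>\<close> by at most \<open>1 / n\<close>.\<close>

lemma riesz_le:
  assumes c: "continuous_on UNIV \<phi>" and r: "\<And>x. 0 \<le> \<phi> x \<and> \<phi> x \<le> 1"
  shows "L \<phi> \<le> (\<integral>x. \<phi> x \<partial>riesz_measure)"
proof -
  interpret prob_space riesz_measure using borel_probsD(1)[OF riesz_borel_probs] .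
  have approx: "L \<phi> \<le> (\<integral>x. \<phi> x \<partial>riesz_measure) + 1 / real n" if n: "n > 0" for n
  proof -
    define l where "l k x = min (max (real n * \<phi> x - real k) 0) 1" for k x
    define U where "U k = {x. real k < real n * \<phi> x}" for k
    have U: "open (U k)" for k unfolding U_def by (intro open_Collect_less continuous_intros c)
    have lc: "continuous_on UNIV (l k)" for k unfolding l_def by (intro continuous_intros c)
    have lU: "l k \<in> below (U k)" for k
      using lc[of k] by (auto simp: below_def l_def U_def indicator_def)
    have layers: "(\<Sum>k<j. min (max (y - real k) 0) 1) = min y (real j)" if "0 \<le> y" for y :: real and j :: nat
      using that by (induction j) (auto simp: min_def max_def)
    \<comment> \<open>The layers add up to \<open>\<phi>\<close>, because \<open>\<phi> \<le> 1\<close>.\<close>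
    have suml: "real n * \<phi> x = (\<Sum>k<n. l k x)" for x
      using layers[of "real n * \<phi> x" n] r[of x] unfolding l_def
      by (simp add: min_def mult_left_le)
    have count: "(\<Sum>k<j. indicator {k. real k < y} k) \<le> y + (1::real)" if "0 \<le> y" for y :: real and j :: nat
    proof -
      have "(\<Sum>k<j. indicator {k. real k < y} k :: real) = real (card ({..<j} \<inter> {k. real k < y}))"
        by (simp add: indicator_def sum.If_cases)
      also have "\<dots> \<le> real (card {..<nat \<lceil>y\<rceil>})"
        by (intro of_nat_mono card_mono) (auto, linarith)
      also have "\<dots> \<le> y + 1" using that by (simp; linarith)
      finally show ?thesis .
    qed
    have "real n * L \<phi> = (\<Sum>k<n. L (l k))"
      using scale[OF c, of "real n"] sum[of "{..<n}" l] lc suml by simp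
    also have "\<dots> \<le> (\<Sum>k<n. measure riesz_measure (U k))"
      by (intro sum_mono riesz_open lU U)
    also have "\<dots> = (\<Sum>k<n. \<integral>x. indicator (U k) x \<partial>riesz_measure)"
      using U sets_riesz borel_probsD(3)[OF riesz_borel_probs] by simp
    also have "\<dots> = (\<integral>x. (\<Sum>k<n. indicator (U k) x) \<partial>riesz_measure)"
      using U sets_riesz by (subst Bochner_Integration.integral_sum)
        (auto simp: integrable_indicator_iff emeasure_eq_measure)
    also have "\<dots> \<le> (\<integral>x. real n * \<phi> x + 1 \<partial>riesz_measure)"
    proof (intro integral_mono)
      show "(\<Sum>k<n. indicator (U k) x) \<le> real n * \<phi> x + 1" for x
        using count[of "real n * \<phi> x" n] r[of x] by (simp add: U_def indicator_def)
      show "integrable riesz_measure (\<lambda>x. \<Sum>k<n. indicator (U k) x :: real)"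
        using U sets_riesz by (intro Bochner_Integration.integrable_sum)
          (auto simp: integrable_indicator_iff emeasure_eq_measure)
      show "integrable riesz_measure (\<lambda>x. real n * \<phi> x + 1)"
        by (intro continuous_integrable compact_space_UNIV riesz_borel_probs continuous_intros c)
    qed
    also have "\<dots> = real n * (\<integral>x. \<phi> x \<partial>riesz_measure) + 1"
      using continuous_integrable[OF compact_space_UNIV riesz_borel_probs c] prob_space by simp
    finally show ?thesis using n by (simp add: field_simps)
  qed
  have "(\<lambda>n. (\<integral>x. \<phi> x \<partial>riesz_measure) + 1 / real n) \<longlonglongrightarrow> (\<integral>x. \<phi> x \<partial>riesz_measure) + 0"
    by (intro tendsto_intros lim_1_over_n)
  then show ?thesis
    using approx by (intro LIMSEQ_le_const[where X="\<lambda>n. (\<integral>x. \<phi> x \<partial>riesz_measure) + 1 / real n"])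
      (auto intro!: exI[of _ 1])
qed

text \<open>The one-sided estimate applied to \<open>\<phi>\<close> and to \<open>1 - \<phi>\<close> gives equality, since both sides have mass one.\<close>

lemma riesz_unit:
  assumes c: "continuous_on UNIV \<phi>" and r: "\<And>x. 0 \<le> \<phi> x \<and> \<phi> x \<le> 1"
  shows "L \<phi> = (\<integral>x. \<phi> x \<partial>riesz_measure)"
proof -
  interpret prob_space riesz_measure using borel_probsD(1)[OF riesz_borel_probs] .
  have "L (\<lambda>x. 1 - \<phi> x) \<le> (\<integral>x. 1 - \<phi> x \<partial>riesz_measure)"
    by (rule riesz_le) (use r in \<open>auto intro!: continuous_intros c\<close>)
  then have "1 - L \<phi> \<le> 1 - (\<integral>x. \<phi> x \<partial>riesz_measure)"
    using diff[of "\<lambda>_. 1" \<phi>] c one prob_space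
      continuous_integrable[OF compact_space_UNIV riesz_borel_probs c] by simp
  with riesz_le[OF assms] show ?thesis by simp
qed

theorem riesz_representation:
  assumes c: "continuous_on UNIV \<phi>"
  shows "L \<phi> = (\<integral>x. \<phi> x \<partial>riesz_measure)"
proof -
  interpret prob_space riesz_measure using borel_probsD(1)[OF riesz_borel_probs] .
  obtain B where B: "B > 0" "\<And>x. \<bar>\<phi> x\<bar> \<le> B"
    using continuous_bounded[OF compact_space_UNIV c] by blast
  define \<psi> where "\<psi> x = 1/2 + (1 / (2*B)) * \<phi> x" for x
  have "0 \<le> \<psi> x \<and> \<psi> x \<le> 1" for x
    using B(1) B(2)[of x] unfolding \<psi>_def by (auto simp: field_simps abs_le_iff)
  moreover have "continuous_on UNIV \<psi>" unfolding \<psi>_def by (intro continuous_intros c)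
  ultimately have "L \<psi> = (\<integral>x. \<psi> x \<partial>riesz_measure)" by (intro riesz_unit) auto
  moreover have "L \<psi> = 1/2 + (1 / (2*B)) * L \<phi>"
    using add[OF continuous_on_const continuous_on_mult[OF continuous_on_const c], of "1/2" "1/(2*B)"]
      scale[OF c, of "1/(2*B)"]
    unfolding \<psi>_def by (simp add: const)
  moreover have "(\<integral>x. \<psi> x \<partial>riesz_measure) = 1/2 + (1 / (2*B)) * (\<integral>x. \<phi> x \<partial>riesz_measure)"
    using continuous_integrable[OF compact_space_UNIV riesz_borel_probs c] prob_space
    unfolding \<psi>_def by simp
  ultimately show ?thesis using B(1) by simp
qed

lemma riesz_outer_regular:
  assumes "A \<in> sets borel" "e > 0"
  shows "\<exists>U. open U \<and> A \<subseteq> U \<and> measure riesz_measure U \<le> measure riesz_measure A + e"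
proof -
  interpret prob_space riesz_measure using borel_probsD(1)[OF riesz_borel_probs] .
  obtain U where U: "open U" "A \<subseteq> U" "content U \<le> outer A + ennreal e"
    using outer_close[OF assms(2)] .
  then have "ennreal (measure riesz_measure U) \<le> ennreal (measure riesz_measure A) + ennreal e"
    using emeasure_riesz[of U] emeasure_riesz[OF assms(1)] by (simp add: emeasure_eq_measure outer_open)
  also have "\<dots> = ennreal (measure riesz_measure A + e)"
    using assms(2) by (simp add: ennreal_plus)
  finally have "measure riesz_measure U \<le> measure riesz_measure A + e"
    using assms(2) by (subst (asm) ennreal_le_iff) auto
  then show ?thesis using U by (auto intro!: exI[of _ U])
qed

end

lemma functional_of_measure:
  assumes "compact (UNIV :: 'a::metric_space set)" "\<mu> \<in> borel_probs"
  shows "normalised_positive_functional (\<lambda>\<phi> :: 'a \<Rightarrow> real. \<integral>x. \<phi> x \<partial>\<mu>)"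
proof -
  interpret prob_space \<mu> using borel_probsD(1)[OF assms(2)] .
  show ?thesis
    by unfold_locales (auto simp: assms continuous_integrable prob_space)
qed

text \<open>Since a Borel probability measure is determined by its integrals, it is the Riesz measure of its own integration
functional and so inherits outer regularity from the construction; complements turn this into inner
regularity.\<close>

lemma closed_inner_regular:
  assumes cpt: "compact (UNIV :: 'a::metric_space set)" and \<mu>: "\<mu> \<in> borel_probs"
    and A: "(A :: 'a set) \<in> sets borel" and "e > 0"
  shows "\<exists>C. closed C \<and> C \<subseteq> A \<and> measure \<mu> (A - C) \<le> e"
proof -
  interpret prob_space \<mu> using borel_probsD(1)[OF \<mu>] .
  interpret normalised_positive_functional "\<lambda>\<phi> :: 'a \<Rightarrow> real. \<integral>x. \<phi> x \<partial>\<mu>"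
    using functional_of_measure[OF cpt \<mu>] .
  have "\<mu> = riesz_measure"
    by (intro borel_probs_eqI \<mu> riesz_borel_probs riesz_representation)
  then obtain U where U: "open U" "- A \<subseteq> U" "measure \<mu> U \<le> measure \<mu> (- A) + e"
    using riesz_outer_regular[of "- A" e] A \<open>e > 0\<close> by auto
  have s: "sets \<mu> = sets borel" using borel_probsD(2)[OF \<mu>] .
  have "measure \<mu> (A - (- U)) = measure \<mu> (U - (- A))" by (rule arg_cong[of _ _ "measure \<mu>"]) auto
  also have "\<dots> = measure \<mu> U - measure \<mu> (- A)"
    using U A s by (intro finite_measure_Diff) auto
  finally show ?thesis using U by (intro exI[of _ "- U"]) auto
qed

section \<open>Compactness in the weak-star topology\<close>

lemma continuous_map_integral:
  assumes "continuous_on UNIV (\<phi> :: 'a::topological_space \<Rightarrow> real)"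
  shows "continuous_map weak_star euclideanreal (\<lambda>\<mu>. \<integral>x. \<phi> x \<partial>\<mu>)"
proof -
  have "openin weak_star {\<mu> \<in> borel_probs. (\<integral>x. \<phi> x \<partial>\<mu>) \<in> U}" if "open U" for U
    unfolding weak_star_def using assms that by (intro topology_generated_by_Basis) blast
  then show ?thesis by (auto simp: continuous_map_def topspace_weak_star)
qed

definition evaluation :: "'a::topological_space measure \<Rightarrow> ('a \<Rightarrow> real) \<Rightarrow> real" where
  "evaluation \<mu> = (\<lambda>\<phi>\<in>{\<phi>. continuous_on UNIV \<phi>}. \<integral>x. \<phi> x \<partial>\<mu>)"

abbreviation functional_space :: "(('a::topological_space \<Rightarrow> real) \<Rightarrow> real) topology" where
  "functional_space \<equiv> product_topology (\<lambda>_. euclideanreal) {\<phi>. continuous_on UNIV \<phi>}"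

text \<open>The weak-star topology is induced by evaluation at continuous functions; this allows covers to be transported
to a power of the real line.\<close>

lemma weak_star_open_pullback:
  fixes W :: "'a::topological_space measure set"
  assumes "openin weak_star W"
  shows "\<exists>V. openin functional_space V \<and>
    W = {\<mu> \<in> borel_probs. evaluation \<mu> \<in> V}"
  using openin_topology_generated_by[OF assms[unfolded weak_star_def]]
proof (induction rule: generate_topology_on.induct)
  case Empty
  then show ?case by (intro exI[of _ "{}"]) auto
next
  case (Int a b)
  then obtain V V' where V: "openin functional_space V" "openin functional_space V'"
    "a = {\<mu> \<in> borel_probs. evaluation \<mu> \<in> V}" "b = {\<mu> \<in> borel_probs. evaluation \<mu> \<in> V'}" by blast
  then show ?case by (intro exI[of _ "V \<inter> V'"]) (auto intro: openin_Int)
next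
  case (UN K)
  then have "\<forall>k\<in>K. \<exists>V. openin functional_space V \<and> k = {\<mu> \<in> borel_probs. evaluation \<mu> \<in> V}" by blast
  from bchoice[OF this] obtain V where "\<forall>k\<in>K. openin functional_space (V k) \<and>
    k = {\<mu> \<in> borel_probs. evaluation \<mu> \<in> V k}" ..
  then have V: "\<And>k. k \<in> K \<Longrightarrow> openin functional_space (V k)"
    "\<And>k. k \<in> K \<Longrightarrow> k = {\<mu> \<in> borel_probs. evaluation \<mu> \<in> V k}" by blast+
  have "\<Union>K = {\<mu> \<in> borel_probs. evaluation \<mu> \<in> \<Union>(V ` K)}" using V(2) by blast
  then show ?case using V(1) by (intro exI[of _ "\<Union>(V ` K)"]) auto
next
  case (Basis s)
  then have "\<exists>(\<phi> :: 'a \<Rightarrow> real) U. s = {\<mu> \<in> borel_probs. (\<integral>x. \<phi> x \<partial>\<mu>) \<in> U} \<and> continuous_on UNIV \<phi> \<and> open U"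
    by (simp only: mem_Collect_eq)
  then obtain \<phi> :: "'a \<Rightarrow> real" and U where s: "s = {\<mu> \<in> borel_probs. (\<integral>x. \<phi> x \<partial>\<mu>) \<in> U}"
    and \<phi>: "continuous_on UNIV \<phi>" and U: "open U" by (elim exE conjE)
  have "openin functional_space {L \<in> topspace functional_space. L \<phi> \<in> U}"
    using continuous_map_product_projection[of \<phi> "{\<phi>. continuous_on UNIV \<phi>}" "\<lambda>_. euclideanreal"] \<phi> U
    by (intro openin_continuous_map_preimage[where Y=euclideanreal]) auto
  moreover have "s = {\<mu> \<in> borel_probs. evaluation \<mu> \<in> {L \<in> topspace functional_space. L \<phi> \<in> U}}"
    using \<phi> unfolding s by (auto simp: evaluation_def)
  ultimately show ?case by blast
qed

text \<open>Evaluations lie in a product of compact intervals, which is compact by Tychonoff's theorem. Linearity, positivity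
and normalisation each constrain finitely many coordinates at a time, hence define closed sets, and by the Riesz
theorem these closed conditions leave exactly the evaluations of Borel probability measures.\<close>

lemma compact_evaluation_image:
  assumes cpt: "compact (UNIV :: 'a::metric_space set)"
  shows "compactin functional_space (evaluation ` (borel_probs :: 'a measure set))"
proof -
  let ?P = "functional_space :: (('a \<Rightarrow> real) \<Rightarrow> real) topology"
  let ?I = "{\<phi> :: 'a \<Rightarrow> real. continuous_on UNIV \<phi>}"
  have "\<forall>\<phi>\<in>?I. \<exists>B. \<forall>x. \<bar>\<phi> x\<bar> \<le> B"
    using continuous_bounded[OF cpt] by (metis mem_Collect_eq)
  then obtain B where B: "\<And>\<phi> x. \<phi> \<in> ?I \<Longrightarrow> \<bar>\<phi> x\<bar> \<le> B \<phi>" by metis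
  define Box where "Box = (\<Pi>\<^sub>E \<phi>\<in>?I. {- B \<phi> .. B \<phi>})"
  have Box: "compactin ?P Box" unfolding Box_def by (auto simp: compactin_PiE)
  have proj: "continuous_map ?P euclideanreal (\<lambda>L. L \<phi>)" if "\<phi> \<in> ?I" for \<phi>
    using continuous_map_product_projection[OF that, of "\<lambda>_. euclideanreal"] by simp
  define Q1 where "Q1 = (\<Inter>(\<phi>,\<psi>)\<in>?I \<times> ?I. {L \<in> topspace ?P. L (\<lambda>x. \<phi> x + \<psi> x) - L \<phi> - L \<psi> \<in> {0}})"
  define Q2 where "Q2 = (\<Inter>(c,\<phi>)\<in>UNIV \<times> ?I. {L \<in> topspace ?P. L (\<lambda>x. c * \<phi> x) - c * L \<phi> \<in> {0}})"
  define Q3 where "Q3 = (\<Inter>\<phi>\<in>{\<phi>\<in>?I. \<forall>x. 0 \<le> \<phi> x}. {L \<in> topspace ?P. L \<phi> \<in> {0..}})"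
  define Q4 where "Q4 = {L \<in> topspace ?P. L (\<lambda>_. 1) \<in> {1}}"
  have ne: "(\<lambda>_. 0) \<in> {\<phi>\<in>?I. \<forall>x. 0 \<le> \<phi> x}" by auto
  have cl: "closedin ?P {L \<in> topspace ?P. F L \<in> S}"
    if "continuous_map ?P euclideanreal F" "closed S" for F S
    using closedin_continuous_map_preimage[OF that(1), of S] that(2) by simp
  have "closedin ?P Q1" unfolding Q1_def
  proof (rule closedin_INT)
    show "?I \<times> ?I \<noteq> {}" using ne by blast
    fix p assume "p \<in> ?I \<times> ?I"
    then obtain \<phi> \<psi> where p: "p = (\<phi>, \<psi>)" "\<phi> \<in> ?I" "\<psi> \<in> ?I" by blast
    have "continuous_map ?P euclideanreal (\<lambda>L. L (\<lambda>x. \<phi> x + \<psi> x) - L \<phi> - L \<psi>)"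
      using p by (intro continuous_map_diff proj) (auto intro: continuous_on_add)
    from cl[OF this, of "{0}"]
    show "closedin ?P (case p of (\<phi>, \<psi>) \<Rightarrow> {L \<in> topspace ?P. L (\<lambda>x. \<phi> x + \<psi> x) - L \<phi> - L \<psi> \<in> {0}})"
      unfolding p(1) prod.case by simp
  qed
  moreover have "closedin ?P Q2" unfolding Q2_def
  proof (rule closedin_INT)
    show "(UNIV :: real set) \<times> ?I \<noteq> {}" using ne by blast
    fix p assume "p \<in> (UNIV :: real set) \<times> ?I"
    then obtain c \<phi> where p: "p = (c, \<phi>)" "\<phi> \<in> ?I" by blast
    have "continuous_map ?P euclideanreal (\<lambda>L. L (\<lambda>x. c * \<phi> x) - c * L \<phi>)"
      using p by (intro continuous_map_diff continuous_map_real_mult proj) (auto intro: continuous_on_mult_left)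
    from cl[OF this, of "{0}"]
    show "closedin ?P (case p of (c, \<phi>) \<Rightarrow> {L \<in> topspace ?P. L (\<lambda>x. c * \<phi> x) - c * L \<phi> \<in> {0}})"
      unfolding p(1) prod.case by simp
  qed
  moreover have "closedin ?P Q3" unfolding Q3_def
  proof (rule closedin_INT)
    show "{\<phi>\<in>?I. \<forall>x. 0 \<le> \<phi> x} \<noteq> {}" using ne by blast
    fix \<phi> assume "\<phi> \<in> {\<phi>\<in>?I. \<forall>x. 0 \<le> \<phi> x}"
    then show "closedin ?P {L \<in> topspace ?P. L \<phi> \<in> {0..}}" by (intro cl proj) simp_all
  qed
  moreover have "closedin ?P Q4" unfolding Q4_def
    by (intro cl proj) simp_all
  ultimately have "compactin ?P (Q1 \<inter> (Q2 \<inter> (Q3 \<inter> (Q4 \<inter> Box))))"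
    by (intro closed_Int_compactin Box)
  also have "Q1 \<inter> (Q2 \<inter> (Q3 \<inter> (Q4 \<inter> Box))) = evaluation ` borel_probs"
  proof (intro subset_antisym subsetI)
    fix L assume L: "L \<in> Q1 \<inter> (Q2 \<inter> (Q3 \<inter> (Q4 \<inter> Box)))"
    interpret normalised_positive_functional L
    proof
      show "compact (UNIV :: 'a set)" by (rule cpt)
      show "L (\<lambda>x. \<phi> x + \<psi> x) = L \<phi> + L \<psi>" if "continuous_on UNIV \<phi>" "continuous_on UNIV \<psi>" for \<phi> \<psi>
      proof -
        have "L \<in> Q1" "(\<phi>, \<psi>) \<in> ?I \<times> ?I" using L that by auto
        from INT_D[OF this[unfolded Q1_def]] show ?thesis unfolding prod.case by simp
      qed
      show "L (\<lambda>x. c * \<phi> x) = c * L \<phi>" if "continuous_on UNIV \<phi>" for c \<phi>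
      proof -
        have "L \<in> Q2" "(c, \<phi>) \<in> UNIV \<times> ?I" using L that by auto
        from INT_D[OF this[unfolded Q2_def]] show ?thesis unfolding prod.case by simp
      qed
      show "0 \<le> L \<phi>" if "continuous_on UNIV \<phi>" "\<And>x. 0 \<le> \<phi> x" for \<phi>
      proof -
        have "L \<in> Q3" "\<phi> \<in> {\<phi>\<in>?I. \<forall>x. 0 \<le> \<phi> x}" using L that by auto
        from INT_D[OF this[unfolded Q3_def]] show ?thesis by simp
      qed
      show "L (\<lambda>_. 1) = 1" using L unfolding Q4_def by simp
    qed
    have "L \<in> Box" using L by blast
    have "L = evaluation riesz_measure"
    proof
      fix \<phi> show "L \<phi> = evaluation riesz_measure \<phi>"
        using riesz_representation[of \<phi>] PiE_arb[OF \<open>L \<in> Box\<close>[unfolded Box_def], of \<phi>]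
        by (simp add: evaluation_def)
    qed
    then show "L \<in> evaluation ` borel_probs" using riesz_borel_probs by blast
  next
    fix L assume "L \<in> evaluation ` (borel_probs :: 'a measure set)"
    then obtain \<mu> where L: "L = evaluation \<mu>" and \<mu>: "\<mu> \<in> borel_probs" by blast
    interpret normalised_positive_functional "\<lambda>\<phi> :: 'a \<Rightarrow> real. \<integral>x. \<phi> x \<partial>\<mu>"
      using functional_of_measure[OF cpt \<mu>] .
    have L': "L \<phi> = (\<integral>x. \<phi> x \<partial>\<mu>)" if "continuous_on UNIV \<phi>" for \<phi>
      using that by (simp add: L evaluation_def)
    have top: "L \<in> topspace ?P" by (simp add: L evaluation_def)
    have "L \<in> Box" unfolding Box_def
    proof (rule PiE_I)
      fix \<phi> assume "\<phi> \<in> ?I"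
      then have c: "continuous_on UNIV \<phi>" by simp
      have "- B \<phi> \<le> \<phi> x" "\<phi> x \<le> B \<phi>" for x
        using B[OF \<open>\<phi> \<in> ?I\<close>, of x] by (auto simp: abs_le_iff)
      then have "(\<integral>x. - B \<phi> \<partial>\<mu>) \<le> (\<integral>x. \<phi> x \<partial>\<mu>)" "(\<integral>x. \<phi> x \<partial>\<mu>) \<le> (\<integral>x. B \<phi> \<partial>\<mu>)"
        using c by (intro mono continuous_on_const; simp)+
      then have "- B \<phi> \<le> (\<integral>x. \<phi> x \<partial>\<mu>)" "(\<integral>x. \<phi> x \<partial>\<mu>) \<le> B \<phi>" unfolding const .
      then show "L \<phi> \<in> {- B \<phi> .. B \<phi>}" by (simp add: L'[OF c])
    next
      fix \<phi> :: "'a \<Rightarrow> real" assume "\<phi> \<notin> ?I"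
      then show "L \<phi> = undefined" by (simp add: L evaluation_def)
    qed
    moreover have "L \<in> Q1" unfolding Q1_def
    proof (rule INT_I)
      fix p assume "p \<in> ?I \<times> ?I"
      then obtain \<phi> \<psi> where p: "p = (\<phi>, \<psi>)" "continuous_on UNIV \<phi>" "continuous_on UNIV \<psi>" by blast
      have "L (\<lambda>x. \<phi> x + \<psi> x) - L \<phi> - L \<psi> = 0"
        using add[OF p(2,3)] p by (simp add: L' continuous_on_add)
      then show "L \<in> (case p of (\<phi>, \<psi>) \<Rightarrow> {L \<in> topspace ?P. L (\<lambda>x. \<phi> x + \<psi> x) - L \<phi> - L \<psi> \<in> {0}})"
        using top unfolding p(1) prod.case by simp
    qed
    moreover have "L \<in> Q2" unfolding Q2_def
    proof (rule INT_I)
      fix p assume "p \<in> (UNIV :: real set) \<times> ?I"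
      then obtain c \<phi> where p: "p = (c, \<phi>)" "continuous_on UNIV \<phi>" by blast
      have "L (\<lambda>x. c * \<phi> x) - c * L \<phi> = 0"
        using scale[OF p(2)] p by (simp add: L' continuous_on_mult_left)
      then show "L \<in> (case p of (c, \<phi>) \<Rightarrow> {L \<in> topspace ?P. L (\<lambda>x. c * \<phi> x) - c * L \<phi> \<in> {0}})"
        using top unfolding p(1) prod.case by simp
    qed
    moreover have "L \<in> Q3" unfolding Q3_def
    proof (rule INT_I)
      fix \<phi> assume "\<phi> \<in> {\<phi>\<in>?I. \<forall>x. 0 \<le> \<phi> x}"
      then show "L \<in> {L \<in> topspace ?P. L \<phi> \<in> {0..}}" using nonneg[of \<phi>] top by (simp add: L')
    qed
    moreover have "L \<in> Q4" using one top by (simp add: Q4_def L')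
    ultimately show "L \<in> Q1 \<inter> (Q2 \<inter> (Q3 \<inter> (Q4 \<inter> Box)))" by blast
  qed
  finally show ?thesis .
qed

theorem compactin_borel_probs:
  assumes cpt: "compact (UNIV :: 'a::metric_space set)"
  shows "compactin weak_star (borel_probs :: 'a measure set)"
  unfolding compactin_def
proof (intro conjI allI impI)
  show "borel_probs \<subseteq> topspace weak_star" by (simp add: topspace_weak_star)
  fix \<U> :: "'a measure set set" assume \<U>: "Ball \<U> (openin weak_star) \<and> borel_probs \<subseteq> \<Union>\<U>"
  then have "\<forall>W\<in>\<U>. \<exists>V. openin functional_space V \<and> W = {\<mu> \<in> borel_probs. evaluation \<mu> \<in> V}"
    using weak_star_open_pullback by blast
  from bchoice[OF this] obtain V where "\<forall>W\<in>\<U>. openin functional_space (V W) \<and>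
    W = {\<mu> \<in> borel_probs. evaluation \<mu> \<in> V W}" ..
  then have V: "\<And>W. W \<in> \<U> \<Longrightarrow> openin functional_space (V W)"
    "\<And>W. W \<in> \<U> \<Longrightarrow> W = {\<mu> \<in> borel_probs. evaluation \<mu> \<in> V W}" by blast+
  have "evaluation ` borel_probs \<subseteq> \<Union>(V ` \<U>)"
  proof (rule image_subsetI)
    fix \<mu> :: "'a measure" assume "\<mu> \<in> borel_probs"
    then obtain W where "W \<in> \<U>" "\<mu> \<in> W" using \<U> by blast
    then show "evaluation \<mu> \<in> \<Union>(V ` \<U>)" using V(2)[of W] by blast
  qed
  then obtain \<F> where F: "finite \<F>" "\<F> \<subseteq> V ` \<U>" "evaluation ` borel_probs \<subseteq> \<Union>\<F>"
    using compactinD[OF compact_evaluation_image[OF cpt], of "V ` \<U>"] V(1) by (metis imageE)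
  then obtain \<G> where G: "\<G> \<subseteq> \<U>" "finite \<G>" "\<F> = V ` \<G>" by (metis finite_subset_image)
  have "borel_probs \<subseteq> \<Union>\<G>"
  proof
    fix \<mu> :: "'a measure" assume \<mu>: "\<mu> \<in> borel_probs"
    then obtain W where "W \<in> \<G>" "evaluation \<mu> \<in> V W" using F(3) G(3) by blast
    then show "\<mu> \<in> \<Union>\<G>" using V(2)[of W] G(1) \<mu> by blast
  qed
  then show "\<exists>\<F>. finite \<F> \<and> \<F> \<subseteq> \<U> \<and> borel_probs \<subseteq> \<Union>\<F>" using G by blast
qed

text \<open>If every point of \<open>K\<close> had a neighbourhood that contains \<open>s n\<close> for finitely many \<open>n\<close> in \<open>A\<close> only, then finitely many such
neighbourhoods would cover \<open>K\<close> and make \<open>A\<close> finite.\<close>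

lemma cluster_point:
  assumes "compactin T K" "infinite A" "\<And>n::nat. n \<in> A \<Longrightarrow> s n \<in> K"
  obtains p where "p \<in> K" "\<And>U. openin T U \<Longrightarrow> p \<in> U \<Longrightarrow> infinite {n \<in> A. s n \<in> U}"
proof (rule ccontr)
  assume "\<not> thesis"
  then have "\<forall>p\<in>K. \<exists>U. openin T U \<and> p \<in> U \<and> finite {n \<in> A. s n \<in> U}" using that by blast
  then obtain U where U: "\<And>p. p \<in> K \<Longrightarrow> openin T (U p) \<and> p \<in> U p \<and> finite {n \<in> A. s n \<in> U p}"
    by metis
  then have "Ball (U ` K) (openin T) \<and> K \<subseteq> \<Union>(U ` K)" by blast
  then obtain \<F> where F: "finite \<F>" "\<F> \<subseteq> U ` K" "K \<subseteq> \<Union>\<F>"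
    using compactinD[OF assms(1), of "U ` K"] by auto
  have "A \<subseteq> (\<Union>W\<in>\<F>. {n \<in> A. s n \<in> W})"
  proof
    fix n assume "n \<in> A"
    then have "s n \<in> \<Union>\<F>" using assms(3) F(3) by blast
    then show "n \<in> (\<Union>W\<in>\<F>. {n \<in> A. s n \<in> W})" using \<open>n \<in> A\<close> by blast
  qed
  moreover have "finite (\<Union>W\<in>\<F>. {n \<in> A. s n \<in> W})"
  proof (rule finite_UN_I[OF F(1)])
    fix W assume "W \<in> \<F>"
    then obtain p where "p \<in> K" "W = U p" using F(2) by blast
    then show "finite {n \<in> A. s n \<in> W}" using U by simp
  qed
  ultimately show False using assms(2) finite_subset by blast
qed

lemma distr_borel_probs:
  assumes "\<mu> \<in> borel_probs" "f \<in> borel_measurable borel"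
  shows "distr \<mu> borel f \<in> borel_probs"
proof -
  interpret prob_space \<mu> using borel_probsD(1)[OF assms(1)] .
  have "f \<in> borel_measurable \<mu>" using assms borel_probsD(2)[OF assms(1)] by (simp cong: measurable_cong_sets)
  then show ?thesis by (auto simp: borel_probs_def intro: prob_space_distr)
qed

text \<open>In this form invariance is a family of weak-star closed conditions, and it passes to cluster points.\<close>

lemma invariant_probs_iff:
  fixes f :: "'a::metric_space \<Rightarrow> 'a"
  assumes cpt: "compact (UNIV :: 'a set)" and f: "continuous_on UNIV f" and \<mu>: "\<mu> \<in> borel_probs"
  shows "\<mu> \<in> invariant_probs f \<longleftrightarrow>
    (\<forall>\<psi> :: 'a \<Rightarrow> real. continuous_on UNIV \<psi> \<longrightarrow> (\<integral>x. \<psi> (f x) \<partial>\<mu>) = (\<integral>x. \<psi> x \<partial>\<mu>))"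
proof -
  have fb: "f \<in> borel_measurable borel" using f by (rule borel_measurable_continuous_onI)
  have fm: "f \<in> borel_measurable \<mu>" using fb borel_probsD(2)[OF \<mu>] by (simp cong: measurable_cong_sets)
  have int: "(\<integral>x. \<psi> x \<partial>distr \<mu> borel f) = (\<integral>x. \<psi> (f x) \<partial>\<mu>)"
    if "continuous_on UNIV \<psi>" for \<psi> :: "'a \<Rightarrow> real"
    using that by (intro integral_distr fm borel_measurable_continuous_onI)
  have em: "emeasure (distr \<mu> borel f) A = emeasure \<mu> (f -` A)" if "A \<in> sets borel" for A
    using that fm borel_probsD(3)[OF \<mu>] by (simp add: emeasure_distr)
  have "\<mu> \<in> invariant_probs f \<longleftrightarrow> distr \<mu> borel f = \<mu>"
  proof
    assume "\<mu> \<in> invariant_probs f"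
    then show "distr \<mu> borel f = \<mu>"
      using em borel_probsD(2)[OF \<mu>] by (intro measure_eqI) (auto simp: invariant_probs_def)
  next
    assume "distr \<mu> borel f = \<mu>"
    then show "\<mu> \<in> invariant_probs f" using em \<mu> by (auto simp: invariant_probs_def)
  qed
  also have "\<dots> \<longleftrightarrow> (\<forall>\<psi> :: 'a \<Rightarrow> real. continuous_on UNIV \<psi> \<longrightarrow> (\<integral>x. \<psi> (f x) \<partial>\<mu>) = (\<integral>x. \<psi> x \<partial>\<mu>))"
    using int borel_probs_eqI[OF distr_borel_probs[OF \<mu> fb] \<mu>] by metis
  finally show ?thesis .
qed

lemma closedin_invariant_probs:
  fixes f :: "'a::metric_space \<Rightarrow> 'a"
  assumes cpt: "compact (UNIV :: 'a set)" and f: "continuous_on UNIV f"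
  shows "closedin weak_star (invariant_probs f)"
proof -
  let ?I = "{\<phi> :: 'a \<Rightarrow> real. continuous_on UNIV \<phi>}"
  have "invariant_probs f =
      (\<Inter>\<psi>\<in>?I. {\<mu> \<in> topspace weak_star. (\<integral>x. \<psi> (f x) \<partial>\<mu>) - (\<integral>x. \<psi> x \<partial>\<mu>) \<in> {0}})" (is "_ = ?R")
  proof (intro subset_antisym subsetI)
    fix \<mu> assume m: "\<mu> \<in> invariant_probs f"
    then have \<mu>: "\<mu> \<in> borel_probs" by (simp add: invariant_probs_def)
    show "\<mu> \<in> ?R" using m \<mu> invariant_probs_iff[OF cpt f \<mu>] by (simp add: topspace_weak_star)
  next
    fix \<mu> assume m: "\<mu> \<in> ?R"
    then have \<mu>: "\<mu> \<in> borel_probs"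
      using continuous_on_const[of UNIV "0::real"] by (auto simp: topspace_weak_star)
    show "\<mu> \<in> invariant_probs f" using m \<mu> invariant_probs_iff[OF cpt f \<mu>] by simp
  qed
  also have "closedin weak_star \<dots>"
    using continuous_on_const[of UNIV "0::real"] continuous_on_compose2[OF _ f]
    by (intro closedin_INT ballI closedin_continuous_map_preimage[where Y=euclideanreal]
        continuous_map_diff continuous_map_integral) auto
  finally show ?thesis .
qed

lemma compactin_invariant_probs:
  fixes f :: "'a::metric_space \<Rightarrow> 'a"
  assumes cpt: "compact (UNIV :: 'a set)" and f: "continuous_on UNIV f"
  shows "compactin weak_star (invariant_probs f)"
  using closed_compactin[OF compactin_borel_probs[OF cpt] _ closedin_invariant_probs[OF assms]]
  by (auto simp: invariant_probs_def)

text \<open>A case of the portmanteau theorem: bump functions of the interior bound \<open>\<nu> A\<close> from below, those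
of the complement of the closure bound it from above, and at \<open>\<mu>\<close> the two bounds agree in the limit.\<close>

lemma null_frontier_neighbourhood:
  assumes \<mu>: "\<mu> \<in> borel_probs" and A: "(A :: 'a::metric_space set) \<in> sets borel"
    and fr: "measure \<mu> (frontier A) = 0" and e: "e > 0"
  shows "\<exists>U. openin weak_star U \<and> \<mu> \<in> U \<and> (\<forall>\<nu>\<in>U. \<bar>measure \<nu> A - measure \<mu> A\<bar> < e)"
proof -
  interpret prob_space \<mu> using borel_probsD(1)[OF \<mu>] .
  have s: "sets \<mu> = sets borel" using borel_probsD(2)[OF \<mu>] .
  define J where "J = - closure A"
  have op: "open (interior A)" "open J" by (auto simp: J_def)
  have fr': "frontier A = closure A - interior A" by (simp add: frontier_def)
  have mJ: "measure \<mu> J = 1 - measure \<mu> (closure A)"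
    using prob_compl[of "closure A"] s borel_probsD(3)[OF \<mu>] by (simp add: J_def Compl_eq_Diff_UNIV)
  have "measure \<mu> (closure A) - measure \<mu> (interior A) = 0"
    using finite_measure_Diff[of "closure A" "interior A"] s fr interior_subset closure_subset
    by (metis closed_closure borel_closed borel_open fr' open_interior subset_trans)
  moreover have "measure \<mu> (interior A) \<le> measure \<mu> A" "measure \<mu> A \<le> measure \<mu> (closure A)"
    using s A by (simp_all add: finite_measure_mono interior_subset closure_subset)
  ultimately have eq: "measure \<mu> (interior A) = measure \<mu> A" "measure \<mu> J = 1 - measure \<mu> A"
    using mJ by linarith+
  have "\<forall>\<^sub>F n in sequentially. (\<integral>x. bump (interior A) n x \<partial>\<mu>) > measure \<mu> A - e"
    using order_tendstoD(1)[OF bump_integral_tendsto[OF \<mu> op(1)]] eq e by simp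
  moreover have "\<forall>\<^sub>F n in sequentially. (\<integral>x. bump J n x \<partial>\<mu>) > 1 - measure \<mu> A - e"
    using order_tendstoD(1)[OF bump_integral_tendsto[OF \<mu> op(2)]] eq e by simp
  ultimately obtain n where n: "(\<integral>x. bump (interior A) n x \<partial>\<mu>) > measure \<mu> A - e"
    "(\<integral>x. bump J n x \<partial>\<mu>) > 1 - measure \<mu> A - e"
    using eventually_happens'[OF sequentially_bot eventually_conj] by blast
  define U where "U = {\<nu> \<in> topspace weak_star. (\<integral>x. bump (interior A) n x \<partial>\<nu>) \<in> {measure \<mu> A - e<..}}
     \<inter> {\<nu> \<in> topspace weak_star. (\<integral>x. bump J n x \<partial>\<nu>) \<in> {1 - measure \<mu> A - e<..}}"
  have "openin weak_star U" unfolding U_def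
    by (intro openin_Int openin_continuous_map_preimage[where Y=euclideanreal] continuous_map_integral
        continuous_on_bump) auto
  moreover have "\<mu> \<in> U" using n \<mu> by (auto simp: U_def topspace_weak_star)
  moreover have "\<bar>measure \<nu> A - measure \<mu> A\<bar> < e" if \<nu>: "\<nu> \<in> U" for \<nu>
  proof -
    have b: "\<nu> \<in> borel_probs" using \<nu> by (auto simp: U_def topspace_weak_star)
    interpret n: prob_space \<nu> using borel_probsD(1)[OF b] .
    have s': "sets \<nu> = sets borel" using borel_probsD(2)[OF b] .
    have "measure \<nu> (interior A) \<le> measure \<nu> A" "measure \<nu> A \<le> measure \<nu> (- J)"
      using s' A by (simp_all add: n.finite_measure_mono interior_subset closure_subset J_def)
    moreover have "measure \<nu> (- J) = 1 - measure \<nu> J"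
      using n.prob_compl[of J] s' op borel_probsD(3)[OF b] by (simp add: Compl_eq_Diff_UNIV)
    moreover have "(\<integral>x. bump (interior A) n x \<partial>\<nu>) > measure \<mu> A - e" "(\<integral>x. bump J n x \<partial>\<nu>) > 1 - measure \<mu> A - e"
      using \<nu> by (auto simp: U_def)
    ultimately show ?thesis
      using bump_integral_le[OF b op(1), of n] bump_integral_le[OF b op(2), of n] by linarith
  qed
  ultimately show ?thesis by blast
qed

section \<open>Entropy of maps with finite range\<close>

text \<open>The terms of entropy sums are written with the usual letter \<open>\<eta>\<close>; \<open>ln 0 = 0\<close> gives the customary value at \<open>0\<close>.\<close>

abbreviation \<eta> :: "real \<Rightarrow> real" where
  "\<eta> t \<equiv> - t * ln t"

lemma neg_mult_ln_le:
  fixes p q :: real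
  assumes "0 \<le> p" "0 \<le> q" "p > 0 \<Longrightarrow> q > 0"
  shows "\<eta> p \<le> - p * ln q + (q - p)"
proof (cases "p = 0")
  case False
  then have pq: "p > 0" "q > 0" using assms by auto
  then have "ln (q / p) \<le> q / p - 1" by (intro ln_le_minus_one) simp
  then have "p * (ln q - ln p) \<le> p * (q / p - 1)" using pq by (intro mult_left_mono) (simp_all add: ln_div)
  also have "\<dots> = q - p" using pq by (simp add: field_simps)
  finally show ?thesis by (simp add: algebra_simps)
qed (use assms in simp)

text \<open>Termwise this is \<open>ln x \<le> x - 1\<close> with \<open>x = q i / p i\<close>.\<close>

lemma gibbs_inequality:
  fixes p q :: "'b \<Rightarrow> real"
  assumes "\<And>i. i \<in> I \<Longrightarrow> 0 \<le> p i" "\<And>i. i \<in> I \<Longrightarrow> 0 \<le> q i" "\<And>i. i \<in> I \<Longrightarrow> p i > 0 \<Longrightarrow> q i > 0"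
    and "sum q I \<le> sum p I"
  shows "(\<Sum>i\<in>I. \<eta> (p i)) \<le> (\<Sum>i\<in>I. - p i * ln (q i))"
proof -
  have "(\<Sum>i\<in>I. \<eta> (p i)) \<le> (\<Sum>i\<in>I. - p i * ln (q i) + (q i - p i))"
    by (intro sum_mono neg_mult_ln_le assms)
  also have "\<dots> = (\<Sum>i\<in>I. - p i * ln (q i)) + (sum q I - sum p I)"
    by (simp only: sum.distrib sum_subtractf)
  finally show ?thesis using assms(4) by linarith
qed

text \<open>Entropy plus energy is at most the logarithm of the partition function: the Gibbs inequality
against the weights \<open>exp (a i) / Z\<close>.\<close>

lemma gibbs_variational:
  fixes p a :: "'b \<Rightarrow> real"
  assumes "finite I" "\<And>i. i \<in> I \<Longrightarrow> 0 \<le> p i" "sum p I = 1"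
  shows "(\<Sum>i\<in>I. \<eta> (p i)) + (\<Sum>i\<in>I. p i * a i) \<le> ln (\<Sum>i\<in>I. exp (a i))"
proof -
  define Z where "Z = (\<Sum>i\<in>I. exp (a i))"
  have "I \<noteq> {}" using assms(3) by auto
  then have Z: "Z > 0" unfolding Z_def by (intro sum_pos assms) auto
  have "(\<Sum>i\<in>I. \<eta> (p i)) \<le> (\<Sum>i\<in>I. - p i * ln (exp (a i) / Z))"
    by (rule gibbs_inequality) (use assms Z in \<open>auto simp: Z_def simp flip: sum_divide_distrib\<close>)
  also have "\<dots> = (\<Sum>i\<in>I. p i * ln Z - p i * a i)"
    using Z by (intro sum.cong) (auto simp: ln_div algebra_simps)
  also have "\<dots> = ln Z - (\<Sum>i\<in>I. p i * a i)"
    using assms(3) by (simp add: sum_subtractf flip: sum_distrib_right)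
  finally show ?thesis by (simp add: Z_def)
qed

text \<open>Concavity of \<open>t \<mapsto> - t * ln t\<close>, obtained from the Gibbs inequality against the constant mean value. It makes
entropy a concave function of the measure.\<close>

lemma sum_neg_mult_ln_le:
  fixes t :: "'b \<Rightarrow> real"
  assumes "finite I" "I \<noteq> {}" "\<And>i. i \<in> I \<Longrightarrow> 0 \<le> t i"
  defines "a \<equiv> sum t I / real (card I)"
  shows "(\<Sum>i\<in>I. \<eta> (t i)) \<le> real (card I) * (- a * ln a)"
proof -
  have c: "real (card I) > 0" using assms by (simp add: card_gt_0_iff)
  have a: "real (card I) * a = sum t I" using c by (simp add: a_def)
  have an: "0 \<le> a" unfolding a_def using assms by (intro divide_nonneg_nonneg sum_nonneg) auto
  have pos: "a > 0" if "i \<in> I" "t i > 0" for i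
  proof -
    have "sum t I > 0" using assms that by (intro sum_pos2) auto
    then show ?thesis using c by (simp add: a_def)
  qed
  have "(\<Sum>i\<in>I. \<eta> (t i)) \<le> (\<Sum>i\<in>I. - t i * ln a)"
    by (rule gibbs_inequality) (use assms an pos a in auto)
  also have "\<dots> = (real (card I) * a) * - ln a"
    unfolding a by (simp add: sum_distrib_right sum_negf)
  finally show ?thesis by simp
qed

text \<open>Finite partitions are treated as fibres of maps with finite range: joins become tuples, and
refinement becomes functional dependence.\<close>

definition entropy_of :: "'b measure \<Rightarrow> ('b \<Rightarrow> 'c) \<Rightarrow> real" where
  "entropy_of M X = (\<Sum>v\<in>range X. \<eta> (measure M (X -` {v})))"

definition finite_valued :: "'b measure \<Rightarrow> ('b \<Rightarrow> 'c) \<Rightarrow> bool" where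
  "finite_valued M X \<longleftrightarrow> finite (range X) \<and> (\<forall>v. X -` {v} \<in> sets M)"

definition joint :: "('i \<Rightarrow> 'b \<Rightarrow> 'c) \<Rightarrow> 'i set \<Rightarrow> 'b \<Rightarrow> 'i \<Rightarrow> 'c" where
  "joint X J x = (\<lambda>j\<in>J. X j x)"

lemma joint_eq_iff: "joint X J x = joint X J y \<longleftrightarrow> (\<forall>j\<in>J. X j x = X j y)"
proof
  assume "joint X J x = joint X J y"
  then have "joint X J x j = joint X J y j" for j by simp
  then show "\<forall>j\<in>J. X j x = X j y" unfolding joint_def by (metis restrict_apply')
next
  assume "\<forall>j\<in>J. X j x = X j y"
  then show "joint X J x = joint X J y" unfolding joint_def by (intro restrict_ext) simp
qed

lemma entropy_of_superset:
  assumes "finite V" "range X \<subseteq> V"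
  shows "entropy_of M X = (\<Sum>v\<in>V. \<eta> (measure M (X -` {v})))"
  unfolding entropy_of_def
proof (rule sum.mono_neutral_left)
  show "\<forall>i\<in>V - range X. \<eta> (measure M (X -` {i})) = 0"
  proof
    fix i assume "i \<in> V - range X"
    then have "X -` {i} = {}" by auto
    then show "\<eta> (measure M (X -` {i})) = 0" by simp
  qed
qed (use assms in auto)

locale full_prob_space = prob_space M for M :: "'b measure" +
  assumes space_UNIV: "space M = UNIV"
begin

lemma prob_split:
  assumes "finite_valued M Z" "S \<in> sets M"
  shows "prob S = (\<Sum>w\<in>range Z. prob (S \<inter> Z -` {w}))"
proof -
  have "prob (\<Union>w\<in>range Z. S \<inter> Z -` {w}) = (\<Sum>w\<in>range Z. prob (S \<inter> Z -` {w}))"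
    using assms by (intro finite_measure_finite_Union) (auto simp: finite_valued_def disjoint_family_on_def)
  moreover have "(\<Union>w\<in>range Z. S \<inter> Z -` {w}) = S" by auto
  ultimately show ?thesis by simp
qed

lemma sum_prob:
  assumes "finite_valued M Z"
  shows "(\<Sum>w\<in>range Z. prob (Z -` {w})) = 1"
  using prob_split[OF assms sets.top] prob_space by (simp add: space_UNIV)

lemma prob_function:
  assumes "finite_valued M Z"
  shows "prob ((\<lambda>x. g (Z x)) -` {v}) = (\<Sum>w\<in>{w\<in>range Z. g w = v}. prob (Z -` {w}))"
    (is "prob ?S = _")
proof -
  have fin: "finite (range Z)" using assms by (simp add: finite_valued_def)
  have "prob (\<Union>w\<in>{w\<in>range Z. g w = v}. Z -` {w}) = (\<Sum>w\<in>{w\<in>range Z. g w = v}. prob (Z -` {w}))"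
    using assms fin by (intro finite_measure_finite_Union) (auto simp: finite_valued_def disjoint_family_on_def)
  moreover have "(\<Union>w\<in>{w\<in>range Z. g w = v}. Z -` {w}) = ?S" by auto
  ultimately show ?thesis by simp
qed

lemma finite_valued_function:
  assumes "finite_valued M Z"
  shows "finite_valued M (\<lambda>x. g (Z x))"
proof -
  have fin: "finite (range Z)" using assms by (simp add: finite_valued_def)
  have "(\<lambda>x. g (Z x)) -` {v} \<in> sets M" for v
  proof -
    have "(\<lambda>x. g (Z x)) -` {v} = (\<Union>w\<in>{w\<in>range Z. g w = v}. Z -` {w})" by auto
    also have "\<dots> \<in> sets M" using assms fin by (intro sets.finite_UN) (auto simp: finite_valued_def)
    finally show ?thesis .
  qed
  moreover have "finite (range (\<lambda>x. g (Z x)))" using fin by (metis finite_imageI image_image)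
  ultimately show ?thesis by (auto simp: finite_valued_def)
qed

lemma sum_prob_function:
  fixes h :: "'d \<Rightarrow> real"
  assumes "finite_valued M Z" and X: "X = (\<lambda>x. g (Z x))"
  shows "(\<Sum>w\<in>range Z. prob (Z -` {w}) * h (g w)) = (\<Sum>v\<in>range X. prob (X -` {v}) * h v)"
proof -
  have fin: "finite (range Z)" using assms by (simp add: finite_valued_def)
  have "(\<Sum>w\<in>range Z. prob (Z -` {w}) * h (g w)) =
      (\<Sum>v\<in>g ` range Z. \<Sum>w\<in>{w\<in>range Z. g w = v}. prob (Z -` {w}) * h (g w))"
    by (rule sum.image_gen[OF fin])
  also have "\<dots> = (\<Sum>v\<in>g ` range Z. prob ((\<lambda>x. g (Z x)) -` {v}) * h v)"
    by (intro sum.cong refl) (auto simp: prob_function[OF assms(1)] sum_distrib_right intro!: sum.cong)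
  finally show ?thesis unfolding X by (simp add: image_image)
qed

lemma entropy_of_nonneg: "0 \<le> entropy_of M X"
  unfolding entropy_of_def
proof (rule sum_nonneg)
  fix v
  have "ln (prob (X -` {v})) \<le> 0"
    using ln_le_zero_iff[of "prob (X -` {v})"] prob_le_1[of "X -` {v}"]
    by (cases "prob (X -` {v}) = 0") (auto simp: zero_less_measure_iff)
  then show "0 \<le> \<eta> (prob (X -` {v}))" by (intro mult_nonpos_nonpos) auto
qed

lemma entropy_of_le_ln_card:
  assumes "finite_valued M X"
  shows "entropy_of M X \<le> ln (real (card (range X)))"
  using gibbs_variational[of "range X" "\<lambda>v. prob (X -` {v})" "\<lambda>_. 0"] assms sum_prob[OF assms]
  by (simp add: entropy_of_def finite_valued_def)

text \<open>If \<open>Z\<close> determines \<open>X\<close>, each fibre of \<open>Z\<close> lies in a fibre of \<open>X\<close>, so the information gained from \<open>X\<close> is pointwise at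
most that gained from \<open>Z\<close>.\<close>

lemma entropy_of_determined:
  assumes Z: "finite_valued M Z" and det: "\<And>x y. Z x = Z y \<Longrightarrow> X x = X y"
  shows "entropy_of M X \<le> entropy_of M Z" "finite_valued M X"
proof -
  define g where "g w = X (SOME x. Z x = w)" for w
  have X: "X = (\<lambda>x. g (Z x))"
  proof
    fix x
    have "Z (SOME y. Z y = Z x) = Z x" by (rule someI[of _ x]) simp
    then show "X x = g (Z x)" unfolding g_def using det by metis
  qed
  show fv: "finite_valued M X" unfolding X by (rule finite_valued_function[OF Z])
  have "entropy_of M X = - (\<Sum>w\<in>range Z. prob (Z -` {w}) * ln (prob (X -` {g w})))"
    using sum_prob_function[OF Z X, of "\<lambda>v. ln (prob (X -` {v}))"] unfolding entropy_of_def
    by (simp add: sum_negf)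
  also have "\<dots> \<le> - (\<Sum>w\<in>range Z. prob (Z -` {w}) * ln (prob (Z -` {w})))"
  proof (intro le_imp_neg_le sum_mono)
    fix w
    have "prob (Z -` {w}) \<le> prob (X -` {g w})"
      using fv by (intro finite_measure_mono) (auto simp: X finite_valued_def)
    then show "prob (Z -` {w}) * ln (prob (Z -` {w})) \<le> prob (Z -` {w}) * ln (prob (X -` {g w}))"
      by (cases "prob (Z -` {w}) = 0") (auto intro!: mult_left_mono ln_mono simp: zero_less_measure_iff)
  qed
  finally show "entropy_of M X \<le> entropy_of M Z" by (simp add: entropy_of_def sum_negf)
qed

lemma finite_valued_pair:
  assumes "finite_valued M X" "finite_valued M Y"
  shows "finite_valued M (\<lambda>x. (X x, Y x))"
proof -
  have "range (\<lambda>x. (X x, Y x)) \<subseteq> range X \<times> range Y" by auto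
  then have "finite (range (\<lambda>x. (X x, Y x)))"
    by (rule finite_subset) (use assms in \<open>simp add: finite_valued_def\<close>)
  moreover have "(\<lambda>x. (X x, Y x)) -` {v} \<in> sets M" for v
  proof -
    have "(\<lambda>x. (X x, Y x)) -` {v} = X -` {fst v} \<inter> Y -` {snd v}" by (auto simp: prod_eq_iff)
    then show ?thesis using assms by (auto simp: finite_valued_def)
  qed
  ultimately show ?thesis by (simp add: finite_valued_def)
qed

text \<open>Subadditivity is the Gibbs inequality for the joint law against the product of the marginals.\<close>

lemma entropy_of_pair:
  assumes "finite_valued M X" "finite_valued M Y"
  shows "entropy_of M (\<lambda>x. (X x, Y x)) \<le> entropy_of M X + entropy_of M Y"
proof -
  define Z where "Z x = (X x, Y x)" for x
  have Z: "finite_valued M Z" unfolding Z_def using assms by (rule finite_valued_pair)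
  have XY: "X = (\<lambda>x. fst (Z x))" "Y = (\<lambda>x. snd (Z x))" by (auto simp: Z_def)
  define p where "p w = prob (Z -` {w})" for w
  define q where "q w = prob (X -` {fst w}) * prob (Y -` {snd w})" for w
  have le: "p w \<le> prob (X -` {fst w})" "p w \<le> prob (Y -` {snd w})" for w
    using assms unfolding p_def by (auto intro!: finite_measure_mono simp: Z_def finite_valued_def)
  have q_pos: "q w > 0" if "p w > 0" for w
    using le[of w] that by (simp add: q_def)
  have "sum q (range Z) \<le> sum q (range X \<times> range Y)"
    using assms by (intro sum_mono2) (auto simp: Z_def q_def finite_valued_def)
  also have "\<dots> = (\<Sum>a\<in>range X. \<Sum>b\<in>range Y. prob (X -` {a}) * prob (Y -` {b}))"
    by (simp add: q_def sum.cartesian_product case_prod_beta)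
  also have "\<dots> = 1"
    using sum_prob[OF assms(1)] sum_prob[OF assms(2)] by (simp flip: sum_distrib_left)
  finally have "sum q (range Z) \<le> sum p (range Z)"
    using sum_prob[OF Z] by (simp add: p_def)
  then have "entropy_of M Z \<le> (\<Sum>w\<in>range Z. - p w * ln (q w))"
    unfolding entropy_of_def p_def[symmetric]
    by (intro gibbs_inequality q_pos) (auto simp: p_def q_def)
  also have "\<dots> = (\<Sum>w\<in>range Z. - (p w * ln (prob (X -` {fst w}))) - p w * ln (prob (Y -` {snd w})))"
  proof (intro sum.cong refl)
    fix w
    show "- p w * ln (q w) = - (p w * ln (prob (X -` {fst w}))) - p w * ln (prob (Y -` {snd w}))"
    proof (cases "p w = 0")
      case False
      then have "p w > 0" by (simp add: p_def zero_less_measure_iff)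
      then have "prob (X -` {fst w}) > 0" "prob (Y -` {snd w}) > 0" using le[of w] by linarith+
      then show ?thesis by (simp add: q_def ln_mult algebra_simps)
    qed simp
  qed
  also have "\<dots> = - (\<Sum>w\<in>range Z. p w * ln (prob (X -` {fst w}))) - (\<Sum>w\<in>range Z. p w * ln (prob (Y -` {snd w})))"
    by (simp add: sum_subtractf sum_negf)
  also have "\<dots> = entropy_of M X + entropy_of M Y"
    using sum_prob_function[OF Z XY(1), of "\<lambda>v. ln (prob (X -` {v}))"]
      sum_prob_function[OF Z XY(2), of "\<lambda>v. ln (prob (Y -` {v}))"]
    by (simp add: p_def entropy_of_def sum_negf)
  finally show ?thesis by (simp add: Z_def[abs_def])
qed

lemma joint_finite_valued:
  assumes "finite J" "\<And>j. j \<in> J \<Longrightarrow> finite_valued M (X j)"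
  shows "finite_valued M (joint X J)"
  using assms
proof (induction rule: finite_induct)
  case empty
  have "joint X {} = (\<lambda>_. \<lambda>_. undefined)" by (simp add: joint_def fun_eq_iff)
  moreover have "(\<lambda>_. c) -` {v} \<in> sets M" for c v :: "'a \<Rightarrow> 'c"
    using sets.top[of M] by (cases "c = v") (auto simp: space_UNIV)
  ultimately show ?case by (auto simp: finite_valued_def)
next
  case (insert i F)
  then have "finite_valued M (\<lambda>x. (X i x, joint X F x))" by (intro finite_valued_pair) auto
  then show ?case by (rule entropy_of_determined) (auto simp: joint_eq_iff)
qed

lemma entropy_of_joint_le:
  assumes "finite J" "\<And>j. j \<in> J \<Longrightarrow> finite_valued M (X j)"
  shows "entropy_of M (joint X J) \<le> (\<Sum>j\<in>J. entropy_of M (X j))"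
  using assms
proof (induction rule: finite_induct)
  case empty
  have "joint X {} = (\<lambda>_. \<lambda>_. undefined)" by (simp add: joint_def fun_eq_iff)
  then show ?case using prob_space by (simp add: entropy_of_def space_UNIV)
next
  case (insert i F)
  then have fv: "finite_valued M (X i)" "finite_valued M (joint X F)" by (auto intro: joint_finite_valued)
  have "entropy_of M (joint X (insert i F)) \<le> entropy_of M (\<lambda>x. (X i x, joint X F x))"
    by (rule entropy_of_determined[OF finite_valued_pair[OF fv]]) (auto simp: joint_eq_iff)
  also have "\<dots> \<le> entropy_of M (X i) + entropy_of M (joint X F)" by (rule entropy_of_pair[OF fv])
  finally show ?case using insert by simp
qed

lemma entropy_of_joint_cover:
  assumes "finite I" "\<And>i. i \<in> I \<Longrightarrow> finite (B i)" "J \<subseteq> (\<Union>i\<in>I. B i)"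
    "\<And>j. finite_valued M (X j)"
  shows "entropy_of M (joint X J) \<le> (\<Sum>i\<in>I. entropy_of M (joint X (B i)))"
proof -
  have fv: "finite_valued M (joint X (B i))" if "i \<in> I" for i
    using assms that by (intro joint_finite_valued) auto
  have "entropy_of M (joint X J) \<le> entropy_of M (joint (\<lambda>i. joint X (B i)) I)"
  proof (rule entropy_of_determined(1))
    show "finite_valued M (joint (\<lambda>i. joint X (B i)) I)" by (intro joint_finite_valued assms(1) fv)
    show "joint X J x = joint X J y" if "joint (\<lambda>i. joint X (B i)) I x = joint (\<lambda>i. joint X (B i)) I y" for x y
      using that assms(3) unfolding joint_eq_iff by blast
  qed
  also have "\<dots> \<le> (\<Sum>i\<in>I. entropy_of M (joint X (B i)))"
    by (rule entropy_of_joint_le[OF assms(1) fv])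
  finally show ?thesis .
qed

text \<open>For a residue \<open>s\<close> modulo \<open>q\<close>, the times below \<open>m\<close> are covered by the \<open>s\<close> initial ones and by the blocks
\<open>{p..<p+q}\<close> with \<open>p < m\<close> and \<open>p mod q = s\<close>; the last block may run past \<open>m\<close>. Subadditivity bounds the joint entropy by
the entropies of these pieces, and summation over \<open>s\<close> makes every \<open>p < m\<close> occur exactly once. For invariant measures
this is subadditivity in time; for orbit averages it is the core of Misiurewicz's argument.\<close>

lemma entropy_of_blocks:
  assumes q: "q > 0" and fv: "\<And>j::nat. finite_valued M (X j)" and k: "\<And>j. entropy_of M (X j) \<le> c"
  shows "real q * entropy_of M (joint X {..<m}) \<le>
    real q ^ 2 * c + (\<Sum>p<m. entropy_of M (joint X {p..<p+q}))"
proof -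
  define H where "H J = entropy_of M (joint X J)" for J
  have c: "0 \<le> c" using k entropy_of_nonneg order_trans by blast
  have fvj: "finite_valued M (joint X J)" if "finite J" for J by (intro joint_finite_valued that fv)
  have step: "H {..<m} \<le> real q * c + (\<Sum>p\<in>{p\<in>{..<m}. p mod q = s}. H {p..<p+q})" if s: "s < q" for s
  proof -
    let ?P = "{p\<in>{..<m}. p mod q = s}"
    have cover: "{..<m} \<subseteq> (\<Union>b\<in>{..<s}. {b}) \<union> (\<Union>p\<in>?P. {p..<p+q})"
    proof
      fix j assume j: "j \<in> {..<m}"
      show "j \<in> (\<Union>b\<in>{..<s}. {b}) \<union> (\<Union>p\<in>?P. {p..<p+q})"
      proof (cases "j < s")
        case False
        define p where "p = j - (j - s) mod q"
        have "(j - s) mod q \<le> j - s" by (rule mod_less_eq_dividend)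
        then have p: "p \<le> j" "s \<le> p" "p - s = (j - s) - (j - s) mod q"
          using False by (auto simp: p_def; linarith)+
        have "j < p + q" using p \<open>(j - s) mod q \<le> j - s\<close> mod_less_divisor[OF q, of "j - s"] by (simp add: p_def)
        have "q dvd p - s" unfolding p(3) by (rule dvd_minus_mod)
        then have "p mod q = s mod q" using p(2) by (simp add: mod_eq_dvd_iff_nat)
        then have "p \<in> ?P" using p j s by simp
        then show ?thesis using \<open>j < p + q\<close> p(1) by (intro UnI2 UN_I[of p]) auto
      qed auto
    qed
    have "H {..<m} \<le> entropy_of M (\<lambda>x. (joint X (\<Union>b\<in>{..<s}. {b}) x, joint X (\<Union>p\<in>?P. {p..<p+q}) x))"
      unfolding H_def
    proof (rule entropy_of_determined(1)[OF finite_valued_pair[OF fvj fvj]])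
      fix x y assume "(joint X (\<Union>b\<in>{..<s}. {b}) x, joint X (\<Union>p\<in>?P. {p..<p+q}) x) =
        (joint X (\<Union>b\<in>{..<s}. {b}) y, joint X (\<Union>p\<in>?P. {p..<p+q}) y)"
      then have "\<forall>j\<in>(\<Union>b\<in>{..<s}. {b}) \<union> (\<Union>p\<in>?P. {p..<p+q}). X j x = X j y"
        unfolding prod.inject joint_eq_iff by (simp only: ball_Un)
      then show "joint X {..<m} x = joint X {..<m} y"
        using cover unfolding joint_eq_iff by (meson subsetD)
    qed auto
    also have "\<dots> \<le> H (\<Union>b\<in>{..<s}. {b}) + H (\<Union>p\<in>?P. {p..<p+q})"
      unfolding H_def by (intro entropy_of_pair fvj) auto
    also have "H (\<Union>b\<in>{..<s}. {b}) \<le> (\<Sum>b\<in>{..<s}. H {b})"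
      unfolding H_def by (rule entropy_of_joint_cover) (auto simp: fv)
    also have "(\<Sum>b\<in>{..<s}. H {b}) \<le> (\<Sum>b\<in>{..<s}. c)"
    proof (rule sum_mono)
      fix b
      have "H {b} \<le> (\<Sum>j\<in>{b}. entropy_of M (X j))" unfolding H_def by (rule entropy_of_joint_le) (auto simp: fv)
      then show "H {b} \<le> c" using k[of b] by simp
    qed
    also have "\<dots> \<le> real q * c" using s c by (simp add: mult_right_mono)
    also have "H (\<Union>p\<in>?P. {p..<p+q}) \<le> (\<Sum>p\<in>?P. H {p..<p+q})"
      unfolding H_def by (rule entropy_of_joint_cover) (auto simp: fv)
    finally show ?thesis by simp
  qed
  have "real q * H {..<m} = (\<Sum>s<q. H {..<m})" by simp
  also have "\<dots> \<le> (\<Sum>s<q. real q * c + (\<Sum>p\<in>{p\<in>{..<m}. p mod q = s}. H {p..<p+q}))"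
    by (rule sum_mono) (use step in auto)
  also have "\<dots> = real q ^ 2 * c + (\<Sum>s<q. \<Sum>p\<in>{p\<in>{..<m}. p mod q = s}. H {p..<p+q})"
    by (simp add: sum.distrib power2_eq_square)
  also have "(\<Sum>s<q. \<Sum>p\<in>{p\<in>{..<m}. p mod q = s}. H {p..<p+q}) = (\<Sum>p<m. H {p..<p+q})"
    by (rule sum.group) (use q in auto)
  finally show ?thesis by (simp add: H_def)
qed

end


section \<open>Itineraries and the entropy of a partition\<close>

definition cell :: "'b set set \<Rightarrow> 'b \<Rightarrow> 'b set" where
  "cell P x = (THE A. A \<in> P \<and> x \<in> A)"

definition itinerary :: "('b \<Rightarrow> 'b) \<Rightarrow> 'b set set \<Rightarrow> nat set \<Rightarrow> 'b \<Rightarrow> nat \<Rightarrow> 'b set" where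
  "itinerary f P = joint (\<lambda>j x. cell P ((f ^^ j) x))"

lemma cell_eqI:
  assumes "partition_on UNIV P" "A \<in> P" "x \<in> A"
  shows "cell P x = A"
  unfolding cell_def
proof (rule the_equality)
  show "A \<in> P \<and> x \<in> A" using assms by simp
  show "B = A" if "B \<in> P \<and> x \<in> B" for B
    using partition_onD2[OF assms(1)] assms(2,3) that unfolding disjoint_def by blast
qed

lemma cell_mem:
  assumes "partition_on UNIV P"
  shows "cell P x \<in> P" "x \<in> cell P x"
proof -
  obtain A where "A \<in> P" "x \<in> A" using assms by (auto simp: partition_on_def)
  then show "cell P x \<in> P" "x \<in> cell P x" using cell_eqI[OF assms] by auto
qed

lemma cell_vimage:
  assumes "partition_on UNIV P"
  shows "cell P -` {A} = (if A \<in> P then A else {})"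
proof (intro set_eqI iffI)
  fix x assume "x \<in> cell P -` {A}"
  then show "x \<in> (if A \<in> P then A else {})" using cell_mem[OF assms, of x] by auto
next
  fix x assume "x \<in> (if A \<in> P then A else {})"
  then show "x \<in> cell P -` {A}" using cell_eqI[OF assms] by (cases "A \<in> P") auto
qed

lemma itinerary_eq_iff: "itinerary f P J x = itinerary f P J y \<longleftrightarrow> (\<forall>j\<in>J. cell P ((f ^^ j) x) = cell P ((f ^^ j) y))"
  by (simp add: itinerary_def joint_eq_iff)

text \<open>The nonempty cells of the refined partition are the fibres of the itinerary map.\<close>

lemma partition_entropy_dyn_refinement:
  assumes P: "partition_on UNIV P"
  shows "partition_entropy \<mu> (dyn_refinement f P n) = entropy_of \<mu> (itinerary f P {..<n})"
proof -
  let ?X = "itinerary f P {..<n}"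
  have fib: "(\<Inter>j<n. (f ^^ j) -` cell P ((f ^^ j) x)) = ?X -` {?X x}" for x
  proof -
    have "y \<in> cell P x \<longleftrightarrow> cell P y = cell P x" for x y
      using cell_mem[OF P, of x] cell_mem(2)[OF P, of y] cell_eqI[OF P, of "cell P x" y] by auto
    then show ?thesis by (auto simp: itinerary_eq_iff)
  qed
  have "dyn_refinement f P n = (\<lambda>v. ?X -` {v}) ` range ?X"
  proof (intro subset_antisym subsetI)
    fix C assume "C \<in> dyn_refinement f P n"
    then obtain a x where a: "a \<in> {..<n} \<rightarrow> P" "C = (\<Inter>j<n. (f ^^ j) -` a j)" "x \<in> C"
      by (auto simp: dyn_refinement_def)
    then have "a j = cell P ((f ^^ j) x)" if "j < n" for j
      using that cell_eqI[OF P, of "a j" "(f ^^ j) x"] by auto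
    then have "C = ?X -` {?X x}" unfolding fib[symmetric] a(2) by auto
    then show "C \<in> (\<lambda>v. ?X -` {v}) ` range ?X" by blast
  next
    fix C assume "C \<in> (\<lambda>v. ?X -` {v}) ` range ?X"
    then obtain x where C: "C = ?X -` {?X x}" by blast
    then have "x \<in> C" by simp
    moreover have "C = (\<Inter>j<n. (f ^^ j) -` (\<lambda>j. cell P ((f ^^ j) x)) j)" using fib C by simp
    ultimately show "C \<in> dyn_refinement f P n"
      unfolding dyn_refinement_def using cell_mem(1)[OF P]
        \<open>x \<in> C\<close> by (intro DiffI image_eqI[where x="\<lambda>j. cell P ((f ^^ j) x)"]) blast+
  qed
  moreover have "inj_on (\<lambda>v. ?X -` {v}) (range ?X)"
  proof (rule inj_onI)
    fix v w assume "v \<in> range ?X" "?X -` {v} = ?X -` {w}"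
    then obtain x where "?X x = v" "x \<in> ?X -` {w}" by blast
    then show "v = w" by simp
  qed
  ultimately show ?thesis by (simp add: partition_entropy_def entropy_of_def sum.reindex)
qed

lemma itinerary_shift:
  "itinerary f P {p..<p+q} x = itinerary f P {p..<p+q} y \<longleftrightarrow>
   itinerary f P {..<q} ((f ^^ p) x) = itinerary f P {..<q} ((f ^^ p) y)"
proof -
  have "(\<forall>j\<in>{p..<p+q}. Q j) \<longleftrightarrow> (\<forall>j<q. Q (j + p))" for Q
  proof (intro iffI ballI)
    fix j assume a: "\<forall>j<q. Q (j + p)" "j \<in> {p..<p+q}"
    then have "j - p < q" "j - p + p = j" by auto
    then show "Q j" using a(1) by metis
  qed auto
  then show ?thesis by (simp add: itinerary_eq_iff funpow_add Ball_def[of "{..<q}"])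
qed

text \<open>Fekete's lemma, in the quantitative form in which the block estimate provides subadditivity.\<close>

lemma subadditive_limit:
  fixes a :: "nat \<Rightarrow> real"
  assumes nonneg: "\<And>n. 0 \<le> a n"
    and block: "\<And>q m. q > 0 \<Longrightarrow> m > 0 \<Longrightarrow> real q * a m \<le> real q ^ 2 * C + real m * a q"
  obtains h where "(\<lambda>n. a n / real n) \<longlonglongrightarrow> h" "\<And>q. q > 0 \<Longrightarrow> h \<le> a q / real q" "0 \<le> h"
proof
  define h where "h = (INF q\<in>{0<..}. a q / real q)"
  have bdd: "bdd_below ((\<lambda>q. a q / real q) ` {0<..})"
    by (rule bdd_belowI[of _ 0]) (auto simp: nonneg)
  show le: "h \<le> a q / real q" if "q > 0" for q
    unfolding h_def using that by (intro cINF_lower bdd) auto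
  show "0 \<le> h" unfolding h_def by (intro cINF_greatest) (auto simp: nonneg)
  show "(\<lambda>n. a n / real n) \<longlonglongrightarrow> h"
  proof (rule order_tendstoI)
    fix y assume "y < h"
    show "\<forall>\<^sub>F n in sequentially. y < a n / real n"
      using eventually_gt_at_top[of 0]
    proof eventually_elim
      case (elim n)
      then show ?case using le[of n] \<open>y < h\<close> by linarith
    qed
  next
    fix y assume "h < y"
    then obtain q where q: "q > 0" "a q / real q < y"
      unfolding h_def using bdd by (auto simp: cINF_less_iff)
    have "(\<lambda>m. real q * C * (1 / real m) + a q / real q) \<longlonglongrightarrow> real q * C * 0 + a q / real q"
      by (intro tendsto_intros lim_1_over_n)
    then have "\<forall>\<^sub>F m in sequentially. real q * C * (1 / real m) + a q / real q < y"
      using q by (intro order_tendstoD) auto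
    then show "\<forall>\<^sub>F m in sequentially. a m / real m < y"
      using eventually_gt_at_top[of 0]
    proof eventually_elim
      case (elim m)
      have "a m / real m \<le> real q * C * (1 / real m) + a q / real q"
        using block[OF q(1) elim(2)] q(1) elim(2) by (simp add: field_simps power2_eq_square)
      then show ?case using elim by simp
    qed
  qed
qed

lemma full_prob_space_borel_probs: "\<mu> \<in> borel_probs \<Longrightarrow> full_prob_space \<mu>"
  using borel_probsD(1,3) by (intro full_prob_space.intro full_prob_space_axioms.intro)

lemma funpow_continuous:
  assumes "continuous_on UNIV (f :: 'a::topological_space \<Rightarrow> 'a)"
  shows "continuous_on UNIV (f ^^ n)"
proof (induction n)
  case (Suc n)
  then show ?case using continuous_on_compose2[OF assms Suc] by (auto simp: o_def)
qed (auto simp: id_def)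

lemma funpow_vimage_borel:
  assumes "continuous_on UNIV (f :: 'a::topological_space \<Rightarrow> 'a)" "A \<in> sets borel"
  shows "(f ^^ n) -` A \<in> sets borel"
  using measurable_sets[OF borel_measurable_continuous_onI[OF funpow_continuous[OF assms(1)]] assms(2), of n]
  by simp

lemma cell_finite_valued:
  assumes "continuous_on UNIV (f :: 'a::topological_space \<Rightarrow> 'a)" "sets borel \<subseteq> sets M"
    and P: "finite P" "partition_on UNIV P" "P \<subseteq> sets borel"
  shows "finite_valued M (\<lambda>x. cell P ((f ^^ j) x))"
    "card (range (\<lambda>x. cell P ((f ^^ j) x))) \<le> card P"
proof -
  have sub: "range (\<lambda>x. cell P ((f ^^ j) x)) \<subseteq> P" using cell_mem[OF P(2)] by auto
  then show "card (range (\<lambda>x. cell P ((f ^^ j) x))) \<le> card P" using P(1) by (intro card_mono)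
  have "(\<lambda>x. cell P ((f ^^ j) x)) -` {v} = (f ^^ j) -` (cell P -` {v})" for v by auto
  moreover have "cell P -` {v} \<in> sets borel" for v using P by (auto simp: cell_vimage)
  ultimately have "(\<lambda>x. cell P ((f ^^ j) x)) -` {v} \<in> sets M" for v
    using funpow_vimage_borel[OF assms(1)] assms(2) by auto
  then show "finite_valued M (\<lambda>x. cell P ((f ^^ j) x))"
    using sub P(1) finite_subset by (auto simp: finite_valued_def)
qed

text \<open>The itinerary over \<open>{p..<p+q}\<close> has the law of the itinerary over \<open>{..<q}\<close> under the image of \<open>M\<close> by
\<open>f ^^ p\<close>. The estimate is phrased with preimages because \<open>M\<close> is to be either an invariant Borel
measure, for which all terms coincide, or a finitely supported measure on the full power set.\<close>

lemma itinerary_blocks: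
  fixes f :: "'a::topological_space \<Rightarrow> 'a"
  assumes f: "continuous_on UNIV f" and M: "full_prob_space M" "sets borel \<subseteq> sets M"
    and P: "finite P" "partition_on UNIV P" "P \<subseteq> sets borel" and q: "q > 0"
  shows "real q * entropy_of M (itinerary f P {..<m}) \<le> real q ^ 2 * ln (card P) +
    (\<Sum>p<m. \<Sum>v\<in>range (itinerary f P {..<q}).
        \<eta> (measure M ((f ^^ p) -` (itinerary f P {..<q} -` {v}))))"
proof -
  interpret full_prob_space M by (rule M)
  note fv = cell_finite_valued(1)[OF f M(2) P]
  have nfv: "finite_valued M (itinerary f P J)" if "finite J" for J
    unfolding itinerary_def by (intro joint_finite_valued that fv)
  have rng: "range (\<lambda>x. cell P ((f ^^ j) x)) \<noteq> {}" for j by auto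
  have k: "entropy_of M (\<lambda>x. cell P ((f ^^ j) x)) \<le> ln (card P)" for j
  proof -
    have "entropy_of M (\<lambda>x. cell P ((f ^^ j) x)) \<le> ln (real (card (range (\<lambda>x. cell P ((f ^^ j) x)))))"
      by (rule entropy_of_le_ln_card[OF fv])
    also have "\<dots> \<le> ln (real (card P))"
      using cell_finite_valued(2)[OF f M(2) P, of j] fv[of j]
      by (intro ln_mono of_nat_mono) (auto simp: finite_valued_def card_gt_0_iff)
    finally show ?thesis .
  qed
  have "real q * entropy_of M (itinerary f P {..<m}) \<le>
      real q ^ 2 * ln (card P) + (\<Sum>p<m. entropy_of M (itinerary f P {p..<p+q}))"
    unfolding itinerary_def by (rule entropy_of_blocks[OF q fv k])
  also have "(\<Sum>p<m. entropy_of M (itinerary f P {p..<p+q})) \<le>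
     (\<Sum>p<m. \<Sum>v\<in>range (itinerary f P {..<q}).
        \<eta> (measure M ((f ^^ p) -` (itinerary f P {..<q} -` {v}))))"
  proof (rule sum_mono)
    fix p
    let ?Y = "\<lambda>x. itinerary f P {..<q} ((f ^^ p) x)"
    have fvY: "finite_valued M ?Y"
      by (rule entropy_of_determined(2)[OF nfv[of "{p..<p+q}"]]) (auto simp: itinerary_shift)
    have "entropy_of M (itinerary f P {p..<p+q}) \<le> entropy_of M ?Y"
      by (rule entropy_of_determined(1)[OF fvY]) (simp add: itinerary_shift)
    also have "\<dots> = (\<Sum>v\<in>range (itinerary f P {..<q}). \<eta> (measure M (?Y -` {v})))"
      using nfv[of "{..<q}"] by (intro entropy_of_superset) (auto simp: finite_valued_def)
    finally show "entropy_of M (itinerary f P {p..<p+q}) \<le> (\<Sum>v\<in>range (itinerary f P {..<q}).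
        \<eta> (measure M ((f ^^ p) -` (itinerary f P {..<q} -` {v}))))"
      by (simp add: vimage_def)
  qed
  finally show ?thesis by simp
qed

lemma invariant_funpow:
  assumes f: "continuous_on UNIV (f :: 'a::topological_space \<Rightarrow> 'a)" and \<mu>: "\<mu> \<in> invariant_probs f"
    and A: "A \<in> sets borel"
  shows "emeasure \<mu> ((f ^^ p) -` A) = emeasure \<mu> A"
proof (induction p)
  case (Suc p)
  have "(f ^^ Suc p) -` A = f -` ((f ^^ p) -` A)" by (auto simp: funpow_swap1)
  moreover have "emeasure \<mu> (f -` ((f ^^ p) -` A)) = emeasure \<mu> ((f ^^ p) -` A)"
    using \<mu> funpow_vimage_borel[OF f A, of p] unfolding invariant_probs_def by blast
  ultimately show ?case using Suc by metis
qed simp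

text \<open>By invariance the block estimate is subadditivity, so the limit that defines \<open>entropy_wrt\<close> exists, and lower
bounds for its terms bound it from below; without convergence \<open>lim\<close> would be an arbitrary value.\<close>

lemma entropy_wrt_limit:
  fixes f :: "'a::topological_space \<Rightarrow> 'a"
  assumes f: "continuous_on UNIV f" and \<mu>: "\<mu> \<in> invariant_probs f"
    and P: "finite P" "partition_on UNIV P" "P \<subseteq> sets borel"
  obtains h where "entropy_wrt \<mu> f P = ereal h" "0 \<le> h"
    "(\<lambda>n. entropy_of \<mu> (itinerary f P {..<n}) / real n) \<longlonglongrightarrow> h"
    "\<And>c. (\<And>q. q > 0 \<Longrightarrow> c \<le> entropy_of \<mu> (itinerary f P {..<q}) / real q) \<Longrightarrow> c \<le> h"
proof -
  have b: "\<mu> \<in> borel_probs" using \<mu> by (simp add: invariant_probs_def)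
  interpret full_prob_space \<mu> by (rule full_prob_space_borel_probs[OF b])
  have s: "sets borel \<subseteq> sets \<mu>" using borel_probsD(2)[OF b] by simp
  note fv = cell_finite_valued(1)[OF f s P]
  define a where "a n = entropy_of \<mu> (itinerary f P {..<n})" for n
  have block: "real q * a m \<le> real q ^ 2 * ln (card P) + real m * a q" if q: "q > 0" for q m
  proof -
    have "finite_valued \<mu> (itinerary f P {..<q})" unfolding itinerary_def by (intro joint_finite_valued fv) auto
    then have "measure \<mu> ((f ^^ p) -` (itinerary f P {..<q} -` {v})) = measure \<mu> (itinerary f P {..<q} -` {v})" for p v
      using invariant_funpow[OF f \<mu>, of "itinerary f P {..<q} -` {v}" p] borel_probsD(2)[OF b]
      by (simp add: finite_valued_def measure_def)
    then show ?thesis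
      using itinerary_blocks[OF f full_prob_space_axioms s P q, of m] by (simp add: a_def entropy_of_def)
  qed
  have an: "0 \<le> a n" for n by (simp add: a_def entropy_of_nonneg)
  obtain h where h: "(\<lambda>n. a n / real n) \<longlonglongrightarrow> h" "0 \<le> h"
    using subadditive_limit[of a "ln (card P)"] an block by metis
  have "(\<lambda>n. ereal (1 / real n * partition_entropy \<mu> (dyn_refinement f P n))) \<longlonglongrightarrow> ereal h"
    using h(1) by (simp add: partition_entropy_dyn_refinement[OF P(2)] a_def)
  then have "entropy_wrt \<mu> f P = ereal h" unfolding entropy_wrt_def by (rule limI)
  moreover have "c \<le> h" if "\<And>q. q > 0 \<Longrightarrow> c \<le> a q / real q" for c
    using that by (intro LIMSEQ_le_const[OF h(1)]) (auto intro!: exI[of _ 1])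
  ultimately show ?thesis using that h by (auto simp: a_def)
qed

section \<open>Topological pressure\<close>

locale compact_dynamics =
  fixes f :: "'a::metric_space \<Rightarrow> 'a"
  assumes cpt: "compact (UNIV :: 'a set)" and f: "continuous_on UNIV f"
begin

lemma separated_finite: "separated f n \<epsilon> E \<Longrightarrow> \<epsilon> > 0 \<Longrightarrow> finite E"
  using separated_card_bounded[OF cpt f] by blast

lemma separated_singleton: "separated f n \<epsilon> {x}"
  by (simp add: separated_def)

lemma birkhoff_sum_bound:
  fixes \<phi> :: "'a \<Rightarrow> real"
  assumes "\<And>x. \<bar>\<phi> x\<bar> \<le> B"
  shows "\<bar>birkhoff_sum f n \<phi> x\<bar> \<le> real (n + 1) * B"
proof -
  have "\<bar>birkhoff_sum f n \<phi> x\<bar> \<le> (\<Sum>j\<le>n. \<bar>\<phi> ((f ^^ j) x)\<bar>)"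
    unfolding birkhoff_sum_def by (rule sum_abs)
  also have "\<dots> \<le> (\<Sum>j\<le>n. B)" by (intro sum_mono assms)
  finally show ?thesis by simp
qed

lemma bdd_above_partition_sum:
  assumes \<phi>: "continuous_on UNIV \<phi>" and "\<epsilon> > 0"
  shows "bdd_above ((\<lambda>E. \<Sum>x\<in>E. exp (birkhoff_sum f n \<phi> x)) ` {E. separated f n \<epsilon> E})"
proof -
  obtain B where B: "\<And>x. \<bar>\<phi> x\<bar> \<le> B" using continuous_bounded[OF cpt \<phi>] by blast
  obtain N where N: "\<And>E. separated f n \<epsilon> E \<Longrightarrow> finite E \<and> card E \<le> N"
    using separated_card_bounded[OF cpt f \<open>\<epsilon> > 0\<close>] by blast
  show ?thesis
  proof (rule bdd_aboveI2)
    fix E assume "E \<in> {E. separated f n \<epsilon> E}"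
    then have E: "finite E" "card E \<le> N" using N by auto
    have "(\<Sum>x\<in>E. exp (birkhoff_sum f n \<phi> x)) \<le> (\<Sum>x\<in>E. exp (real (n + 1) * B))"
      using birkhoff_sum_bound[OF B] by (intro sum_mono) (simp add: abs_le_iff)
    also have "\<dots> \<le> real N * exp (real (n + 1) * B)" using E by (simp add: mult_right_mono)
    finally show "(\<Sum>x\<in>E. exp (birkhoff_sum f n \<phi> x)) \<le> real N * exp (real (n + 1) * B)" .
  qed
qed

lemma partition_sum_upper:
  assumes "continuous_on UNIV \<phi>" "\<epsilon> > 0" "separated f n \<epsilon> E"
  shows "(\<Sum>x\<in>E. exp (birkhoff_sum f n \<phi> x)) \<le> partition_sum f \<phi> n \<epsilon>"
  unfolding partition_sum_def using assms by (intro cSUP_upper bdd_above_partition_sum) auto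

lemma partition_sum_least:
  assumes "\<And>E. separated f n \<epsilon> E \<Longrightarrow> (\<Sum>x\<in>E. exp (birkhoff_sum f n \<phi> x)) \<le> c"
  shows "partition_sum f \<phi> n \<epsilon> \<le> c"
  unfolding partition_sum_def
proof (rule cSUP_least)
  show "{E. separated f n \<epsilon> E} \<noteq> {}" using separated_singleton by blast
qed (use assms in auto)

lemma partition_sum_ge:
  assumes "continuous_on UNIV \<phi>" "\<epsilon> > 0"
  shows "exp (birkhoff_sum f n \<phi> x) \<le> partition_sum f \<phi> n \<epsilon>"
  using partition_sum_upper[OF assms separated_singleton[of n _ x]] by simp

lemma partition_sum_pos:
  assumes "continuous_on UNIV \<phi>" "\<epsilon> > 0"
  shows "0 < partition_sum f \<phi> n \<epsilon>"
  using partition_sum_ge[OF assms] exp_gt_zero by (meson less_le_trans)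

lemma partition_sum_antimono:
  assumes "continuous_on UNIV \<phi>" "0 < \<epsilon>" "\<epsilon> \<le> \<epsilon>'"
  shows "partition_sum f \<phi> n \<epsilon>' \<le> partition_sum f \<phi> n \<epsilon>"
proof (rule partition_sum_least)
  fix E assume "separated f n \<epsilon>' E"
  then have "separated f n \<epsilon> E" using assms(3) by (auto simp: separated_def intro: order_trans)
  then show "(\<Sum>x\<in>E. exp (birkhoff_sum f n \<phi> x)) \<le> partition_sum f \<phi> n \<epsilon>"
    using assms by (intro partition_sum_upper)
qed

definition growth_rate :: "('a \<Rightarrow> real) \<Rightarrow> real \<Rightarrow> ereal" where
  "growth_rate \<phi> \<epsilon> = limsup (\<lambda>n. ereal (1 / real n * ln (partition_sum f \<phi> n \<epsilon>)))"

lemma growth_rate_antimono: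
  assumes "continuous_on UNIV \<phi>" "0 < \<epsilon>" "\<epsilon> \<le> \<epsilon>'"
  shows "growth_rate \<phi> \<epsilon>' \<le> growth_rate \<phi> \<epsilon>"
  unfolding growth_rate_def
  using partition_sum_antimono[OF assms] partition_sum_pos[OF assms(1)] assms(2,3)
  by (intro Limsup_mono always_eventually allI) (simp add: mult_left_mono ln_mono divide_right_mono)

text \<open>Smaller \<open>\<epsilon>\<close> admits more separated sets, so the limit as \<open>\<epsilon>\<close> tends to \<open>0\<close> is a supremum.\<close>

lemma P_top_eq_SUP:
  assumes \<phi>: "continuous_on UNIV \<phi>"
  shows "P_top f \<phi> = (SUP \<epsilon>\<in>{0<..}. growth_rate \<phi> \<epsilon>)"
proof -
  have "(growth_rate \<phi> \<longlongrightarrow> (SUP \<epsilon>\<in>{0<..}. growth_rate \<phi> \<epsilon>)) (at_right 0)"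
  proof (rule order_tendstoI)
    fix a assume "a < (SUP \<epsilon>\<in>{0<..}. growth_rate \<phi> \<epsilon>)"
    then obtain e where e: "e > 0" "a < growth_rate \<phi> e" by (auto simp: less_SUP_iff)
    have "\<forall>\<^sub>F \<epsilon> in at_right 0. \<epsilon> \<in> {0<..<e}" by (rule eventually_at_right_real[OF e(1)])
    then show "\<forall>\<^sub>F \<epsilon> in at_right 0. a < growth_rate \<phi> \<epsilon>"
    proof eventually_elim
      case (elim \<epsilon>)
      then show ?case using growth_rate_antimono[OF \<phi>, of \<epsilon> e] e(2) by (simp add: less_le_trans)
    qed
  next
    fix a assume a: "(SUP \<epsilon>\<in>{0<..}. growth_rate \<phi> \<epsilon>) < a"
    have "\<forall>\<^sub>F \<epsilon> in at_right 0. \<epsilon> \<in> {0<..<1::real}" by (rule eventually_at_right_real) simp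
    then show "\<forall>\<^sub>F \<epsilon> in at_right 0. growth_rate \<phi> \<epsilon> < a"
    proof eventually_elim
      case (elim \<epsilon>)
      then have "growth_rate \<phi> \<epsilon> \<le> (SUP \<epsilon>\<in>{0<..}. growth_rate \<phi> \<epsilon>)" by (intro SUP_upper) auto
      then show ?case using a by simp
    qed
  qed
  then show ?thesis
    unfolding P_top_def growth_rate_def[symmetric] by (intro tendsto_Lim) auto
qed

lemma growth_rate_le_P_top:
  "continuous_on UNIV \<phi> \<Longrightarrow> \<epsilon> > 0 \<Longrightarrow> growth_rate \<phi> \<epsilon> \<le> P_top f \<phi>"
  by (simp add: P_top_eq_SUP SUP_upper)

text \<open>A discrepancy \<open>D\<close> between Birkhoff sums that stays bounded in \<open>n\<close> disappears after division by \<open>n\<close>, while a discrepancy of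
\<open>c\<close> per iterate survives as \<open>c\<close>.\<close>

lemma P_top_le:
  assumes \<phi>: "continuous_on UNIV \<phi>" and \<psi>: "continuous_on UNIV \<psi>"
    and le: "\<And>n x. birkhoff_sum f n \<phi> x \<le> birkhoff_sum f n \<psi> x + real (n + 1) * c + D"
  shows "P_top f \<phi> \<le> P_top f \<psi> + ereal c"
  unfolding P_top_eq_SUP[OF \<phi>]
proof (rule SUP_least)
  fix \<epsilon> :: real assume "\<epsilon> \<in> {0<..}"
  then have \<epsilon>: "\<epsilon> > 0" by simp
  define r where "r n = real (n + 1) * c + D" for n
  have ln_le: "ln (partition_sum f \<phi> n \<epsilon>) \<le> ln (partition_sum f \<psi> n \<epsilon>) + r n" for n
  proof -
    have "partition_sum f \<phi> n \<epsilon> \<le> exp (r n) * partition_sum f \<psi> n \<epsilon>"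
    proof (rule partition_sum_least)
      fix E assume E: "separated f n \<epsilon> E"
      have "(\<Sum>x\<in>E. exp (birkhoff_sum f n \<phi> x)) \<le> (\<Sum>x\<in>E. exp (r n) * exp (birkhoff_sum f n \<psi> x))"
        using le[of n] by (intro sum_mono) (simp add: r_def add.commute add.left_commute flip: exp_add)
      also have "\<dots> \<le> exp (r n) * partition_sum f \<psi> n \<epsilon>"
        using partition_sum_upper[OF \<psi> \<epsilon> E] by (simp flip: sum_distrib_left)
      finally show "(\<Sum>x\<in>E. exp (birkhoff_sum f n \<phi> x)) \<le> exp (r n) * partition_sum f \<psi> n \<epsilon>" .
    qed
    then have "ln (partition_sum f \<phi> n \<epsilon>) \<le> ln (exp (r n) * partition_sum f \<psi> n \<epsilon>)"
      using partition_sum_pos[OF \<phi> \<epsilon>, of n] by (intro ln_mono) auto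
    also have "\<dots> = ln (partition_sum f \<psi> n \<epsilon>) + r n"
      using partition_sum_pos[OF \<psi> \<epsilon>, of n] by (simp add: ln_mult)
    finally show ?thesis .
  qed
  have "(\<lambda>n. c + (c + D) * (1 / real n)) \<longlonglongrightarrow> c + (c + D) * 0"
    by (intro tendsto_intros lim_1_over_n)
  moreover have "\<forall>\<^sub>F n in sequentially. c + (c + D) * (1 / real n) = 1 / real n * r n"
    using eventually_gt_at_top[of 0] by eventually_elim (simp add: r_def field_simps)
  ultimately have "(\<lambda>n. 1 / real n * r n) \<longlonglongrightarrow> c" by (simp add: tendsto_cong)
  then have lim: "(\<lambda>n. ereal (1 / real n * r n)) \<longlonglongrightarrow> ereal c" by simp
  have "growth_rate \<phi> \<epsilon> \<le> limsup (\<lambda>n. ereal (1 / real n * r n) + ereal (1 / real n * ln (partition_sum f \<psi> n \<epsilon>)))"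
    unfolding growth_rate_def
  proof (intro Limsup_mono always_eventually allI)
    fix n
    have "1 / real n * ln (partition_sum f \<phi> n \<epsilon>) \<le> 1 / real n * (ln (partition_sum f \<psi> n \<epsilon>) + r n)"
      by (intro mult_left_mono ln_le) simp
    then show "ereal (1 / real n * ln (partition_sum f \<phi> n \<epsilon>)) \<le>
       ereal (1 / real n * r n) + ereal (1 / real n * ln (partition_sum f \<psi> n \<epsilon>))"
      by (simp add: distrib_left add.commute)
  qed
  also have "\<dots> = ereal c + growth_rate \<psi> \<epsilon>"
    unfolding growth_rate_def by (rule ereal_limsup_lim_add[OF lim]) simp
  also have "\<dots> \<le> P_top f \<psi> + ereal c"
    using add_left_mono[OF growth_rate_le_P_top[OF \<psi> \<epsilon>], of "ereal c"] by (simp add: add.commute)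
  finally show "growth_rate \<phi> \<epsilon> \<le> P_top f \<psi> + ereal c" .
qed

lemma P_top_le_const:
  assumes "continuous_on UNIV \<phi>" "continuous_on UNIV \<psi>" "\<And>x. \<phi> x \<le> \<psi> x + c"
  shows "P_top f \<phi> \<le> P_top f \<psi> + ereal c"
proof (rule P_top_le[where D=0, OF assms(1,2)])
  fix n x
  have "birkhoff_sum f n \<phi> x \<le> (\<Sum>j\<le>n. \<psi> ((f ^^ j) x) + c)"
    unfolding birkhoff_sum_def by (intro sum_mono assms(3))
  then show "birkhoff_sum f n \<phi> x \<le> birkhoff_sum f n \<psi> x + real (n + 1) * c + 0"
    by (simp add: birkhoff_sum_def sum.distrib algebra_simps)
qed

lemma h_top_nonneg: "0 \<le> h_top f"
proof -
  have "0 \<le> growth_rate (\<lambda>_. 0) 1"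
    unfolding growth_rate_def
  proof (rule le_Limsup)
    show "\<forall>\<^sub>F n in sequentially. 0 \<le> ereal (1 / real n * ln (partition_sum f (\<lambda>_. 0) n 1))"
      using partition_sum_ge[of "\<lambda>_. 0" 1] by (intro always_eventually) (simp add: birkhoff_sum_def)
  qed simp
  also have "\<dots> \<le> h_top f" unfolding h_top_def by (rule growth_rate_le_P_top) auto
  finally show ?thesis .
qed

lemma P_top_finite:
  assumes h: "h_top f < \<infinity>" and \<phi>: "continuous_on UNIV \<phi>"
  shows "\<bar>P_top f \<phi>\<bar> \<noteq> \<infinity>"
proof -
  obtain B where B: "\<And>x. \<bar>\<phi> x\<bar> \<le> B" using continuous_bounded[OF cpt \<phi>] by blast
  have "P_top f \<phi> \<le> h_top f + ereal B" unfolding h_top_def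
    by (rule P_top_le_const[OF \<phi>]) (use B in \<open>auto simp: abs_le_iff\<close>)
  moreover have "h_top f \<le> P_top f \<phi> + ereal B" unfolding h_top_def
  proof (rule P_top_le_const[OF _ \<phi>])
    show "0 \<le> \<phi> x + B" for x using B[of x] by linarith
  qed simp
  ultimately show ?thesis using h h_top_nonneg
    by (cases "P_top f \<phi>"; cases "h_top f") auto
qed

text \<open>The Birkhoff sums of a coboundary telescope and hence stay bounded.\<close>

lemma P_top_coboundary:
  assumes \<phi>: "continuous_on UNIV \<phi>" and \<psi>: "continuous_on UNIV \<psi>"
  shows "P_top f (\<lambda>x. \<phi> x + (\<psi> (f x) - \<psi> x)) \<le> P_top f \<phi>"
proof -
  obtain B where B: "\<And>x. \<bar>\<psi> x\<bar> \<le> B" using continuous_bounded[OF cpt \<psi>] by blast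
  have "P_top f (\<lambda>x. \<phi> x + (\<psi> (f x) - \<psi> x)) \<le> P_top f \<phi> + ereal 0"
  proof (rule P_top_le[where D="2 * B"])
    show "continuous_on UNIV (\<lambda>x. \<phi> x + (\<psi> (f x) - \<psi> x))"
      using continuous_on_compose2[OF \<psi> f] by (intro continuous_intros \<phi> \<psi>) auto
    fix n x
    have "(\<Sum>j\<le>n. \<psi> (f ((f ^^ j) x)) - \<psi> ((f ^^ j) x)) = \<psi> ((f ^^ Suc n) x) - \<psi> x"
      by (induction n) auto
    then have "birkhoff_sum f n (\<lambda>x. \<phi> x + (\<psi> (f x) - \<psi> x)) x =
        birkhoff_sum f n \<phi> x + (\<psi> ((f ^^ Suc n) x) - \<psi> x)"
      by (simp add: birkhoff_sum_def sum.distrib)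
    moreover have "\<psi> ((f ^^ Suc n) x) - \<psi> x \<le> 2 * B"
      using B[of "(f ^^ Suc n) x"] B[of x] unfolding abs_le_iff by linarith
    ultimately show "birkhoff_sum f n (\<lambda>x. \<phi> x + (\<psi> (f x) - \<psi> x)) x
        \<le> birkhoff_sum f n \<phi> x + real (n + 1) * 0 + 2 * B" by simp
  qed (rule \<phi>)
  then show ?thesis by simp
qed

end

section \<open>Metric entropy is bounded by pressure\<close>

lemma neg_mult_ln_le_1: "0 \<le> p \<Longrightarrow> \<eta> p \<le> (1::real)"
  using neg_mult_ln_le[of p 1] by simp

text \<open>From \<open>ln y \<le> y - 1\<close> at \<open>y = 1 / sqrt p\<close>.\<close>

lemma neg_mult_ln_le_sqrt:
  assumes "0 \<le> p"
  shows "\<eta> p \<le> 2 * sqrt p"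
proof (cases "p = 0")
  case False
  then have p: "p > 0" using assms by simp
  have "ln (1 / sqrt p) \<le> 1 / sqrt p - 1" using p by (intro ln_le_minus_one) simp
  moreover have "ln (1 / sqrt p) = - ln p / 2" using p by (simp add: ln_div ln_sqrt)
  ultimately have "p * (- ln p) \<le> p * (2 * (1 / sqrt p))" using p by (intro mult_left_mono) auto
  also have "\<dots> = 2 * (p / sqrt p)" by simp
  also have "\<dots> = 2 * sqrt p" using p by (subst real_div_sqrt) auto
  finally show ?thesis by simp
qed simp

lemma (in full_prob_space) integral_finite_valued:
  fixes a :: "'c \<Rightarrow> real"
  assumes "finite_valued M Z"
  shows "integrable M (\<lambda>x. a (Z x))" "(\<integral>x. a (Z x) \<partial>M) = (\<Sum>c\<in>range Z. prob (Z -` {c}) * a c)"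
proof -
  have fin: "finite (range Z)" and meas: "\<And>c. Z -` {c} \<in> sets M"
    using assms by (auto simp: finite_valued_def)
  have eq: "(\<lambda>x. a (Z x)) = (\<lambda>x. \<Sum>c\<in>range Z. indicator (Z -` {c}) x * a c)"
  proof
    fix x
    have "(\<Sum>c\<in>range Z. indicator (Z -` {c}) x * a c) = (\<Sum>c\<in>{Z x}. indicator (Z -` {c}) x * a c)"
      using fin by (intro sum.mono_neutral_right) auto
    then show "a (Z x) = (\<Sum>c\<in>range Z. indicator (Z -` {c}) x * a c)" by simp
  qed
  have int: "integrable M (\<lambda>x. indicator (Z -` {c}) x * a c)" for c
    using meas[of c] by (intro integrable_mult_left) (auto simp: integrable_indicator_iff emeasure_eq_measure)
  show "integrable M (\<lambda>x. a (Z x))"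
    unfolding eq by (intro Bochner_Integration.integrable_sum int)
  show "(\<integral>x. a (Z x) \<partial>M) = (\<Sum>c\<in>range Z. prob (Z -` {c}) * a c)"
    unfolding eq by (subst Bochner_Integration.integral_sum[OF int]) (simp add: space_UNIV)
qed

lemma disjoint_closed_gap:
  assumes cpt: "compact (UNIV :: 'a::metric_space set)" and V: "finite V"
    and B: "\<And>v. v \<in> V \<Longrightarrow> closed (B v :: 'a set)"
    and disj: "\<And>v w. v \<in> V \<Longrightarrow> w \<in> V \<Longrightarrow> v \<noteq> w \<Longrightarrow> B v \<inter> B w = {}"
  obtains d where "d > 0"
    "\<And>v w x y. v \<in> V \<Longrightarrow> w \<in> V \<Longrightarrow> x \<in> B v \<Longrightarrow> y \<in> B w \<Longrightarrow> dist x y < d \<Longrightarrow> v = w"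
proof -
  have "\<exists>d>0. v \<in> V \<longrightarrow> w \<in> V \<longrightarrow> v \<noteq> w \<longrightarrow> (\<forall>x\<in>B v. \<forall>y\<in>B w. d \<le> dist x y)" for v w
  proof (cases "v \<in> V \<and> w \<in> V \<and> v \<noteq> w")
    case True
    show ?thesis
    proof (cases "B v = {} \<or> B w = {}")
      case False
      have "compact (B v)" using B True closed_Int_compact[OF _ cpt, of "B v"] by simp
      moreover have "continuous_on (B v) (\<lambda>x. infdist x (B w))" by (intro continuous_intros)
      ultimately obtain x0 where x0: "x0 \<in> B v" "\<And>x. x \<in> B v \<Longrightarrow> infdist x0 (B w) \<le> infdist x (B w)"
        using continuous_attains_inf[of "B v"] False by blast
      have "x0 \<notin> B w" using disj True x0(1) by blast
      then have "infdist x0 (B w) > 0"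
        using in_closed_iff_infdist_zero[of "B w" x0] B True False infdist_nonneg[of x0 "B w"] by auto
      moreover have "infdist x0 (B w) \<le> dist x y" if "x \<in> B v" "y \<in> B w" for x y
        using x0(2)[OF that(1)] infdist_le[OF that(2), of x] by linarith
      ultimately show ?thesis by blast
    qed (auto intro: exI[of _ 1])
  qed (auto intro: exI[of _ 1])
  then obtain g where g: "\<And>v w. g v w > 0"
    "\<And>v w x y. v \<in> V \<Longrightarrow> w \<in> V \<Longrightarrow> v \<noteq> w \<Longrightarrow> x \<in> B v \<Longrightarrow> y \<in> B w \<Longrightarrow> g v w \<le> dist x y" by metis
  define d where "d = Min (insert 1 ((\<lambda>(v,w). g v w) ` (V \<times> V)))"
  have fin: "finite (insert 1 ((\<lambda>(v,w). g v w) ` (V \<times> V)))" using V by simp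
  have "d > 0" unfolding d_def using fin g(1) by (subst Min_gr_iff) auto
  moreover have "v = w" if "v \<in> V" "w \<in> V" "x \<in> B v" "y \<in> B w" "dist x y < d" for v w x y
  proof (rule ccontr)
    assume "v \<noteq> w"
    have "d \<le> g v w" unfolding d_def using fin that by (intro Min_le) auto
    also have "\<dots> \<le> dist x y" using g(2) that \<open>v \<noteq> w\<close> by blast
    finally show False using that by simp
  qed
  ultimately show ?thesis using that by blast
qed

context compact_dynamics
begin

lemma dyn_dist_less_iff: "dyn_dist f n x y < e \<longleftrightarrow> (\<forall>j\<le>n. dist ((f ^^ j) x) ((f ^^ j) y) < e)"
  by (auto simp: dyn_dist_def)

lemma dyn_dist_commute: "dyn_dist f n x y = dyn_dist f n y x"
  by (simp add: dyn_dist_def dist_commute)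

text \<open>Adding a point at distance at least \<open>\<epsilon>\<close> from all of \<open>E\<close> would enlarge a separated set of maximal cardinality.\<close>

lemma maximal_separated:
  assumes "\<epsilon> > 0"
  obtains E where "separated f n \<epsilon> E" "finite E" "\<And>x. \<exists>y\<in>E. dyn_dist f n x y < \<epsilon>"
proof -
  obtain N where N: "\<And>E. separated f n \<epsilon> E \<Longrightarrow> finite E \<and> card E \<le> N"
    using separated_card_bounded[OF cpt f assms] by blast
  have "separated f n \<epsilon> {}" by (simp add: separated_def)
  then obtain E where E: "separated f n \<epsilon> E" "\<And>E'. separated f n \<epsilon> E' \<Longrightarrow> card E' \<le> card E"
    using ex_has_greatest_nat[of "separated f n \<epsilon>" "{}" card "Suc N"] N
    by (auto simp: less_Suc_eq_le)
  have fin: "finite E" using N E(1) by blast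
  have "\<exists>y\<in>E. dyn_dist f n x y < \<epsilon>" for x
  proof (rule ccontr)
    assume a: "\<not> (\<exists>y\<in>E. dyn_dist f n x y < \<epsilon>)"
    have "dyn_dist f n x x < \<epsilon>" using assms by (simp add: dyn_dist_less_iff)
    then have "x \<notin> E" using a by blast
    have "separated f n \<epsilon> (insert x E)"
      unfolding separated_def
    proof (intro ballI impI)
      fix y z assume yz: "y \<in> insert x E" "z \<in> insert x E" "y \<noteq> z"
      have far: "\<epsilon> \<le> dyn_dist f n x w" "\<epsilon> \<le> dyn_dist f n w x" if "w \<in> E" for w
        using a that dyn_dist_commute[of n x w] by (auto simp: not_less)
      consider "y = x" "z \<in> E" | "z = x" "y \<in> E" | "y \<in> E" "z \<in> E" using yz by blast
      then show "\<epsilon> \<le> dyn_dist f n y z"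
        using far E(1) yz(3) by cases (auto simp: separated_def)
    qed
    then show False using E(2)[of "insert x E"] \<open>x \<notin> E\<close> fin by simp
  qed
  then show ?thesis using that E(1) fin by blast
qed

lemma invariant_integral_funpow:
  fixes \<psi> :: "'a \<Rightarrow> real"
  assumes \<mu>: "\<mu> \<in> invariant_probs f" and \<psi>: "continuous_on UNIV \<psi>"
  shows "(\<integral>x. \<psi> ((f ^^ n) x) \<partial>\<mu>) = (\<integral>x. \<psi> x \<partial>\<mu>)"
proof (induction n)
  case (Suc n)
  have b: "\<mu> \<in> borel_probs" using \<mu> by (simp add: invariant_probs_def)
  have "continuous_on UNIV (\<lambda>x. \<psi> ((f ^^ n) x))"
    using continuous_on_compose2[OF \<psi> funpow_continuous[OF f]] by simp
  then have "(\<integral>x. \<psi> ((f ^^ n) (f x)) \<partial>\<mu>) = (\<integral>x. \<psi> ((f ^^ n) x) \<partial>\<mu>)"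
    using invariant_probs_iff[OF cpt f b] \<mu> by blast
  then show ?case using Suc by (simp add: funpow_swap1)
qed simp

lemma birkhoff_sum_continuous:
  assumes "continuous_on UNIV (\<phi> :: 'a \<Rightarrow> real)"
  shows "continuous_on UNIV (birkhoff_sum f n \<phi>)"
proof -
  have "continuous_on UNIV (\<lambda>x. \<Sum>j\<le>n. \<phi> ((f ^^ j) x))"
    using continuous_on_compose2[OF assms funpow_continuous[OF f]] by (intro continuous_on_sum) simp
  then show ?thesis by (simp add: birkhoff_sum_def[abs_def])
qed

lemma invariant_integral_birkhoff:
  assumes \<mu>: "\<mu> \<in> invariant_probs f" and \<phi>: "continuous_on UNIV (\<phi> :: 'a \<Rightarrow> real)"
  shows "(\<integral>x. birkhoff_sum f n \<phi> x \<partial>\<mu>) = real (n + 1) * (\<integral>x. \<phi> x \<partial>\<mu>)"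
proof -
  have b: "\<mu> \<in> borel_probs" using \<mu> by (simp add: invariant_probs_def)
  have "continuous_on UNIV (\<lambda>x. \<phi> ((f ^^ j) x))" for j
    using continuous_on_compose2[OF \<phi> funpow_continuous[OF f]] by simp
  then have "integrable \<mu> (\<lambda>x. \<phi> ((f ^^ j) x))" for j
    by (rule continuous_integrable[OF cpt b])
  then show ?thesis
    by (simp add: birkhoff_sum_def Bochner_Integration.integral_sum invariant_integral_funpow[OF \<mu> \<phi>])
qed

lemma entropy_of_invariant_comp:
  assumes \<mu>: "\<mu> \<in> invariant_probs f" and Z: "finite_valued \<mu> Z"
  shows "finite_valued \<mu> (\<lambda>x. Z ((f ^^ p) x))" "entropy_of \<mu> (\<lambda>x. Z ((f ^^ p) x)) = entropy_of \<mu> Z"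
proof -
  have b: "\<mu> \<in> borel_probs" using \<mu> by (simp add: invariant_probs_def)
  have s: "sets \<mu> = sets borel" using borel_probsD(2)[OF b] .
  have fin: "finite (range Z)" and meas: "\<And>c. Z -` {c} \<in> sets borel"
    using Z s by (auto simp: finite_valued_def)
  have v: "(\<lambda>x. Z ((f ^^ p) x)) -` {c} = (f ^^ p) -` (Z -` {c})" for c by auto
  have sub: "range (\<lambda>x. Z ((f ^^ p) x)) \<subseteq> range Z" by auto
  show "finite_valued \<mu> (\<lambda>x. Z ((f ^^ p) x))"
    unfolding finite_valued_def v using finite_subset[OF sub fin] funpow_vimage_borel[OF f meas] s by simp
  have "measure \<mu> ((\<lambda>x. Z ((f ^^ p) x)) -` {c}) = measure \<mu> (Z -` {c})" for c
    unfolding v using invariant_funpow[OF f \<mu> meas] by (simp add: measure_def)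
  then show "entropy_of \<mu> (\<lambda>x. Z ((f ^^ p) x)) = entropy_of \<mu> Z"
    using entropy_of_superset[OF fin sub, of \<mu>] by (simp add: entropy_of_def)
qed

text \<open>The comparison between itineraries and separated sets, over \<open>n\<close> blocks of \<open>N\<close> iterates each.

Let \<open>X\<close> be the itinerary over one block. Each fibre of \<open>X\<close> contains a closed set \<open>B v\<close> that fills it up to measure
\<open>e\<close>. Let \<open>Y\<close> record the value of \<open>X\<close> on the union of the \<open>B v\<close> and \<open>None\<close> elsewhere, and let \<open>W\<close> record the value of \<open>X\<close>
exactly where \<open>Y\<close> does not. Then \<open>Y\<close> and \<open>W\<close> determine \<open>X\<close>, and \<open>W\<close> has small entropy because it is mostly constant.
The sets \<open>B v\<close> have a positive mutual distance \<open>d\<close>, so on a ball of radius at most \<open>d / 2\<close> the map \<open>Y\<close> takes at most two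
values. Hence at most \<open>2 ^ n\<close> sequences of values of \<open>Y\<close> are compatible with shadowing a given point of a maximal
separated set, and the Gibbs inequality bounds entropy plus energy of these sequences by the logarithm of the partition sum.\<close>

lemma block_estimate:
  assumes \<mu>: "\<mu> \<in> invariant_probs f" and P: "finite P" "partition_on UNIV P" "P \<subseteq> sets borel"
    and \<phi>: "continuous_on UNIV \<phi>" and N: "N > 0" and \<rho>: "\<rho> > 0"
  obtains \<delta> where "\<delta> > 0" "\<And>n. entropy_of \<mu> (itinerary f P {..<n * N}) + real (n * N + 1) * (\<integral>x. \<phi> x \<partial>\<mu>)
     \<le> real n * (2 + ln 2) + real (n * N + 1) * \<rho> + ln (partition_sum f \<phi> (n * N) \<delta>)"
proof -
  have b: "\<mu> \<in> borel_probs" using \<mu> by (simp add: invariant_probs_def)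
  interpret full_prob_space \<mu> by (rule full_prob_space_borel_probs[OF b])
  have s: "sets \<mu> = sets borel" using borel_probsD(2)[OF b] .
  have nfv: "finite_valued \<mu> (itinerary f P J)" if "finite J" for J
    unfolding itinerary_def using s that by (intro joint_finite_valued cell_finite_valued(1)[OF f _ P]) auto
  define X where "X = itinerary f P {..<N}"
  define V where "V = range X"
  have X: "finite_valued \<mu> X" unfolding X_def by (rule nfv) simp
  have V: "finite V" "V \<noteq> {}" using X by (auto simp: V_def finite_valued_def)
  \<comment> \<open>Chosen so that the \<open>card V\<close> values of \<open>W\<close> other than \<open>None\<close> contribute at most \<open>1\<close> to its entropy.\<close>
  define e where "e = (1 / (2 * real (card V))) ^ 2"
  have cV: "real (card V) > 0" using V by (simp add: card_gt_0_iff)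
  have e: "e > 0" "2 * sqrt e * real (card V) = 1" using cV by (auto simp: e_def)
  have "\<exists>C. closed C \<and> C \<subseteq> X -` {v} \<and> prob (X -` {v} - C) \<le> e" for v
    using X s by (intro closed_inner_regular cpt b e(1)) (auto simp: finite_valued_def)
  then obtain B where B: "\<And>v. closed (B v)" "\<And>v. B v \<subseteq> X -` {v}" "\<And>v. prob (X -` {v} - B v) \<le> e"
    by metis
  define Y where "Y x = (if x \<in> B (X x) then Some (X x) else None)" for x
  define W where "W x = (if x \<in> B (X x) then None else Some (X x))" for x
  define G where "G x = (x \<in> B (X x))" for x
  have "G -` {True} = (\<Union>v\<in>V. B v)" using B(2) by (force simp: G_def V_def)
  then have GT: "G -` {True} \<in> sets \<mu>" using V(1) B(1) s by auto
  moreover have "G -` {False} = UNIV - G -` {True}" by auto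
  ultimately have "G -` {b} \<in> sets \<mu>" for b using sets.compl_sets[OF GT] by (cases b) (simp_all add: space_UNIV)
  then have G: "finite_valued \<mu> G" by (simp add: finite_valued_def)
  have "Y x = Y y" "W x = W y" if "(X x, G x) = (X y, G y)" for x y
    using that by (auto simp: Y_def W_def G_def)
  then have Y: "finite_valued \<mu> Y" and W: "finite_valued \<mu> W"
    using entropy_of_determined(2)[OF finite_valued_pair[OF X G]] by blast+
  have HW: "entropy_of \<mu> W \<le> 2"
  proof -
    have "entropy_of \<mu> W = (\<Sum>w\<in>insert None (Some ` V). \<eta> (prob (W -` {w})))"
      using V(1) by (intro entropy_of_superset) (auto simp: W_def V_def)
    also have "\<dots> = \<eta> (prob (W -` {None}))
        + (\<Sum>v\<in>V. \<eta> (prob (W -` {Some v})))"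
      using V(1) by (subst sum.insert) (auto simp: sum.reindex)
    also have "\<dots> \<le> 1 + (\<Sum>v\<in>V. 2 * sqrt e)"
    proof (intro add_mono sum_mono neg_mult_ln_le_1 measure_nonneg)
      fix v
      have "W -` {Some v} = X -` {v} - B v" by (auto simp: W_def split: if_splits)
      then have "prob (W -` {Some v}) \<le> e" using B(3) by simp
      then have "2 * sqrt (prob (W -` {Some v})) \<le> 2 * sqrt e" by simp
      then show "\<eta> (prob (W -` {Some v})) \<le> 2 * sqrt e"
        using neg_mult_ln_le_sqrt[OF measure_nonneg, of \<mu> "W -` {Some v}"] by (rule order_trans[rotated])
    qed
    finally show ?thesis using e(2) by (simp add: mult.commute)
  qed
  obtain d where d: "d > 0"
    "\<And>v w x y. v \<in> V \<Longrightarrow> w \<in> V \<Longrightarrow> x \<in> B v \<Longrightarrow> y \<in> B w \<Longrightarrow> dist x y < d \<Longrightarrow> v = w"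
  proof (rule disjoint_closed_gap[OF cpt V(1) B(1)])
    show "B v \<inter> B w = {}" if "v \<noteq> w" for v w using B(2)[of v] B(2)[of w] that by auto
  qed blast
  have gap: "Y x = Y y" if "dist x y < d" "Y x \<noteq> None" "Y y \<noteq> None" for x y
    using that d(2)[of "X x" "X y" x y] by (auto simp: Y_def V_def split: if_splits)
  have "uniformly_continuous_on UNIV \<phi>" using \<phi> cpt by (rule compact_uniformly_continuous)
  then obtain d' where d': "d' > 0" "\<And>x y. dist x y < d' \<Longrightarrow> \<bar>\<phi> x - \<phi> y\<bar> < \<rho>"
    using \<rho> unfolding uniformly_continuous_on_def dist_real_def by (metis UNIV_I abs_minus_commute dist_commute)
  \<comment> \<open>Two points in one ball of radius \<open>d / 2\<close> are closer than \<open>d\<close>; the second bound controls the oscillation of \<open>\<phi>\<close>.\<close>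
  define \<delta> where "\<delta> = min (d / 2) d'"
  have \<delta>: "\<delta> > 0" "2 * \<delta> \<le> d" "\<delta> \<le> d'" using d d' by (auto simp: \<delta>_def)
  have "entropy_of \<mu> (itinerary f P {..<n * N}) + real (n * N + 1) * (\<integral>x. \<phi> x \<partial>\<mu>)
     \<le> real n * (2 + ln 2) + real (n * N + 1) * \<rho> + ln (partition_sum f \<phi> (n * N) \<delta>)" for n
  proof -
    define M where "M = n * N"
    obtain E where E: "separated f M \<delta> E" "finite E" "\<And>x. \<exists>y\<in>E. dyn_dist f M x y < \<delta>"
      using maximal_separated[OF \<delta>(1)] by blast
    define Yn where "Yn = joint (\<lambda>i x. Y ((f ^^ (i * N)) x)) {..<n}"
    define Wn where "Wn = joint (\<lambda>i x. W ((f ^^ (i * N)) x)) {..<n}"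
    note Yi = entropy_of_invariant_comp[OF \<mu> Y]
    note Wi = entropy_of_invariant_comp[OF \<mu> W]
    have Yn: "finite_valued \<mu> Yn" and Wn: "finite_valued \<mu> Wn"
      unfolding Yn_def Wn_def by (intro joint_finite_valued Yi Wi; simp)+
    have "entropy_of \<mu> (itinerary f P {..<M}) \<le> entropy_of \<mu> (\<lambda>x. (Yn x, Wn x))"
    proof (rule entropy_of_determined(1)[OF finite_valued_pair[OF Yn Wn]])
      fix x y assume a: "(Yn x, Wn x) = (Yn y, Wn y)"
      show "itinerary f P {..<M} x = itinerary f P {..<M} y"
        unfolding itinerary_eq_iff
      proof
        fix j assume "j \<in> {..<M}"
        then have i: "j div N < n" and r: "j mod N < N"
          using N by (auto simp: M_def less_mult_imp_div_less)
        define i where "i = j div N"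
        have "Y ((f ^^ (i * N)) x) = Y ((f ^^ (i * N)) y)" "W ((f ^^ (i * N)) x) = W ((f ^^ (i * N)) y)"
          using a i by (auto simp: Yn_def Wn_def joint_eq_iff i_def)
        then have "X ((f ^^ (i * N)) x) = X ((f ^^ (i * N)) y)"
          by (auto simp: Y_def W_def split: if_splits)
        then have "cell P ((f ^^ (j mod N)) ((f ^^ (i * N)) x)) = cell P ((f ^^ (j mod N)) ((f ^^ (i * N)) y))"
          using r unfolding X_def itinerary_eq_iff by blast
        moreover have "(f ^^ (j mod N)) ((f ^^ (i * N)) z) = (f ^^ j) z" for z
          by (metis (no_types, lifting) comp_apply funpow_add i_def mod_div_mult_eq)
        ultimately show "cell P ((f ^^ j) x) = cell P ((f ^^ j) y)" by simp
      qed
    qed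
    also have "\<dots> \<le> entropy_of \<mu> Yn + entropy_of \<mu> Wn" by (rule entropy_of_pair[OF Yn Wn])
    also have "entropy_of \<mu> Wn \<le> (\<Sum>i<n. entropy_of \<mu> (\<lambda>x. W ((f ^^ (i * N)) x)))"
      unfolding Wn_def by (intro entropy_of_joint_le Wi) simp
    also have "\<dots> \<le> real n * 2" using HW by (simp add: Wi(2) mult_left_mono)
    finally have H: "entropy_of \<mu> (itinerary f P {..<M}) \<le> entropy_of \<mu> Yn + real n * 2" by simp
    define near where "near c y \<longleftrightarrow> (\<exists>x. Yn x = c \<and> dyn_dist f M x y < \<delta>)" for c y
    define S where "S = birkhoff_sum f M \<phi>"
    \<comment> \<open>An upper bound for \<open>S\<close> on the fibre of \<open>Yn\<close> over \<open>c\<close>: orbits near a point of \<open>E\<close> have almost its Birkhoff sum.\<close>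
    define a where "a c = real (M + 1) * \<rho> + ln (\<Sum>y\<in>{y\<in>E. near c y}. exp (S y))" for c
    have le_a: "S x \<le> a (Yn x)" for x
    proof -
      obtain y where y: "y \<in> E" "dyn_dist f M x y < \<delta>" using E(3) by blast
      have "S x - S y = (\<Sum>j\<le>M. \<phi> ((f ^^ j) x) - \<phi> ((f ^^ j) y))"
        by (simp add: S_def birkhoff_sum_def sum_subtractf)
      also have "\<dots> \<le> (\<Sum>j\<le>M. \<rho>)"
      proof (rule sum_mono)
        fix j assume "j \<in> {..M}"
        then have "dist ((f ^^ j) x) ((f ^^ j) y) < d'" using y(2) \<delta>(3) by (fastforce simp: dyn_dist_less_iff)
        then show "\<phi> ((f ^^ j) x) - \<phi> ((f ^^ j) y) \<le> \<rho>" using d'(2) by (smt (verit))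
      qed
      finally have "S x \<le> S y + real (M + 1) * \<rho>" by (simp add: algebra_simps)
      moreover have "exp (S y) \<le> (\<Sum>y\<in>{y\<in>E. near (Yn x) y}. exp (S y))"
        using y E(2) by (intro member_le_sum) (auto simp: near_def)
      then have "S y \<le> ln (\<Sum>y\<in>{y\<in>E. near (Yn x) y}. exp (S y))"
        by (smt (verit) exp_gt_zero ln_exp ln_mono)
      ultimately show ?thesis by (simp add: a_def)
    qed
    have "real (M + 1) * (\<integral>x. \<phi> x \<partial>\<mu>) = (\<integral>x. S x \<partial>\<mu>)"
      unfolding S_def by (rule invariant_integral_birkhoff[OF \<mu> \<phi>, symmetric])
    also have "\<dots> \<le> (\<integral>x. a (Yn x) \<partial>\<mu>)"
      using birkhoff_sum_continuous[OF \<phi>] continuous_integrable[OF cpt b]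
      by (intro integral_mono le_a integral_finite_valued(1)[OF Yn]) (auto simp: S_def)
    also have "\<dots> = (\<Sum>c\<in>range Yn. prob (Yn -` {c}) * a c)" by (rule integral_finite_valued(2)[OF Yn])
    finally have "entropy_of \<mu> Yn + real (M + 1) * (\<integral>x. \<phi> x \<partial>\<mu>) \<le> ln (\<Sum>c\<in>range Yn. exp (a c))"
      using gibbs_variational[of "range Yn" "\<lambda>c. prob (Yn -` {c})" a] sum_prob[OF Yn] Yn
      by (simp add: entropy_of_def finite_valued_def)
    also have "\<dots> \<le> ln (exp (real (M + 1) * \<rho>) * (2 ^ n * partition_sum f \<phi> M \<delta>))"
    proof (rule ln_mono)
      have fY: "finite (range Yn)" using Yn by (simp add: finite_valued_def)
      then show "0 < (\<Sum>c\<in>range Yn. exp (a c))" by (intro sum_pos) auto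
      have cnt: "card {c \<in> range Yn. near c y} \<le> 2 ^ n" for y
      proof -
        \<comment> \<open>The only value other than \<open>None\<close> that \<open>Y\<close> can take at time \<open>i * N\<close> along orbits shadowing \<open>y\<close>.\<close>
        define t where "t i = (if \<exists>x. dyn_dist f M x y < \<delta> \<and> Y ((f ^^ (i * N)) x) \<noteq> None
          then Y ((f ^^ (i * N)) (SOME x. dyn_dist f M x y < \<delta> \<and> Y ((f ^^ (i * N)) x) \<noteq> None)) else None)" for i
        have t: "Y ((f ^^ (i * N)) x) \<in> {None, t i}" if x: "dyn_dist f M x y < \<delta>" and i: "i < n" for x i
        proof (cases "Y ((f ^^ (i * N)) x) = None")
          case False
          define x' where "x' = (SOME x. dyn_dist f M x y < \<delta> \<and> Y ((f ^^ (i * N)) x) \<noteq> None)"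
          have x': "dyn_dist f M x' y < \<delta> \<and> Y ((f ^^ (i * N)) x') \<noteq> None"
            unfolding x'_def by (rule someI[of _ x]) (use x False in blast)
          have "i * N \<le> M" using i by (simp add: M_def)
          then have "dist ((f ^^ (i * N)) x) ((f ^^ (i * N)) y) < \<delta>" "dist ((f ^^ (i * N)) x') ((f ^^ (i * N)) y) < \<delta>"
            using x x' by (auto simp: dyn_dist_less_iff)
          then have "dist ((f ^^ (i * N)) x) ((f ^^ (i * N)) x') < d"
            using dist_triangle2[of "(f ^^ (i * N)) x" "(f ^^ (i * N)) x'" "(f ^^ (i * N)) y"] \<delta>(2) by linarith
          then have "Y ((f ^^ (i * N)) x) = Y ((f ^^ (i * N)) x')" using gap False x' by blast
          moreover have "t i = Y ((f ^^ (i * N)) x')" unfolding t_def x'_def using x False by auto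
          ultimately show ?thesis by simp
        qed simp
        have "{c \<in> range Yn. near c y} \<subseteq> (\<Pi>\<^sub>E i\<in>{..<n}. {None, t i})"
        proof
          fix c assume "c \<in> {c \<in> range Yn. near c y}"
          then have "near c y" by simp
          then obtain x where x: "c = Yn x" "dyn_dist f M x y < \<delta>" unfolding near_def by blast
          show "c \<in> (\<Pi>\<^sub>E i\<in>{..<n}. {None, t i})"
            unfolding x(1) Yn_def joint_def restrict_PiE_iff using t[OF x(2)] by blast
        qed
        then have "card {c \<in> range Yn. near c y} \<le> card (\<Pi>\<^sub>E i\<in>{..<n}. {None, t i})"
          by (intro card_mono finite_PiE) auto
        also have "\<dots> = (\<Prod>i<n. card {None, t i})" by (simp add: card_PiE)
        also have "\<dots> \<le> (\<Prod>i<n. 2)" by (intro prod_mono) (auto simp: card_insert_if)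
        finally show ?thesis by simp
      qed
      have "(\<Sum>c\<in>range Yn. exp (a c)) = (\<Sum>c\<in>range Yn. exp (real (M + 1) * \<rho>) * (\<Sum>y\<in>{y\<in>E. near c y}. exp (S y)))"
      proof (intro sum.cong refl)
        fix c assume "c \<in> range Yn"
        then obtain x where "c = Yn x" by blast
        moreover obtain y where "y \<in> E" "dyn_dist f M x y < \<delta>" using E(3) by blast
        ultimately have "y \<in> {y\<in>E. near c y}" by (auto simp: near_def)
        then have "0 < (\<Sum>y\<in>{y\<in>E. near c y}. exp (S y))" using E(2) by (intro sum_pos) auto
        then show "exp (a c) = exp (real (M + 1) * \<rho>) * (\<Sum>y\<in>{y\<in>E. near c y}. exp (S y))"
          by (simp add: a_def exp_add)
      qed
      also have "\<dots> = exp (real (M + 1) * \<rho>) * (\<Sum>c\<in>range Yn. \<Sum>y\<in>{y\<in>E. near c y}. exp (S y))"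
        by (simp add: sum_distrib_left)
      also have "(\<Sum>c\<in>range Yn. \<Sum>y\<in>{y\<in>E. near c y}. exp (S y)) = (\<Sum>y\<in>E. \<Sum>c\<in>{c\<in>range Yn. near c y}. exp (S y))"
        by (rule sum.swap_restrict[OF fY E(2)])
      also have "\<dots> \<le> (\<Sum>y\<in>E. 2 ^ n * exp (S y))"
      proof (rule sum_mono)
        fix y
        have "real (card {c \<in> range Yn. near c y}) \<le> 2 ^ n" using cnt[of y] by (metis of_nat_le_iff of_nat_numeral of_nat_power)
        then show "(\<Sum>c\<in>{c\<in>range Yn. near c y}. exp (S y)) \<le> 2 ^ n * exp (S y)" by (simp add: mult_right_mono)
      qed
      also have "(\<Sum>y\<in>E. 2 ^ n * exp (S y)) \<le> 2 ^ n * partition_sum f \<phi> M \<delta>"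
        using partition_sum_upper[OF \<phi> \<delta>(1) E(1)] by (simp add: S_def flip: sum_distrib_left)
      finally show "(\<Sum>c\<in>range Yn. exp (a c)) \<le> exp (real (M + 1) * \<rho>) * (2 ^ n * partition_sum f \<phi> M \<delta>)"
        by simp
    qed
    also have "\<dots> = real (M + 1) * \<rho> + (real n * ln 2 + ln (partition_sum f \<phi> M \<delta>))"
      using partition_sum_pos[OF \<phi> \<delta>(1), of M] by (simp add: ln_mult ln_realpow)
    finally show ?thesis using H by (simp add: M_def algebra_simps)
  qed
  with \<delta>(1) show ?thesis using that by blast
qed

text \<open>Divide the block estimate by \<open>n * N\<close> and let \<open>n\<close> tend to infinity. The loss of \<open>2 + ln 2\<close> per block becomes
\<open>(2 + ln 2) / N\<close> and vanishes as \<open>N\<close> grows.\<close>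

theorem variational_upper_bound:
  assumes \<mu>: "\<mu> \<in> invariant_probs f" and \<phi>: "continuous_on UNIV \<phi>"
  shows "metric_entropy \<mu> f \<le> P_top f \<phi> - ereal (\<integral>x. \<phi> x \<partial>\<mu>)"
  unfolding metric_entropy_def
proof (rule SUP_least)
  fix P :: "'a set set" assume "P \<in> {P. finite P \<and> partition_on UNIV P \<and> P \<subseteq> sets borel}"
  then have P: "finite P" "partition_on UNIV P" "P \<subseteq> sets borel" by auto
  obtain h where h: "entropy_wrt \<mu> f P = ereal h"
    "(\<lambda>n. entropy_of \<mu> (itinerary f P {..<n}) / real n) \<longlonglongrightarrow> h"
    using entropy_wrt_limit[OF f \<mu> P] by metis
  define I where "I = (\<integral>x. \<phi> x \<partial>\<mu>)"
  have *: "ereal (h + I - 1 / real N - (2 + ln 2) * (1 / real N)) \<le> P_top f \<phi>" if N: "N > 0" for N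
  proof -
    have "1 / real N > 0" using N by simp
    then obtain \<delta> where \<delta>: "\<delta> > 0" "\<And>n. entropy_of \<mu> (itinerary f P {..<n * N}) + real (n * N + 1) * I
       \<le> real n * (2 + ln 2) + real (n * N + 1) * (1 / real N) + ln (partition_sum f \<phi> (n * N) \<delta>)"
      using block_estimate[OF \<mu> P \<phi> N] unfolding I_def by metis
    define u where "u n = ereal (1 / real n * ln (partition_sum f \<phi> n \<delta>))" for n
    define r where "r n = n * N" for n
    have r: "strict_mono r" unfolding r_def using N by (intro strict_monoI) simp
    define v where "v n = entropy_of \<mu> (itinerary f P {..<n}) / real n + (I - 1 / real N) * (1 + 1 / real n)" for n
    have "v \<longlonglongrightarrow> h + (I - 1 / real N) * (1 + 0)"
      unfolding v_def by (intro tendsto_intros h(2) lim_1_over_n)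
    then have "(\<lambda>n. v (r n)) \<longlonglongrightarrow> h + (I - 1 / real N) * (1 + 0)"
      using LIMSEQ_subseq_LIMSEQ[OF _ r] by (auto simp: o_def)
    then have "(\<lambda>n. ereal (v (r n) - (2 + ln 2) * (1 / real N))) \<longlonglongrightarrow> ereal (h + (I - 1 / real N) * (1 + 0) - (2 + ln 2) * (1 / real N))"
      by (intro tendsto_intros)
    then have "ereal (h + (I - 1 / real N) * (1 + 0) - (2 + ln 2) * (1 / real N)) = limsup (\<lambda>n. ereal (v (r n) - (2 + ln 2) * (1 / real N)))"
      by (intro lim_imp_Limsup[symmetric]) auto
    also have "\<dots> \<le> limsup (u \<circ> r)"
    proof (rule Limsup_mono)
      show "\<forall>\<^sub>F n in sequentially. ereal (v (r n) - (2 + ln 2) * (1 / real N)) \<le> (u \<circ> r) n"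
        using eventually_gt_at_top[of 0]
      proof eventually_elim
        case (elim n)
        have M: "real (r n) > 0" using elim N by (simp add: r_def)
        have "real n = real (r n) * (1 / real N)" using N by (simp add: r_def)
        then have "entropy_of \<mu> (itinerary f P {..<r n}) + (real (r n) + 1) * I
          \<le> real (r n) * ((2 + ln 2) * (1 / real N)) + (real (r n) + 1) * (1 / real N) + ln (partition_sum f \<phi> (r n) \<delta>)"
          using \<delta>(2)[of n] unfolding r_def[symmetric] by (simp add: algebra_simps)
        then have "(entropy_of \<mu> (itinerary f P {..<r n}) + (real (r n) + 1) * I) / real (r n)
          \<le> (real (r n) * ((2 + ln 2) * (1 / real N)) + (real (r n) + 1) * (1 / real N) + ln (partition_sum f \<phi> (r n) \<delta>)) / real (r n)"
          using M by (intro divide_right_mono) auto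
        then show ?case using M by (simp add: u_def v_def add_divide_distrib diff_divide_distrib algebra_simps)
      qed
    qed
    also have "\<dots> \<le> limsup u" by (rule limsup_subseq_mono[OF r])
    also have "\<dots> \<le> P_top f \<phi>"
      using growth_rate_le_P_top[OF \<phi> \<delta>(1)] by (simp add: growth_rate_def u_def[abs_def])
    finally show ?thesis by (simp add: algebra_simps)
  qed
  have "(\<lambda>N. ereal (h + I - 1 / real N - (2 + ln 2) * (1 / real N))) \<longlonglongrightarrow> ereal (h + I - 0 - (2 + ln 2) * 0)"
    by (intro tendsto_intros lim_1_over_n)
  then have "ereal (h + I) \<le> P_top f \<phi>"
    using * by (intro LIMSEQ_le_const2[where X="\<lambda>N. ereal (h + I - 1 / real N - (2 + ln 2) * (1 / real N))"])
      (auto intro!: exI[of _ 1])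
  then show "entropy_wrt \<mu> f P \<le> P_top f \<phi> - ereal (\<integral>x. \<phi> x \<partial>\<mu>)"
    by (simp add: h(1) ereal_le_minus I_def)
qed

end

section \<open>Invariant measures of almost maximal free energy\<close>

lemma neg_mult_ln_nonneg: "0 \<le> p \<Longrightarrow> p \<le> 1 \<Longrightarrow> 0 \<le> - p * ln (p::real)"
  by (cases "p = 0") (auto simp: mult_nonneg_nonpos)

text \<open>At the end point \<open>p = 0\<close>, where the logarithm is unbounded, continuity of \<open>\<eta>\<close> comes from the square-root bound.\<close>

lemma neg_mult_ln_close:
  fixes p :: real
  assumes "0 \<le> p" "0 < e"
  obtains d where "d > 0" "\<And>t. 0 \<le> t \<Longrightarrow> t \<le> 1 \<Longrightarrow> \<bar>t - p\<bar> < d \<Longrightarrow> \<bar>\<eta> t - (\<eta> p)\<bar> < e"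
proof (cases "p = 0")
  case True
  show ?thesis
  proof
    show "(e / 2) ^ 2 > 0" using assms by simp
    fix t assume t: "0 \<le> t" "t \<le> 1" "\<bar>t - p\<bar> < (e / 2) ^ 2"
    then have "sqrt t < sqrt ((e / 2) ^ 2)" using True by (intro real_sqrt_less_mono) simp
    then have "2 * sqrt t < e" using assms by simp
    then have "\<eta> t < e" using neg_mult_ln_le_sqrt[OF t(1)] by linarith
    then show "\<bar>\<eta> t - (\<eta> p)\<bar> < e" using neg_mult_ln_nonneg[OF t(1,2)] True by simp
  qed
next
  case False
  then have "isCont (\<lambda>t. \<eta> t) p" by (intro continuous_intros) auto
  then obtain d where "d > 0" "\<And>t. \<bar>t - p\<bar> < d \<Longrightarrow> \<bar>\<eta> t - (\<eta> p)\<bar> < e"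
    using assms(2) unfolding continuous_at_eps_delta dist_real_def by meson
  then show ?thesis using that by blast
qed

text \<open>The points where \<open>g\<close> is not locally constant contain the frontiers of all fibres of \<open>g\<close>, and this set behaves
well under compositions and tuples.\<close>

definition locally_constant_at :: "('b::topological_space \<Rightarrow> 'c) \<Rightarrow> 'b \<Rightarrow> bool" where
  "locally_constant_at g y \<longleftrightarrow> (\<exists>U. open U \<and> y \<in> U \<and> (\<forall>z\<in>U. g z = g y))"

lemma frontier_not_locally_constant:
  assumes "y \<in> frontier (g -` {v})"
  shows "\<not> locally_constant_at g y"
proof
  assume "locally_constant_at g y"
  then obtain U where U: "open U" "y \<in> U" "\<And>z. z \<in> U \<Longrightarrow> g z = g y"
    unfolding locally_constant_at_def by blast
  have "y \<in> closure (g -` {v})" "y \<notin> interior (g -` {v})" using assms by (auto simp: frontier_def)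
  then have "U \<inter> g -` {v} \<noteq> {}" using U open_Int_closure_eq_empty[OF U(1)] by blast
  then have "g y = v" using U(3) by auto
  then have "U \<subseteq> g -` {v}" using U(3) by auto
  then show False using U(1,2) \<open>y \<notin> interior (g -` {v})\<close> interiorI by blast
qed

text \<open>Only countably many values of the distance from \<open>x\<close> can carry positive mass.\<close>

lemma null_sphere:
  assumes \<mu>: "\<mu> \<in> borel_probs" and "e > 0"
  shows "\<exists>r. 0 < r \<and> r < e \<and> measure \<mu> {y. dist (x::'a::metric_space) y = r} = 0"
proof -
  interpret prob_space \<mu> using borel_probsD(1)[OF \<mu>] .
  have m: "dist x \<in> borel_measurable \<mu>"
    by (intro continuous_measurable \<mu> continuous_intros)
  interpret D: prob_space "distr \<mu> borel (dist x)" using m by (rule prob_space_distr)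
  have "countable {r. measure (distr \<mu> borel (dist x)) {r} \<noteq> 0}" by (rule D.countable_support)
  then have "\<not> {0<..<e} \<subseteq> {r. measure (distr \<mu> borel (dist x)) {r} \<noteq> 0}"
    using uncountable_open_interval[of 0 e] assms(2) countable_subset by blast
  then obtain r where r: "0 < r" "r < e" "measure (distr \<mu> borel (dist x)) {r} = 0" by auto
  moreover have "measure (distr \<mu> borel (dist x)) {r} = measure \<mu> {y. dist x y = r}"
    using m borel_probsD(3)[OF \<mu>] by (subst measure_distr) (auto intro: arg_cong[of _ _ "measure \<mu>"])
  ultimately show ?thesis by auto
qed

text \<open>Cover the space by finitely many small balls whose spheres are null, and group points according to the set of
balls that contain them. Off the spheres this set is locally constant.\<close>

lemma null_boundary_partition:
  assumes cpt: "compact (UNIV :: 'a::metric_space set)" and \<mu>: "\<mu> \<in> borel_probs" and \<epsilon>: "\<epsilon> > 0"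
  obtains P N where "finite P" "partition_on UNIV P" "P \<subseteq> sets borel"
    "\<And>A x y. A \<in> P \<Longrightarrow> x \<in> A \<Longrightarrow> y \<in> A \<Longrightarrow> dist x y < \<epsilon>"
    "(N :: 'a set) \<in> sets borel" "emeasure \<mu> N = 0" "\<And>x. x \<notin> N \<Longrightarrow> locally_constant_at (cell P) x"
proof -
  interpret prob_space \<mu> using borel_probsD(1)[OF \<mu>] .
  have s: "sets \<mu> = sets borel" using borel_probsD(2)[OF \<mu>] .
  have "\<forall>x::'a. \<exists>r. 0 < r \<and> r < \<epsilon> / 2 \<and> measure \<mu> {y. dist x y = r} = 0"
    using null_sphere[OF \<mu>] \<epsilon> half_gt_zero by blast
  then obtain r :: "'a \<Rightarrow> real" where r: "\<And>x. 0 < r x" "\<And>x. r x < \<epsilon> / 2"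
    "\<And>x. measure \<mu> {y. dist x y = r x} = 0" by metis
  have "UNIV \<subseteq> (\<Union>x. ball x (r x))" using r(1) by auto
  then obtain C where C: "finite C" "UNIV \<subseteq> (\<Union>x\<in>C. ball x (r x))"
    using compactE_image[OF cpt, of UNIV "\<lambda>x. ball x (r x)"] by (metis open_ball)
  define g where "g y = {c\<in>C. y \<in> ball c (r c)}" for y
  define P where "P = (\<lambda>y. g -` {g y}) ` UNIV"
  define N where "N = (\<Union>c\<in>C. {y. dist c y = r c})"
  have fib: "g -` {t} = (if t \<subseteq> C then (\<Inter>c\<in>t. ball c (r c)) - (\<Union>c\<in>C - t. ball c (r c)) else {})" for t
    unfolding g_def by auto
  have "finite (range g)" by (rule finite_subset[of _ "Pow C"]) (use C(1) in \<open>auto simp: g_def\<close>)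
  moreover have "P = (\<lambda>t. g -` {t}) ` range g" by (auto simp: P_def)
  ultimately have "finite P" by simp
  moreover have part: "partition_on UNIV P"
    by (rule partition_onI) (auto simp: P_def disjnt_def)
  moreover have "P \<subseteq> sets borel"
  proof -
    have "g -` {t} \<in> sets borel" for t
    proof (cases "t \<subseteq> C")
      case True
      then have "finite t" using C(1) finite_subset by blast
      then have "(\<Inter>c\<in>t. ball c (r c)) \<in> sets borel" by (intro borel_open open_INT) auto
      moreover have "(\<Union>c\<in>C - t. ball c (r c)) \<in> sets borel" by (intro borel_open open_UN) auto
      ultimately show ?thesis using True unfolding fib by auto
    qed (simp add: fib)
    then show ?thesis by (auto simp: P_def)
  qed
  moreover have "dist x y < \<epsilon>" if A: "A \<in> P" "x \<in> A" "y \<in> A" for A x y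
  proof -
    obtain c where c: "c \<in> C" "x \<in> ball c (r c)" using C(2) by blast
    have "g y = g x" using A by (auto simp: P_def)
    then have "y \<in> ball c (r c)" using c by (auto simp: g_def)
    then show ?thesis using c(2) r(2)[of c] dist_triangle3[of x y c] by simp
  qed
  moreover have sph: "{y. dist c y = r c} \<in> sets borel" for c
    by (intro borel_closed closed_Collect_eq continuous_intros)
  then have Nb: "N \<in> sets borel" unfolding N_def using C(1) by auto
  moreover have "emeasure \<mu> N = 0"
  proof -
    have "{y. dist c y = r c} \<in> null_sets \<mu>" for c
      using r(3)[of c] sph s by (auto simp: null_sets_def emeasure_eq_measure)
    then have "N \<in> null_sets \<mu>" unfolding N_def using C(1)
      by (intro null_sets_UN') (auto intro: countable_finite)
    then show ?thesis by auto
  qed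
  moreover have "locally_constant_at (cell P) x" if x: "x \<notin> N" for x
  proof -
    define U where "U = (\<Inter>c\<in>g x. ball c (r c)) \<inter> (\<Inter>c\<in>C - g x. - cball c (r c))"
    have fg: "finite (g x)" using C(1) by (simp add: g_def)
    have "open U" unfolding U_def using fg C(1) by (intro open_Int open_INT) auto
    moreover have "x \<in> U" using x by (auto simp: U_def g_def N_def)
    moreover have "cell P z = cell P x" if z: "z \<in> U" for z
    proof -
      have "c \<in> g z \<longleftrightarrow> c \<in> g x" for c
      proof (cases "c \<in> g x")
        case True
        then have "c \<in> C" "z \<in> ball c (r c)" using z by (auto simp: U_def g_def)
        then show ?thesis using True by (simp add: g_def)
      next
        case False
        have "z \<in> (\<Inter>c\<in>C - g x. - cball c (r c))" using z unfolding U_def by (rule IntD2)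
        then have "z \<notin> cball c (r c)" if "c \<in> C" using that False by blast
        then have "z \<notin> ball c (r c)" if "c \<in> C" using that ball_subset_cball by blast
        then have "c \<notin> g z" unfolding g_def by blast
        then show ?thesis using False by simp
      qed
      then have "g z = g x" by (rule set_eqI)
      moreover have "g -` {g x} \<in> P" unfolding P_def by blast
      ultimately show ?thesis using cell_eqI[OF part, of "g -` {g x}"] by simp
    qed
    ultimately show ?thesis unfolding locally_constant_at_def by blast
  qed
  ultimately show ?thesis using that by blast
qed

lemma pmf_with_weights:
  fixes w :: "'b \<Rightarrow> real"
  assumes "finite E" "\<And>x. x \<in> E \<Longrightarrow> 0 < w x" "sum w E = 1"
  obtains S where "set_pmf S = E" "\<And>x. x \<in> E \<Longrightarrow> pmf S x = w x"
proof -
  define g where "g x = (if x \<in> E then w x else 0)" for x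
  have nn: "0 \<le> g x" for x using assms(2)[of x] by (auto simp: g_def)
  have "(\<integral>\<^sup>+ x. ennreal (g x) \<partial>count_space UNIV) = (\<Sum>x\<in>E. ennreal (g x))"
    by (rule nn_integral_count_space') (use assms nn in \<open>auto simp: g_def\<close>)
  also have "\<dots> = ennreal (sum g E)" by (rule sum_ennreal) (rule nn)
  also have "sum g E = 1" using assms(3) by (simp add: g_def)
  finally have one: "(\<integral>\<^sup>+ x. ennreal (g x) \<partial>count_space UNIV) = 1" by simp
  have "pmf (embed_pmf g) x = g x" for x by (rule pmf_embed_pmf[OF nn one])
  moreover have "set_pmf (embed_pmf g) = E"
    unfolding set_embed_pmf[OF nn one] using assms(2) by (force simp: g_def)
  ultimately show ?thesis using that[of "embed_pmf g"] by (simp add: g_def)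
qed

lemma full_prob_space_pmf: "full_prob_space (measure_pmf S)"
  by unfold_locales auto

definition empirical :: "('a::topological_space \<Rightarrow> 'a) \<Rightarrow> nat \<Rightarrow> 'a pmf \<Rightarrow> 'a measure" where
  "empirical f m S = distr (measure_pmf (pmf_of_set {..<m} \<bind> (\<lambda>p. map_pmf (f ^^ p) S))) borel (\<lambda>x. x)"

lemma empirical_borel_probs: "empirical f m S \<in> borel_probs"
  unfolding empirical_def borel_probs_def by (auto intro!: measure_pmf.prob_space_distr)

lemma empirical_integral:
  fixes h :: "'a::topological_space \<Rightarrow> real"
  assumes "m > 0" "finite (set_pmf S)" "h \<in> borel_measurable borel"
  shows "(\<integral>x. h x \<partial>empirical f m S) = (\<Sum>p<m. \<integral>x. h ((f ^^ p) x) \<partial>measure_pmf S) / real m"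
proof -
  have "(\<integral>x. h x \<partial>empirical f m S) =
     measure_pmf.expectation (pmf_of_set {..<m} \<bind> (\<lambda>p. map_pmf (f ^^ p) S)) h"
    unfolding empirical_def using assms(3) by (subst integral_distr) auto
  also have "\<dots> = (\<Sum>p<m. measure_pmf.expectation (map_pmf (f ^^ p) S) h /\<^sub>R real (card {..<m}))"
    using assms by (intro pmf_expectation_bind_pmf_of_set) auto
  also have "\<dots> = (\<Sum>p<m. \<integral>x. h ((f ^^ p) x) \<partial>measure_pmf S) / real m"
    by (simp add: sum_distrib_left divide_inverse mult.commute)
  finally show ?thesis .
qed

lemma empirical_measure:
  assumes "m > 0" "finite (set_pmf S)" "A \<in> sets borel"
  shows "measure (empirical f m S) A = (\<Sum>p<m. measure (measure_pmf S) ((f ^^ p) -` A)) / real m"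
proof -
  have b: "empirical f m S \<in> borel_probs" by (rule empirical_borel_probs)
  have "measure (empirical f m S) A = (\<integral>x. indicator A x \<partial>empirical f m S)"
    using assms(3) borel_probsD(2,3)[OF b] by simp
  also have "\<dots> = (\<Sum>p<m. \<integral>x. indicator A ((f ^^ p) x) \<partial>measure_pmf S) / real m"
    by (rule empirical_integral) (use assms in auto)
  also have "(\<lambda>p. \<integral>x. indicator A ((f ^^ p) x) \<partial>measure_pmf S) = (\<lambda>p. measure (measure_pmf S) ((f ^^ p) -` A))"
  proof
    fix p
    have "(\<integral>x. indicator A ((f ^^ p) x) \<partial>measure_pmf S) = (\<integral>x. (indicator ((f ^^ p) -` A) x :: real) \<partial>measure_pmf S)"
      by (intro Bochner_Integration.integral_cong) (auto simp: indicator_def)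
    then show "(\<integral>x. indicator A ((f ^^ p) x) \<partial>measure_pmf S) = measure (measure_pmf S) ((f ^^ p) -` A)" by simp
  qed
  finally show ?thesis .
qed

context compact_dynamics
begin

text \<open>The average of a coboundary over the orbit telescopes.\<close>

lemma empirical_almost_invariant:
  fixes \<psi> :: "'a \<Rightarrow> real"
  assumes m: "m > 0" "finite (set_pmf S)" and \<psi>: "continuous_on UNIV \<psi>" and B: "\<And>x. \<bar>\<psi> x\<bar> \<le> B"
  shows "\<bar>(\<integral>x. \<psi> (f x) - \<psi> x \<partial>empirical f m S)\<bar> \<le> 2 * B / real m"
proof -
  have c: "continuous_on UNIV (\<lambda>x. \<psi> (f x) - \<psi> x)"
    using continuous_on_compose2[OF \<psi> f] by (intro continuous_intros \<psi>) auto
  define F where "F p = (\<integral>x. \<psi> ((f ^^ p) x) \<partial>measure_pmf S)" for p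
  have int: "integrable (measure_pmf S) h" for h :: "'a \<Rightarrow> real" using m(2) by (rule integrable_measure_pmf_finite)
  have "(\<integral>x. \<psi> (f x) - \<psi> x \<partial>empirical f m S) =
     (\<Sum>p<m. \<integral>x. \<psi> (f ((f ^^ p) x)) - \<psi> ((f ^^ p) x) \<partial>measure_pmf S) / real m"
    by (rule empirical_integral[OF m borel_measurable_continuous_onI[OF c]])
  also have "(\<Sum>p<m. \<integral>x. \<psi> (f ((f ^^ p) x)) - \<psi> ((f ^^ p) x) \<partial>measure_pmf S) = (\<Sum>p<m. F (Suc p) - F p)"
    by (simp add: F_def Bochner_Integration.integral_diff[OF int int])
  also have "\<dots> = F m - F 0" by (rule sum_lessThan_telescope)
  finally have eq: "(\<integral>x. \<psi> (f x) - \<psi> x \<partial>empirical f m S) = (F m - F 0) / real m" .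
  have "\<bar>F p\<bar> \<le> B" for p
  proof -
    have "\<bar>F p\<bar> \<le> (\<integral>x. \<bar>\<psi> ((f ^^ p) x)\<bar> \<partial>measure_pmf S)" unfolding F_def by (rule integral_abs_bound)
    also have "\<dots> \<le> (\<integral>x. B \<partial>measure_pmf S)" by (intro integral_mono int B)
    finally show ?thesis by simp
  qed
  from this[of m] this[of 0] have "\<bar>F m - F 0\<bar> \<le> 2 * B" by linarith
  then show ?thesis using m(1) unfolding eq by (simp add: divide_right_mono)
qed

text \<open>An exponential growth rate \<open>b\<close> of partition sums is passed on to entropy plus energy of orbit averages of \<open>S\<close>. One
\<open>S\<close> has to serve all partitions and all \<open>q\<close>, because the partition is chosen only after the cluster point of the averages.\<close>

definition entropy_controlled :: "nat \<Rightarrow> real \<Rightarrow> ('a \<Rightarrow> real) \<Rightarrow> real \<Rightarrow> 'a pmf \<Rightarrow> bool" where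
  "entropy_controlled n \<epsilon> \<phi> b S \<longleftrightarrow> finite (set_pmf S) \<and>
    (\<forall>P q. finite P \<longrightarrow> partition_on UNIV P \<longrightarrow> P \<subseteq> sets borel \<longrightarrow>
      (\<forall>A\<in>P. \<forall>x\<in>A. \<forall>y\<in>A. dist x y < \<epsilon>) \<longrightarrow> q > 0 \<longrightarrow>
      real q * b \<le> real q ^ 2 * ln (real (card P)) +
        real (Suc n) * entropy_of (empirical f (Suc n) S) (itinerary f P {..<q}) +
        real q * (real (Suc n) * (\<integral>x. \<phi> x \<partial>empirical f (Suc n) S)))"

lemma entropy_controlled_mono:
  assumes "entropy_controlled n \<epsilon> \<phi> b S" "b' \<le> b"
  shows "entropy_controlled n \<epsilon> \<phi> b' S"
proof -
  have "real q * b' \<le> real q * b" for q using assms(2) by (intro mult_left_mono) auto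
  then show ?thesis using assms(1) unfolding entropy_controlled_def by (meson order_trans)
qed

text \<open>The weights of \<open>S\<close> are the Gibbs weights \<open>exp (birkhoff_sum f n \<phi> x) / Z\<close> on \<open>E\<close>, for which entropy plus energy is
exactly \<open>ln Z\<close>. Distinct points of \<open>E\<close> have distinct itineraries when the cells have diameter below \<open>\<epsilon>\<close>, so this
entropy is bounded by that of the itinerary over times \<open>0, ..., n\<close>. The block estimate breaks it into itineraries of
length \<open>q\<close>, and concavity moves the average over starting times inside.\<close>

lemma empirical_entropy_bound:
  assumes \<phi>: "continuous_on UNIV \<phi>" and \<epsilon>: "\<epsilon> > 0"
    and E: "separated f n \<epsilon> E" "E \<noteq> {}"
  shows "\<exists>S. entropy_controlled n \<epsilon> \<phi> (ln (\<Sum>x\<in>E. exp (birkhoff_sum f n \<phi> x))) S"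
proof -
  have fin: "finite E" using E \<epsilon> separated_finite by blast
  define Z where "Z = (\<Sum>x\<in>E. exp (birkhoff_sum f n \<phi> x))"
  have Z: "Z > 0" unfolding Z_def using fin E(2) by (intro sum_pos) auto
  define w where "w x = exp (birkhoff_sum f n \<phi> x) / Z" for x
  have w: "0 < w x" for x using Z by (simp add: w_def)
  have "sum w E = 1" using Z by (simp add: w_def Z_def flip: sum_divide_distrib)
  then obtain S where S: "set_pmf S = E" "\<And>x. x \<in> E \<Longrightarrow> pmf S x = w x"
    using pmf_with_weights[OF fin, of w] w by metis
  define \<nu> where "\<nu> = empirical f (Suc n) S"
  interpret full_prob_space "measure_pmf S" by (rule full_prob_space_pmf)
  have int: "integrable (measure_pmf S) h" for h :: "'a \<Rightarrow> real"
    using fin S(1) by (intro integrable_measure_pmf_finite) simp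
  have "real q * ln Z \<le> real q ^ 2 * ln (real (card P)) +
         real (Suc n) * entropy_of \<nu> (itinerary f P {..<q}) + real q * (real (Suc n) * (\<integral>x. \<phi> x \<partial>\<nu>))"
    if P: "finite P" "partition_on UNIV P" "P \<subseteq> sets borel"
      and diam: "\<forall>A\<in>P. \<forall>x\<in>A. \<forall>y\<in>A. dist x y < \<epsilon>" and q: "q > 0" for P :: "'a set set" and q
  proof -
    define X where "X = itinerary f P {..<Suc n}"
    have nfv: "finite_valued (measure_pmf S) (itinerary f P J)" if "finite J" for J
      unfolding itinerary_def using that by (intro joint_finite_valued cell_finite_valued(1)[OF f _ P]) auto
    have inj: "x = y" if xy: "x \<in> E" "y \<in> E" "X x = X y" for x y
    proof (rule ccontr)
      assume "x \<noteq> y"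
      have "dist ((f ^^ j) x) ((f ^^ j) y) < \<epsilon>" if "j \<le> n" for j
      proof -
        have "cell P ((f ^^ j) x) = cell P ((f ^^ j) y)"
          using xy(3) that by (simp add: X_def itinerary_eq_iff)
        then show ?thesis using diam cell_mem[OF P(2)] by metis
      qed
      then have "dyn_dist f n x y < \<epsilon>" by (simp add: dyn_dist_less_iff)
      then show False using E(1) xy \<open>x \<noteq> y\<close> unfolding separated_def by (meson not_le)
    qed
    have pw: "measure (measure_pmf S) (X -` {X x}) = w x" if x: "x \<in> E" for x
    proof -
      have "measure (measure_pmf S) (X -` {X x}) = measure (measure_pmf S) (X -` {X x} \<inter> E)" using measure_Int_set_pmf[of S "X -` {X x}"] unfolding S(1) by (rule sym)
      also have "X -` {X x} \<inter> E = {x}" using inj x by blast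
      finally show ?thesis using S(2)[OF x] by (simp add: measure_pmf_single)
    qed
    have "ln Z = (\<Sum>x\<in>E. w x * ln Z)" using \<open>sum w E = 1\<close> by (simp flip: sum_distrib_right)
    also have "\<dots> = (\<Sum>x\<in>E. \<eta> (w x) + birkhoff_sum f n \<phi> x * w x)"
    proof (intro sum.cong refl)
      fix x
      have "ln (w x) = birkhoff_sum f n \<phi> x - ln Z" using Z by (simp add: w_def ln_div)
      show "w x * ln Z = \<eta> (w x) + birkhoff_sum f n \<phi> x * w x"
        unfolding \<open>ln (w x) = birkhoff_sum f n \<phi> x - ln Z\<close> by (simp add: algebra_simps)
    qed
    also have "\<dots> = (\<Sum>x\<in>E. \<eta> (w x)) + (\<Sum>x\<in>E. birkhoff_sum f n \<phi> x * pmf S x)"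
      using S(2) unfolding sum.distrib by (intro arg_cong2[of _ _ _ _ "(+)"] sum.cong) auto
    also have "(\<Sum>x\<in>E. \<eta> (w x)) = (\<Sum>v\<in>X ` E. \<eta> (measure (measure_pmf S) (X -` {v})))"
    proof -
      have "inj_on X E" using inj by (rule inj_onI)
      then show ?thesis unfolding sum.reindex[OF \<open>inj_on X E\<close>] o_def by (intro sum.cong) (auto simp: pw)
    qed
    also have "\<dots> \<le> entropy_of (measure_pmf S) X"
      unfolding entropy_of_def using nfv[of "{..<Suc n}"]
      by (intro sum_mono2 neg_mult_ln_nonneg) (auto simp: X_def finite_valued_def)
    also have "(\<Sum>x\<in>E. birkhoff_sum f n \<phi> x * pmf S x) = (\<integral>x. birkhoff_sum f n \<phi> x \<partial>measure_pmf S)"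
      using fin S(1) by (intro integral_measure_pmf_real[symmetric]) auto
    also have "\<dots> = (\<Sum>j<Suc n. \<integral>x. \<phi> ((f ^^ j) x) \<partial>measure_pmf S)"
      unfolding birkhoff_sum_def lessThan_Suc_atMost by (rule Bochner_Integration.integral_sum) (rule int)
    also have "\<dots> = real (Suc n) * (\<integral>x. \<phi> x \<partial>\<nu>)"
      unfolding \<nu>_def using fin S(1) borel_measurable_continuous_onI[OF \<phi>]
      by (subst empirical_integral) auto
    finally have "real q * ln Z \<le> real q * entropy_of (measure_pmf S) X + real q * (real (Suc n) * (\<integral>x. \<phi> x \<partial>\<nu>))"
      using q by (simp flip: distrib_left)
    also have "real q * entropy_of (measure_pmf S) X \<le> real q ^ 2 * ln (real (card P)) +
      (\<Sum>p<Suc n. \<Sum>v\<in>range (itinerary f P {..<q}).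
        \<eta> (measure (measure_pmf S) ((f ^^ p) -` (itinerary f P {..<q} -` {v}))))"
      unfolding X_def by (rule itinerary_blocks[OF f full_prob_space_axioms _ P q]) simp
    also have "(\<Sum>p<Suc n. \<Sum>v\<in>range (itinerary f P {..<q}).
        \<eta> (measure (measure_pmf S) ((f ^^ p) -` (itinerary f P {..<q} -` {v}))))
      = (\<Sum>v\<in>range (itinerary f P {..<q}). \<Sum>p<Suc n.
        \<eta> (measure (measure_pmf S) ((f ^^ p) -` (itinerary f P {..<q} -` {v}))))"
      by (rule sum.swap)
    also have "\<dots> \<le> (\<Sum>v\<in>range (itinerary f P {..<q}). real (Suc n) *
        (\<eta> (measure \<nu> (itinerary f P {..<q} -` {v}))))"
    proof (rule sum_mono)
      fix v
      interpret N: full_prob_space \<nu> unfolding \<nu>_def by (rule full_prob_space_borel_probs[OF empirical_borel_probs])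
      have "finite_valued \<nu> (itinerary f P {..<q})"
        unfolding itinerary_def using borel_probsD(2)[OF empirical_borel_probs]
        by (intro N.joint_finite_valued cell_finite_valued(1)[OF f _ P]) (auto simp: \<nu>_def)
      then have "itinerary f P {..<q} -` {v} \<in> sets borel"
        using borel_probsD(2)[OF empirical_borel_probs, of f "Suc n" S] unfolding finite_valued_def \<nu>_def by blast
      then have "measure \<nu> (itinerary f P {..<q} -` {v}) =
          (\<Sum>p<Suc n. measure (measure_pmf S) ((f ^^ p) -` (itinerary f P {..<q} -` {v}))) / real (card {..<Suc n})"
        unfolding \<nu>_def using fin S(1) by (subst empirical_measure) auto
      then show "(\<Sum>p<Suc n. \<eta> (measure (measure_pmf S) ((f ^^ p) -` (itinerary f P {..<q} -` {v}))))
        \<le> real (Suc n) * (\<eta> (measure \<nu> (itinerary f P {..<q} -` {v})))"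
        using sum_neg_mult_ln_le[of "{..<Suc n}" "\<lambda>p. measure (measure_pmf S) ((f ^^ p) -` (itinerary f P {..<q} -` {v}))"]
        by (simp only: card_lessThan finite_lessThan measure_nonneg lessThan_empty_iff not_False_eq_True
            nat.distinct bot_nat_def simp_thms)
    qed
    also have "\<dots> = real (Suc n) * entropy_of \<nu> (itinerary f P {..<q})"
      by (simp add: entropy_of_def sum_distrib_left)
    finally show ?thesis by simp
  qed
  then show ?thesis using S(1) fin
    unfolding entropy_controlled_def \<nu>_def Z_def by (intro exI[of _ S]) simp
qed

text \<open>If the cells have null boundary, so do the fibres of each itinerary map, by invariance of \<open>\<mu>\<close>; hence
the finitely many measures entering the entropy are weak-star continuous at \<open>\<mu>\<close>.\<close>

lemma entropy_neighbourhood: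
  assumes \<mu>: "\<mu> \<in> invariant_probs f" and P: "finite P" "partition_on UNIV P" "P \<subseteq> sets borel"
    and N: "N \<in> sets borel" "emeasure \<mu> N = 0" "\<And>x. x \<notin> N \<Longrightarrow> locally_constant_at (cell P) x" and e: "e > 0"
  obtains U where "openin weak_star U" "\<mu> \<in> U"
    "\<And>\<nu>. \<nu> \<in> U \<Longrightarrow> \<bar>entropy_of \<nu> (itinerary f P {..<q}) - entropy_of \<mu> (itinerary f P {..<q})\<bar> \<le> e"
proof -
  have b: "\<mu> \<in> borel_probs" using \<mu> by (simp add: invariant_probs_def)
  interpret full_prob_space \<mu> by (rule full_prob_space_borel_probs[OF b])
  have s: "sets \<mu> = sets borel" using borel_probsD(2)[OF b] .
  let ?X = "itinerary f P {..<q}"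
  have X: "finite_valued \<mu> ?X"
    unfolding itinerary_def using s by (intro joint_finite_valued cell_finite_valued(1)[OF f _ P]) auto
  then have fin: "finite (range ?X)" and meas: "?X -` {v} \<in> sets borel" for v
    using s by (auto simp: finite_valued_def)
  define N' where "N' = (\<Union>j<q. (f ^^ j) -` N)"
  have "(f ^^ j) -` N \<in> null_sets \<mu>" for j
    using funpow_vimage_borel[OF f N(1)] invariant_funpow[OF f \<mu> N(1)] N(2) s by (simp add: null_sets_def)
  then have N': "N' \<in> null_sets \<mu>"
    unfolding N'_def by (intro null_sets_UN') auto
  have "frontier (?X -` {v}) \<subseteq> N'" for v
  proof (rule ccontr)
    assume "\<not> frontier (?X -` {v}) \<subseteq> N'"
    then obtain y where y: "y \<in> frontier (?X -` {v})" "y \<notin> N'" by blast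
    then have "locally_constant_at (cell P) ((f ^^ j) y)" if "j < q" for j
      using N(3) that by (auto simp: N'_def)
    then have "\<forall>j\<in>{..<q}. \<exists>W. open W \<and> (f ^^ j) y \<in> W \<and> (\<forall>z\<in>W. cell P z = cell P ((f ^^ j) y))"
      unfolding locally_constant_at_def by blast
    from bchoice[OF this] obtain W where W: "\<forall>j\<in>{..<q}. open (W j) \<and> (f ^^ j) y \<in> W j \<and>
       (\<forall>z\<in>W j. cell P z = cell P ((f ^^ j) y))" ..
    define U where "U = (\<Inter>j\<in>{..<q}. (f ^^ j) -` W j)"
    have "open U" unfolding U_def using W funpow_continuous[OF f] by (intro open_INT ballI open_vimage) auto
    moreover have "y \<in> U" using W by (auto simp: U_def)
    moreover have "?X z = ?X y" if "z \<in> U" for z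
      unfolding itinerary_eq_iff
    proof
      fix j assume "j \<in> {..<q}"
      then have "(f ^^ j) z \<in> W j" using that unfolding U_def by blast
      then show "cell P ((f ^^ j) z) = cell P ((f ^^ j) y)" using W \<open>j \<in> {..<q}\<close> by blast
    qed
    ultimately have "locally_constant_at ?X y" unfolding locally_constant_at_def by blast
    then show False using frontier_not_locally_constant[OF y(1)] by blast
  qed
  then have fr: "measure \<mu> (frontier (?X -` {v})) = 0" for v
    using null_sets_subset[OF N', of "frontier (?X -` {v})"] s borel_closed[OF frontier_closed]
    by (intro measure_eq_0_null_sets) blast
  define k where "k = real (card (range ?X))"
  have k: "k > 0" using fin by (simp add: k_def card_gt_0_iff)
  have ek: "e / k > 0" using e k by simp
  have "\<exists>U. openin weak_star U \<and> \<mu> \<in> U \<and> (\<forall>\<nu>\<in>U.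
      \<bar>\<eta> (measure \<nu> (?X -` {v})) - (\<eta> (prob (?X -` {v})))\<bar> < e / k)" for v
  proof -
    obtain d where d: "d > 0" "\<And>t. 0 \<le> t \<Longrightarrow> t \<le> 1 \<Longrightarrow> \<bar>t - prob (?X -` {v})\<bar> < d \<Longrightarrow>
      \<bar>\<eta> t - (\<eta> (prob (?X -` {v})))\<bar> < e / k"
      using neg_mult_ln_close[OF measure_nonneg ek] by metis
    obtain U where "openin weak_star U \<and> \<mu> \<in> U \<and> (\<forall>\<nu>\<in>U. \<bar>measure \<nu> (?X -` {v}) - prob (?X -` {v})\<bar> < d)"
      using null_frontier_neighbourhood[OF b meas[of v] fr[of v] d(1)] ..
    then have U: "openin weak_star U" "\<mu> \<in> U"
      "\<And>\<nu>. \<nu> \<in> U \<Longrightarrow> \<bar>measure \<nu> (?X -` {v}) - prob (?X -` {v})\<bar> < d" by simp_all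
    have "\<nu> \<in> borel_probs" if "\<nu> \<in> U" for \<nu>
      using openin_subset[OF U(1)] that by (auto simp: topspace_weak_star)
    then have "measure \<nu> (?X -` {v}) \<le> 1" if "\<nu> \<in> U" for \<nu>
      using that prob_space.prob_le_1 borel_probsD(1) by blast
    then show ?thesis using U d(2) by (intro exI[of _ U]) auto
  qed
  then obtain U where U: "\<And>v. openin weak_star (U v)" "\<And>v. \<mu> \<in> U v" "\<And>v \<nu>. \<nu> \<in> U v \<Longrightarrow>
      \<bar>\<eta> (measure \<nu> (?X -` {v})) - (\<eta> (prob (?X -` {v})))\<bar> < e / k"
    by metis
  show ?thesis
  proof
    show "openin weak_star (\<Inter>v\<in>range ?X. U v)" using fin U(1) by (intro openin_INT2) auto
    show "\<mu> \<in> (\<Inter>v\<in>range ?X. U v)" using U(2) by blast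
    fix \<nu> assume \<nu>: "\<nu> \<in> (\<Inter>v\<in>range ?X. U v)"
    have "\<bar>entropy_of \<nu> ?X - entropy_of \<mu> ?X\<bar> = \<bar>\<Sum>v\<in>range ?X.
      \<eta> (measure \<nu> (?X -` {v})) - (\<eta> (prob (?X -` {v})))\<bar>"
      by (simp only: entropy_of_def sum_subtractf)
    also have "\<dots> \<le> (\<Sum>v\<in>range ?X. \<bar>\<eta> (measure \<nu> (?X -` {v}))
       - (\<eta> (prob (?X -` {v})))\<bar>)" by (rule sum_abs)
    also have "\<dots> \<le> (\<Sum>v\<in>range ?X. e / k)" using U(3) \<nu> by (intro sum_mono less_imp_le) blast
    also have "\<dots> = e" using k by (simp add: k_def)
    finally show "\<bar>entropy_of \<nu> ?X - entropy_of \<mu> ?X\<bar> \<le> e" .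
  qed
qed

text \<open>For infinitely many \<open>n\<close> some \<open>(n, \<epsilon>)\<close>-separated set has partition sum above \<open>exp (c * n)\<close>. Let \<open>\<mu>\<close> be a cluster point of
the associated orbit averages. It is invariant because the averages are almost invariant. For a partition with
small cells and \<open>\<mu>\<close>-null boundaries the entropy bound for the averages passes to \<open>\<mu>\<close>, for every length \<open>q\<close>.\<close>

theorem variational_lower_bound:
  assumes \<phi>: "continuous_on UNIV \<phi>" and c: "ereal c < P_top f \<phi>"
  obtains \<mu> where "\<mu> \<in> invariant_probs f" "ereal (c - (\<integral>x. \<phi> x \<partial>\<mu>)) \<le> metric_entropy \<mu> f"
proof -
  obtain \<epsilon> where \<epsilon>: "\<epsilon> > 0" "ereal c < growth_rate \<phi> \<epsilon>"
    using c unfolding P_top_eq_SUP[OF \<phi>] less_SUP_iff by auto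
  define A where "A = {n. n > 0 \<and> c * real n < ln (partition_sum f \<phi> n \<epsilon>)}"
  have A: "infinite A"
  proof
    assume "finite A"
    then obtain k where k: "\<And>n. n \<in> A \<Longrightarrow> n < k" using finite_nat_bounded by blast
    have "\<forall>\<^sub>F n in sequentially. ereal (1 / real n * ln (partition_sum f \<phi> n \<epsilon>)) \<le> ereal c"
      using eventually_ge_at_top[of k] eventually_gt_at_top[of 0]
    proof eventually_elim
      case (elim n)
      then have "n \<notin> A" using k[of n] by auto
      then show ?case using elim by (simp add: A_def field_simps)
    qed
    then have "growth_rate \<phi> \<epsilon> \<le> ereal c" unfolding growth_rate_def by (rule Limsup_bounded)
    then show False using \<epsilon>(2) by simp
  qed
  let ?good = "\<lambda>n. entropy_controlled n \<epsilon> \<phi> (c * real n)"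
  have "\<exists>S. ?good n S" if n: "n \<in> A" for n
  proof -
    have "exp (c * real n) < exp (ln (partition_sum f \<phi> n \<epsilon>))" using n by (simp add: A_def)
    then have "exp (c * real n) < partition_sum f \<phi> n \<epsilon>" using partition_sum_pos[OF \<phi> \<epsilon>(1)] by simp
    then obtain E where E: "separated f n \<epsilon> E" "exp (c * real n) < (\<Sum>x\<in>E. exp (birkhoff_sum f n \<phi> x))"
      unfolding partition_sum_def
    proof (subst (asm) less_cSUP_iff)
      show "{E. separated f n \<epsilon> E} \<noteq> {}" using separated_singleton by blast
    qed (use bdd_above_partition_sum[OF \<phi> \<epsilon>(1)] in auto)
    have ne: "E \<noteq> {}"
    proof
      assume "E = {}"
      then have "exp (c * real n) < 0" using E(2) by simp
      then show False by simp
    qed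
    have "ln (exp (c * real n)) \<le> ln (\<Sum>x\<in>E. exp (birkhoff_sum f n \<phi> x))"
      using E(2) by (intro ln_mono) auto
    then have "c * real n \<le> ln (\<Sum>x\<in>E. exp (birkhoff_sum f n \<phi> x))" by simp
    then show ?thesis
      using empirical_entropy_bound[OF \<phi> \<epsilon>(1) E(1) ne] entropy_controlled_mono by blast
  qed
  then obtain S where S: "\<And>n. n \<in> A \<Longrightarrow> ?good n (S n)" by metis
  define \<nu> where "\<nu> n = empirical f (Suc n) (S n)" for n
  have \<nu>b: "\<nu> n \<in> borel_probs" for n unfolding \<nu>_def by (rule empirical_borel_probs)
  obtain \<mu> where \<mu>b: "\<mu> \<in> borel_probs"
    and cl: "\<And>U. openin weak_star U \<Longrightarrow> \<mu> \<in> U \<Longrightarrow> infinite {n \<in> A. \<nu> n \<in> U}"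
    using cluster_point[OF compactin_borel_probs[OF cpt] A, of \<nu>] \<nu>b by blast
  have large: "\<exists>n\<in>A. \<nu> n \<in> U \<and> n \<ge> k" if "openin weak_star U" "\<mu> \<in> U" for U k
    using cl[OF that] unfolding infinite_nat_iff_unbounded_le by blast
  have small: "\<exists>k. \<forall>n\<ge>k. C / real (Suc n) < d" if "d > 0" for C d :: real
  proof -
    have "(\<lambda>n. C * (1 / real (Suc n))) \<longlonglongrightarrow> C * 0"
      by (intro tendsto_intros LIMSEQ_Suc lim_1_over_n)
    then have "\<forall>\<^sub>F n in sequentially. C * (1 / real (Suc n)) < d"
      using that by (intro order_tendstoD) auto
    then show ?thesis unfolding eventually_sequentially by simp
  qed
  have near: "openin weak_star {\<nu> \<in> topspace weak_star. (\<integral>x. \<psi> x \<partial>\<nu>) \<in> ball (\<integral>x. \<psi> x \<partial>\<mu>) d}"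
    if "continuous_on UNIV \<psi>" for \<psi> :: "'a \<Rightarrow> real" and d
    by (rule openin_continuous_map_preimage[where Y=euclideanreal]) (use that in \<open>auto intro: continuous_map_integral\<close>)
  have inv: "\<mu> \<in> invariant_probs f"
    unfolding invariant_probs_iff[OF cpt f \<mu>b]
  proof (intro allI impI)
    fix \<psi> :: "'a \<Rightarrow> real" assume \<psi>: "continuous_on UNIV \<psi>"
    obtain B where B: "\<And>x. \<bar>\<psi> x\<bar> \<le> B" using continuous_bounded[OF cpt \<psi>] by blast
    have cf: "continuous_on UNIV (\<lambda>x. \<psi> (f x))" using continuous_on_compose2[OF \<psi> f] by simp
    have c: "continuous_on UNIV (\<lambda>x. \<psi> (f x) - \<psi> x)" by (intro continuous_intros \<psi> cf)
    define D where "D = (\<integral>x. \<psi> (f x) - \<psi> x \<partial>\<mu>)"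
    have "\<bar>D\<bar> \<le> 0 + d" if d: "d > 0" for d
    proof -
      obtain k where k: "\<And>n. n \<ge> k \<Longrightarrow> (2 * B) / real (Suc n) < d / 2" using small[of "d / 2" "2 * B"] d by auto
      obtain n where n: "n \<in> A" "n \<ge> k" "(\<integral>x. \<psi> (f x) - \<psi> x \<partial>\<nu> n) \<in> ball D (d / 2)"
        using large[OF near[OF c, of "d / 2"], of k] \<mu>b d by (auto simp: topspace_weak_star D_def)
      have "\<bar>(\<integral>x. \<psi> (f x) - \<psi> x \<partial>\<nu> n)\<bar> \<le> 2 * B / real (Suc n)"
        unfolding \<nu>_def using S[OF n(1)] by (intro empirical_almost_invariant \<psi> B) (auto simp: entropy_controlled_def)
      moreover have "\<bar>D - (\<integral>x. \<psi> (f x) - \<psi> x \<partial>\<nu> n)\<bar> < d / 2" using n(3) unfolding mem_ball dist_real_def .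
      ultimately show ?thesis using k[OF n(2)] by linarith
    qed
    then have "\<bar>D\<bar> \<le> 0" by (rule field_le_epsilon)
    then show "(\<integral>x. \<psi> (f x) \<partial>\<mu>) = (\<integral>x. \<psi> x \<partial>\<mu>)"
      using continuous_integrable[OF cpt \<mu>b \<psi>] continuous_integrable[OF cpt \<mu>b cf] by (simp add: D_def)
  qed
  obtain P N where P: "finite P" "partition_on UNIV P" "P \<subseteq> sets borel"
    and diam: "\<forall>A\<in>P. \<forall>x\<in>A. \<forall>y\<in>A. dist x y < \<epsilon>"
    and N: "N \<in> sets borel" "emeasure \<mu> N = 0" "\<And>x. x \<notin> N \<Longrightarrow> locally_constant_at (cell P) x"
    using null_boundary_partition[OF cpt \<mu>b \<epsilon>(1)] by metis
  define I where "I = (\<integral>x. \<phi> x \<partial>\<mu>)"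
  have key: "c - I \<le> entropy_of \<mu> (itinerary f P {..<q}) / real q" if q: "q > 0" for q
  proof (rule field_le_epsilon)
    fix e :: real assume "e > 0"
    define d where "d = e / 4"
    have d: "d > 0" using \<open>e > 0\<close> by (simp add: d_def)
    obtain U where U: "openin weak_star U" "\<mu> \<in> U"
      "\<And>\<nu>. \<nu> \<in> U \<Longrightarrow> \<bar>entropy_of \<nu> (itinerary f P {..<q}) - entropy_of \<mu> (itinerary f P {..<q})\<bar> \<le> d"
      using entropy_neighbourhood[OF inv P N d] by blast
    define W where "W = U \<inter> {\<nu> \<in> topspace weak_star. (\<integral>x. \<phi> x \<partial>\<nu>) \<in> ball (\<integral>x. \<phi> x \<partial>\<mu>) d}"
    have W: "openin weak_star W" "\<mu> \<in> W"
      using near[OF \<phi>] U d \<mu>b by (auto simp: W_def topspace_weak_star)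
    obtain k1 where k1: "\<And>n. n \<ge> k1 \<Longrightarrow> c / real (Suc n) < d" using small[OF d] by blast
    obtain k2 where k2: "\<And>n. n \<ge> k2 \<Longrightarrow> (real q * ln (real (card P))) / real (Suc n) < d" using small[OF d] by blast
    obtain n where n: "n \<in> A" "\<nu> n \<in> W" "n \<ge> max k1 k2" using large[OF W] by blast
    define H where "H = entropy_of (\<nu> n) (itinerary f P {..<q})"
    define J where "J = (\<integral>x. \<phi> x \<partial>\<nu> n)"
    have close: "H \<le> entropy_of \<mu> (itinerary f P {..<q}) + d" "J \<le> I + d"
      using n(2) U(3)[of "\<nu> n"] by (auto simp: W_def H_def J_def I_def dist_real_def abs_le_iff)
    have "real q * (c * real n) \<le> real q ^ 2 * ln (real (card P)) + real (Suc n) * H + real q * (real (Suc n) * J)"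
      using S[OF n(1)] P diam q unfolding entropy_controlled_def H_def J_def \<nu>_def by blast
    \<comment> \<open>The averages run over the \<open>n + 1\<close> times \<open>0, ..., n\<close>, while growth rates are normalised by \<open>n\<close>.\<close>
    then have "real q * (real (Suc n) * c) \<le> real q * c + real q * (real q * ln (real (card P))) + real (Suc n) * H + real q * (real (Suc n) * J)"
      by (simp add: algebra_simps power2_eq_square)
    then have "c \<le> c / real (Suc n) + (real q * ln (real (card P))) / real (Suc n) + H / real q + J"
      using q by (simp add: divide_simps) (simp add: algebra_simps)
    also have "\<dots> \<le> d + d + H / real q + J" using k1[of n] k2[of n] n(3) by simp
    also have "H / real q \<le> (entropy_of \<mu> (itinerary f P {..<q}) + d) / real q"
      using close(1) by (rule divide_right_mono) simp
    also have "(entropy_of \<mu> (itinerary f P {..<q}) + d) / real q \<le> entropy_of \<mu> (itinerary f P {..<q}) / real q + d"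
      using q d by (simp add: add_divide_distrib divide_le_eq)
    finally show "c - I \<le> entropy_of \<mu> (itinerary f P {..<q}) / real q + e"
      using close(2) by (simp add: d_def)
  qed
  obtain h where h: "entropy_wrt \<mu> f P = ereal h"
    "\<And>c. (\<And>q. q > 0 \<Longrightarrow> c \<le> entropy_of \<mu> (itinerary f P {..<q}) / real q) \<Longrightarrow> c \<le> h"
    using entropy_wrt_limit[OF f inv P] by metis
  have "ereal (c - I) \<le> entropy_wrt \<mu> f P" using h(2)[OF key] by (simp add: h(1))
  also have "\<dots> \<le> metric_entropy \<mu> f" unfolding metric_entropy_def using P by (intro SUP_upper) auto
  finally show ?thesis using that inv by (simp add: I_def)
qed

end

section \<open>Separation by continuous functions\<close>

text \<open>A convex combination of integration functionals is represented by its Riesz measure, and this measure agrees with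
\<open>convex_comb\<close> on open sets, hence is equal to it.\<close>

lemma
  fixes \<mu> \<nu> :: "'a::metric_space measure"
  assumes cpt: "compact (UNIV :: 'a set)" and \<mu>: "\<mu> \<in> borel_probs" and \<nu>: "\<nu> \<in> borel_probs" and t: "t \<in> {0..1}"
  shows convex_comb_borel_probs: "convex_comb t \<mu> \<nu> \<in> borel_probs"
    and integral_convex_comb: "continuous_on UNIV \<phi> \<Longrightarrow>
      (\<integral>x. \<phi> x \<partial>convex_comb t \<mu> \<nu>) = t * (\<integral>x. \<phi> x \<partial>\<mu>) + (1 - t) * (\<integral>x. \<phi> x \<partial>\<nu>)"
proof -
  interpret m: prob_space \<mu> using borel_probsD(1)[OF \<mu>] .
  interpret n: prob_space \<nu> using borel_probsD(1)[OF \<nu>] .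
  have sc: "sets (convex_comb t \<mu> \<nu>) = sets borel"
    using sets.sigma_sets_eq[of borel] by (simp add: convex_comb_def)
  have em: "emeasure (convex_comb t \<mu> \<nu>) A = ennreal (t * measure \<mu> A + (1 - t) * measure \<nu> A)"
    if "A \<in> sets borel" for A
    using emeasure_convex_comb[OF \<mu> \<nu> that, of t] t
    by (simp add: m.emeasure_eq_measure n.emeasure_eq_measure ennreal_mult ennreal_plus)
  show cb: "convex_comb t \<mu> \<nu> \<in> borel_probs"
    using em[of UNIV] borel_probsD(5)[OF \<mu>] borel_probsD(5)[OF \<nu>] sc sets_eq_imp_space_eq[OF sc]
    by (auto simp: borel_probs_def intro!: prob_spaceI)
  define L where "L \<phi> = t * (\<integral>x. \<phi> x \<partial>\<mu>) + (1 - t) * (\<integral>x. \<phi> x \<partial>\<nu>)" for \<phi> :: "'a \<Rightarrow> real"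
  interpret M: normalised_positive_functional "\<lambda>\<phi> :: 'a \<Rightarrow> real. \<integral>x. \<phi> x \<partial>\<mu>"
    by (rule functional_of_measure[OF cpt \<mu>])
  interpret N: normalised_positive_functional "\<lambda>\<phi> :: 'a \<Rightarrow> real. \<integral>x. \<phi> x \<partial>\<nu>"
    by (rule functional_of_measure[OF cpt \<nu>])
  interpret L: normalised_positive_functional L
  proof
    show "L (\<lambda>x. \<phi> x + \<psi> x) = L \<phi> + L \<psi>" if "continuous_on UNIV \<phi>" "continuous_on UNIV \<psi>" for \<phi> \<psi>
      unfolding L_def M.add[OF that] N.add[OF that] by (simp add: algebra_simps)
    show "L (\<lambda>x. c * \<phi> x) = c * L \<phi>" if "continuous_on UNIV \<phi>" for c \<phi>
      unfolding L_def M.scale[OF that] N.scale[OF that] by (simp add: algebra_simps)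
    show "0 \<le> L \<phi>" if "continuous_on UNIV \<phi>" "\<And>x. 0 \<le> \<phi> x" for \<phi>
      unfolding L_def using t by (intro add_nonneg_nonneg mult_nonneg_nonneg M.nonneg N.nonneg that) auto
    show "L (\<lambda>_. 1) = 1" unfolding L_def M.one N.one by simp
  qed (rule cpt)
  have "L.riesz_measure = convex_comb t \<mu> \<nu>"
  proof (rule borel_probs_eqI_open[OF L.riesz_borel_probs cb])
    fix U :: "'a set" assume U: "open U"
    have "(\<lambda>n. L (bump U n)) \<longlonglongrightarrow> t * measure \<mu> U + (1 - t) * measure \<nu> U"
      unfolding L_def by (intro tendsto_intros bump_integral_tendsto \<mu> \<nu> U)
    moreover have "(\<lambda>n. L (bump U n)) \<longlonglongrightarrow> measure L.riesz_measure U"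
      using bump_integral_tendsto[OF L.riesz_borel_probs U] L.riesz_representation[OF continuous_on_bump]
      by simp
    ultimately have "measure L.riesz_measure U = t * measure \<mu> U + (1 - t) * measure \<nu> U"
      by (rule LIMSEQ_unique[rotated])
    also have "\<dots> = measure (convex_comb t \<mu> \<nu>) U"
      unfolding measure_def[of "convex_comb t \<mu> \<nu>" U] em[OF borel_open[OF U]]
      using t by (intro enn2real_ennreal[symmetric]) simp
    finally show "measure L.riesz_measure U = measure (convex_comb t \<mu> \<nu>) U" .
  qed
  then show "continuous_on UNIV \<phi> \<Longrightarrow>
      (\<integral>x. \<phi> x \<partial>convex_comb t \<mu> \<nu>) = t * (\<integral>x. \<phi> x \<partial>\<mu>) + (1 - t) * (\<integral>x. \<phi> x \<partial>\<nu>)"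
    using L.riesz_representation[of \<phi>] by (simp add: L_def)
qed

text \<open>A weak-star neighbourhood constrains only finitely many integrals, which reduces separation to finite dimension.\<close>

lemma weak_star_basic_neighbourhood:
  fixes W :: "'a::topological_space measure set"
  assumes "openin weak_star W" "\<mu> \<in> W"
  shows "\<exists>F e. finite F \<and> (\<forall>\<phi>\<in>F. continuous_on UNIV (\<phi> :: 'a \<Rightarrow> real)) \<and> e > 0 \<and>
    (\<forall>\<nu>\<in>borel_probs. (\<forall>\<phi>\<in>F. \<bar>(\<integral>x. \<phi> x \<partial>\<nu>) - (\<integral>x. \<phi> x \<partial>\<mu>)\<bar> < e) \<longrightarrow> \<nu> \<in> W)"
  using openin_topology_generated_by[OF assms(1)[unfolded weak_star_def]] assms(2)
proof (induction rule: generate_topology_on.induct)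
  case Empty
  then show ?case by simp
next
  case (Int a b)
  obtain F e where F: "finite F" "\<forall>\<phi>\<in>F. continuous_on UNIV (\<phi> :: 'a \<Rightarrow> real)" "e > 0"
    "\<forall>\<nu>\<in>borel_probs. (\<forall>\<phi>\<in>F. \<bar>(\<integral>x. \<phi> x \<partial>\<nu>) - (\<integral>x. \<phi> x \<partial>\<mu>)\<bar> < e) \<longrightarrow> \<nu> \<in> a"
    using Int.IH(1) Int.prems by blast
  obtain F' e' where F': "finite F'" "\<forall>\<phi>\<in>F'. continuous_on UNIV (\<phi> :: 'a \<Rightarrow> real)" "e' > 0"
    "\<forall>\<nu>\<in>borel_probs. (\<forall>\<phi>\<in>F'. \<bar>(\<integral>x. \<phi> x \<partial>\<nu>) - (\<integral>x. \<phi> x \<partial>\<mu>)\<bar> < e') \<longrightarrow> \<nu> \<in> b"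
    using Int.IH(2) Int.prems by blast
  show ?case
    by (rule exI[of _ "F \<union> F'"], rule exI[of _ "min e e'"]) (use F F' in \<open>simp add: ball_Un\<close>)
next
  case (UN K)
  then obtain k where k: "k \<in> K" "\<mu> \<in> k" by blast
  from UN.IH[OF this] obtain F e where "finite F" "\<forall>\<phi>\<in>F. continuous_on UNIV (\<phi> :: 'a \<Rightarrow> real)" "e > 0"
    "\<forall>\<nu>\<in>borel_probs. (\<forall>\<phi>\<in>F. \<bar>(\<integral>x. \<phi> x \<partial>\<nu>) - (\<integral>x. \<phi> x \<partial>\<mu>)\<bar> < e) \<longrightarrow> \<nu> \<in> k"
    by (elim exE conjE)
  then show ?case using k(1) by (intro exI[of _ F] exI[of _ e] conjI) (assumption | blast)+
next
  case (Basis s)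
  have "\<exists>(\<phi> :: 'a \<Rightarrow> real) U. s = {\<mu> \<in> borel_probs. (\<integral>x. \<phi> x \<partial>\<mu>) \<in> U} \<and> continuous_on UNIV \<phi> \<and> open U"
    using Basis.hyps by (simp only: mem_Collect_eq)
  then obtain \<phi> :: "'a \<Rightarrow> real" and U where s: "s = {\<mu> \<in> borel_probs. (\<integral>x. \<phi> x \<partial>\<mu>) \<in> U}"
    and \<phi>: "continuous_on UNIV \<phi>" and U: "open U" by (elim exE conjE)
  have "(\<integral>x. \<phi> x \<partial>\<mu>) \<in> U" using Basis.prems s by blast
  then obtain e where e: "e > 0" "\<And>y. dist y (\<integral>x. \<phi> x \<partial>\<mu>) < e \<Longrightarrow> y \<in> U"
    using U unfolding open_dist by blast
  show ?case
    by (rule exI[of _ "{\<phi>}"], rule exI[of _ e]) (use e \<phi> in \<open>simp add: s dist_real_def\<close>)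
qed

lemma nonneg_linear_coefficient:
  fixes A B :: real
  assumes "\<And>t. 0 < t \<Longrightarrow> t \<le> 1 \<Longrightarrow> 0 \<le> 2 * t * A + t ^ 2 * B"
  shows "0 \<le> A"
proof (rule ccontr)
  assume A: "\<not> 0 \<le> A"
  define t where "t = (if B \<le> 0 then 1 else min 1 (- A / B))"
  have t: "0 < t" "t \<le> 1" using A by (auto simp: t_def divide_neg_pos)
  have "t * B \<le> - A"
  proof (cases "B \<le> 0")
    case False
    then have "t * B \<le> (- A / B) * B" by (intro mult_right_mono) (auto simp: t_def)
    then show ?thesis using False by simp
  qed (use A in \<open>simp add: t_def\<close>)
  then have "2 * A + t * B < 0" using A by linarith
  then have "t * (2 * A + t * B) < 0" using t(1) by (simp add: mult_pos_neg)
  then show False using assms[OF t] by (simp add: algebra_simps power2_eq_square)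
qed

text \<open>Separation of the origin from the image of a compact convex set under finitely many continuous affine coordinates
\<open>X j\<close>. The coefficients are the coordinates at a point \<open>\<nu>0\<close> whose image is closest to the origin: moving from \<open>\<nu>0\<close>
towards any \<open>\<nu>\<close> cannot decrease the distance to first order.\<close>

lemma compact_convex_separation:
  fixes X :: "'i \<Rightarrow> 'a::topological_space measure \<Rightarrow> real"
  assumes K: "compactin T K" "K \<noteq> {}"
    and conv: "\<And>\<mu> \<nu> t. \<mu> \<in> K \<Longrightarrow> \<nu> \<in> K \<Longrightarrow> t \<in> {0..1} \<Longrightarrow> convex_comb t \<mu> \<nu> \<in> K"
    and J: "finite J" and cont: "\<And>j. j \<in> J \<Longrightarrow> continuous_map (subtopology T K) euclideanreal (X j)"
    and aff: "\<And>j. j \<in> J \<Longrightarrow> affine_on_probs K (X j)"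
    and sep: "\<And>\<nu>. \<nu> \<in> K \<Longrightarrow> \<exists>j\<in>J. X j \<nu> \<noteq> 0"
  obtains c where "\<And>\<nu>. \<nu> \<in> K \<Longrightarrow> 0 < (\<Sum>j\<in>J. c j * X j \<nu>)"
proof -
  define Q where "Q \<nu> = (\<Sum>j\<in>J. (X j \<nu>) ^ 2)" for \<nu>
  have "continuous_map (subtopology T K) euclideanreal Q"
    unfolding Q_def by (intro continuous_map_sum J continuous_map_real_pow cont)
  moreover have "compactin (subtopology T K) K" using K(1) by (simp add: compactin_subtopology)
  ultimately have "compact (Q ` K)" using image_compactin by (metis compactin_euclidean_iff)
  then obtain \<nu>0 where n0: "\<nu>0 \<in> K" "\<And>\<nu>. \<nu> \<in> K \<Longrightarrow> Q \<nu>0 \<le> Q \<nu>"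
    using compact_attains_inf[of "Q ` K"] K(2) by blast
  obtain j where "j \<in> J" "X j \<nu>0 \<noteq> 0" using sep[OF n0(1)] by blast
  then have Q0: "Q \<nu>0 > 0" unfolding Q_def using J by (intro sum_pos2[of J j]) auto
  have "0 < (\<Sum>j\<in>J. X j \<nu>0 * X j \<nu>)" if \<nu>: "\<nu> \<in> K" for \<nu>
  proof -
    define d where "d j = X j \<nu> - X j \<nu>0" for j
    have "0 \<le> (\<Sum>j\<in>J. X j \<nu>0 * d j)"
    proof (rule nonneg_linear_coefficient)
      fix t :: real assume t: "0 < t" "t \<le> 1"
      have "Q \<nu>0 \<le> Q (convex_comb t \<nu> \<nu>0)" using t by (intro n0 conv \<nu>) auto
      also have "\<dots> = (\<Sum>j\<in>J. (X j \<nu>0 + t * d j) ^ 2)"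
        unfolding Q_def
      proof (intro sum.cong refl)
        fix j assume "j \<in> J"
        then have "X j (convex_comb t \<nu> \<nu>0) = t * X j \<nu> + (1 - t) * X j \<nu>0"
          using aff[of j] \<nu> n0(1) t unfolding affine_on_probs_def by simp
        then show "(X j (convex_comb t \<nu> \<nu>0)) ^ 2 = (X j \<nu>0 + t * d j) ^ 2"
          unfolding d_def by (intro arg_cong[of _ _ "\<lambda>y. y ^ 2"]) (simp add: algebra_simps)
      qed
      also have "\<dots> = (\<Sum>j\<in>J. (X j \<nu>0) ^ 2 + 2 * t * (X j \<nu>0 * d j) + t ^ 2 * (d j) ^ 2)"
        by (intro sum.cong refl) (simp add: power2_eq_square algebra_simps)
      also have "\<dots> = Q \<nu>0 + 2 * t * (\<Sum>j\<in>J. X j \<nu>0 * d j) + t ^ 2 * (\<Sum>j\<in>J. (d j) ^ 2)"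
        by (simp add: Q_def sum.distrib sum_distrib_left)
      finally show "0 \<le> 2 * t * (\<Sum>j\<in>J. X j \<nu>0 * d j) + t ^ 2 * (\<Sum>j\<in>J. (d j) ^ 2)" by simp
    qed
    also have "(\<Sum>j\<in>J. X j \<nu>0 * d j) = (\<Sum>j\<in>J. X j \<nu>0 * X j \<nu>) - Q \<nu>0"
      by (simp add: d_def Q_def right_diff_distrib sum_subtractf power2_eq_square)
    finally show ?thesis using Q0 by simp
  qed
  then show ?thesis by (rule that[of "\<lambda>j. X j \<nu>0"])
qed


section \<open>The entropy map\<close>

context compact_dynamics
begin

lemma convex_comb_invariant:
  assumes \<mu>: "\<mu> \<in> invariant_probs f" and \<nu>: "\<nu> \<in> invariant_probs f" and t: "t \<in> {0..1}"
  shows "convex_comb t \<mu> \<nu> \<in> invariant_probs f"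
proof -
  have b: "\<mu> \<in> borel_probs" "\<nu> \<in> borel_probs" using \<mu> \<nu> by (auto simp: invariant_probs_def)
  have "(\<integral>x. \<psi> (f x) \<partial>convex_comb t \<mu> \<nu>) = (\<integral>x. \<psi> x \<partial>convex_comb t \<mu> \<nu>)"
    if "continuous_on UNIV \<psi>" for \<psi> :: "'a \<Rightarrow> real"
    using that continuous_on_compose2[OF that f] \<mu> \<nu>
    by (simp add: integral_convex_comb[OF cpt b t] invariant_probs_iff[OF cpt f b(1)] invariant_probs_iff[OF cpt f b(2)])
  then show ?thesis
    using invariant_probs_iff[OF cpt f convex_comb_borel_probs[OF cpt b t]] by blast
qed

lemma entropy_map_le:
  "continuous_on UNIV \<phi> \<Longrightarrow> entropy_map f \<mu> \<le> P_top f \<phi> - ereal (\<integral>x. \<phi> x \<partial>\<mu>)"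
  unfolding entropy_map_def by (rule INF_lower) simp

lemma metric_entropy_le_entropy_map:
  "\<mu> \<in> invariant_probs f \<Longrightarrow> metric_entropy \<mu> f \<le> entropy_map f \<mu>"
  unfolding entropy_map_def by (intro INF_greatest variational_upper_bound) auto

lemma metric_entropy_nonneg:
  assumes "\<mu> \<in> invariant_probs f"
  shows "0 \<le> metric_entropy \<mu> f"
proof -
  have P: "finite {UNIV :: 'a set}" "partition_on UNIV {UNIV :: 'a set}" "{UNIV :: 'a set} \<subseteq> sets borel"
    by (auto simp: partition_on_def)
  obtain h where "entropy_wrt \<mu> f {UNIV} = ereal h" "0 \<le> h"
    using entropy_wrt_limit[OF f assms P] by metis
  then have "0 \<le> entropy_wrt \<mu> f {UNIV}" by simp
  also have "\<dots> \<le> metric_entropy \<mu> f" unfolding metric_entropy_def using P by (intro SUP_upper) auto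
  finally show ?thesis .
qed

end

locale finite_entropy_dynamics = compact_dynamics +
  assumes h_top_finite: "h_top f < \<infinity>"
begin

definition pressure :: "('a \<Rightarrow> real) \<Rightarrow> real" where
  "pressure \<phi> = real_of_ereal (P_top f \<phi>)"

lemma P_top_pressure: "continuous_on UNIV \<phi> \<Longrightarrow> P_top f \<phi> = ereal (pressure \<phi>)"
  using P_top_finite[OF h_top_finite] by (simp add: pressure_def ereal_real)

text \<open>A strict sublevel set of an infimum is the union of the strict sublevel sets of its continuous members.\<close>

lemma entropy_map_upper_semicontinuous: "upper_semicontinuous_map weak_star (entropy_map f)"
  unfolding upper_semicontinuous_map_def
proof
  fix c :: ereal
  have "{\<mu> \<in> topspace weak_star. entropy_map f \<mu> < c} =
    (\<Union>\<phi>\<in>{\<phi> :: 'a \<Rightarrow> real. continuous_on UNIV \<phi>}.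
      {\<mu> \<in> topspace weak_star. (\<integral>x. \<phi> x \<partial>\<mu>) \<in> {y. ereal (pressure \<phi> - y) < c}})"
    unfolding entropy_map_def INF_less_iff by (auto simp: P_top_pressure)
  also have "openin weak_star \<dots>"
  proof (intro openin_Union ballI, clarify)
    fix \<phi> :: "'a \<Rightarrow> real" assume \<phi>: "continuous_on UNIV \<phi>"
    have "open {y. ereal (pressure \<phi> - y) < c}"
    proof (cases c)
      case (real r)
      then have "{y. ereal (pressure \<phi> - y) < c} = {y. pressure \<phi> - y < r}" by simp
      then show ?thesis by (simp only:) (intro open_Collect_less continuous_intros)
    qed auto
    then show "openin weak_star {\<mu> \<in> topspace weak_star. (\<integral>x. \<phi> x \<partial>\<mu>) \<in> {y. ereal (pressure \<phi> - y) < c}}"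
      by (intro openin_continuous_map_preimage[where Y=euclideanreal] continuous_map_integral \<phi>) simp
  qed
  finally show "openin weak_star {\<mu> \<in> topspace weak_star. entropy_map f \<mu> < c}" .
qed

text \<open>Take invariant measures \<open>s n\<close> whose free energy is within \<open>1 / (n + 1)\<close> of the pressure. The upper bound for a second potential \<open>\<psi>\<close> reads
\<open>pressure \<phi> - 1 / (n + 1) \<le> pressure \<psi> + \<integral>(\<phi> - \<psi>)\<close> at each \<open>s n\<close>, and it involves the measure only through
a weak-star continuous term; thus it passes to a cluster point.\<close>

lemma equilibrium_exists:
  assumes \<phi>: "continuous_on UNIV \<phi>"
  obtains \<mu> where "\<mu> \<in> invariant_probs f" "entropy_map f \<mu> + ereal (\<integral>x. \<phi> x \<partial>\<mu>) = P_top f \<phi>"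
proof -
  let ?K = "invariant_probs f"
  have "\<exists>\<mu>\<in>?K. ereal (pressure \<phi> - 1 / real (Suc n) - (\<integral>x. \<phi> x \<partial>\<mu>)) \<le> metric_entropy \<mu> f" for n
    using variational_lower_bound[OF \<phi>, of "pressure \<phi> - 1 / real (Suc n)"] P_top_pressure[OF \<phi>]
    by (metis divide_pos_pos diff_less_eq ereal_less(2) less_add_same_cancel1 less_ereal.simps(1) of_nat_0_less_iff zero_less_Suc zero_less_one)
  then obtain s where s: "\<And>n. s n \<in> ?K"
    "\<And>n. ereal (pressure \<phi> - 1 / real (Suc n) - (\<integral>x. \<phi> x \<partial>s n)) \<le> metric_entropy (s n) f" by metis
  obtain \<mu> where \<mu>: "\<mu> \<in> ?K" and cl: "\<And>U. openin weak_star U \<Longrightarrow> \<mu> \<in> U \<Longrightarrow> infinite {n \<in> UNIV. s n \<in> U}"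
    using cluster_point[OF compactin_invariant_probs[OF cpt f] infinite_UNIV_nat, of s] s(1) by blast
  have \<mu>b: "\<mu> \<in> borel_probs" using \<mu> by (simp add: invariant_probs_def)
  have "pressure \<phi> - (\<integral>x. \<phi> x \<partial>\<mu>) \<le> pressure \<psi> - (\<integral>x. \<psi> x \<partial>\<mu>)"
    if \<psi>: "continuous_on UNIV \<psi>" for \<psi>
  proof (rule field_le_epsilon)
    fix e :: real assume e: "e > 0"
    have c: "continuous_on UNIV (\<lambda>x. \<phi> x - \<psi> x)" by (intro continuous_intros \<phi> \<psi>)
    define U where "U = {\<nu> \<in> topspace weak_star. (\<integral>x. \<phi> x - \<psi> x \<partial>\<nu>) \<in> {..< (\<integral>x. \<phi> x - \<psi> x \<partial>\<mu>) + e / 2}}"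
    have "openin weak_star U" unfolding U_def
      by (intro openin_continuous_map_preimage[where Y=euclideanreal] continuous_map_integral c) simp
    moreover have "\<mu> \<in> U" using \<mu>b e by (simp add: U_def topspace_weak_star)
    ultimately have inf: "infinite {n. s n \<in> U}" using cl by simp
    obtain k where k: "1 / real (Suc k) < e / 2" using e nat_approx_posE[of "e / 2"] by (metis half_gt_zero)
    obtain n where n: "n \<ge> k" "s n \<in> U" using inf unfolding infinite_nat_iff_unbounded_le by blast
    have sb: "s n \<in> borel_probs" using s(1) by (simp add: invariant_probs_def)
    have "1 / real (Suc n) \<le> 1 / real (Suc k)" using n(1) by (intro divide_left_mono) auto
    moreover have "ereal (pressure \<phi> - 1 / real (Suc n) - (\<integral>x. \<phi> x \<partial>s n)) \<le> ereal (pressure \<psi> - (\<integral>x. \<psi> x \<partial>s n))"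
      using order_trans[OF s(2)[of n] variational_upper_bound[OF s(1) \<psi>]] P_top_pressure[OF \<psi>] by simp
    moreover have "(\<integral>x. \<phi> x \<partial>s n) - (\<integral>x. \<psi> x \<partial>s n) < (\<integral>x. \<phi> x \<partial>\<mu>) - (\<integral>x. \<psi> x \<partial>\<mu>) + e / 2"
      using n(2) continuous_integrable[OF cpt sb] continuous_integrable[OF cpt \<mu>b] \<phi> \<psi>
      by (simp add: U_def)
    ultimately show "pressure \<phi> - (\<integral>x. \<phi> x \<partial>\<mu>) \<le> pressure \<psi> - (\<integral>x. \<psi> x \<partial>\<mu>) + e"
      using k by simp
  qed
  then have "ereal (pressure \<phi> - (\<integral>x. \<phi> x \<partial>\<mu>)) \<le> entropy_map f \<mu>"
    unfolding entropy_map_def by (intro INF_greatest) (simp add: P_top_pressure)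
  with entropy_map_le[OF \<phi>, of \<mu>] have "entropy_map f \<mu> = ereal (pressure \<phi> - (\<integral>x. \<phi> x \<partial>\<mu>))"
    by (simp add: P_top_pressure[OF \<phi>])
  then show ?thesis using that \<mu> by (simp add: P_top_pressure[OF \<phi>])
qed

lemma entropy_map_add_le:
  "continuous_on UNIV \<phi> \<Longrightarrow> entropy_map f \<mu> + ereal (\<integral>x. \<phi> x \<partial>\<mu>) \<le> P_top f \<phi>"
  using entropy_map_le[of \<phi> \<mu>] by (simp add: ereal_le_minus)

text \<open>If \<open>\<mu>\<close> is maximising for \<open>\<phi>\<close>, adding \<open>\<psi> \<circ> f - \<psi>\<close> to the potential does not increase the pressure, hence it does
not increase the integral. Applied to \<open>\<psi>\<close> and \<open>-\<psi>\<close> this is invariance.\<close>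

lemma equilibrium_invariant:
  assumes \<phi>: "continuous_on UNIV \<phi>" and \<mu>: "\<mu> \<in> borel_probs"
    and eq: "entropy_map f \<mu> + ereal (\<integral>x. \<phi> x \<partial>\<mu>) = P_top f \<phi>"
  shows "\<mu> \<in> invariant_probs f"
proof -
  have em: "entropy_map f \<mu> = ereal (pressure \<phi> - (\<integral>x. \<phi> x \<partial>\<mu>))"
    using eq P_top_pressure[OF \<phi>] by (cases "entropy_map f \<mu>") auto
  have le: "(\<integral>x. \<psi> (f x) \<partial>\<mu>) \<le> (\<integral>x. \<psi> x \<partial>\<mu>)" if \<psi>: "continuous_on UNIV \<psi>" for \<psi> :: "'a \<Rightarrow> real"
  proof -
    have cf: "continuous_on UNIV (\<lambda>x. \<psi> (f x))" using continuous_on_compose2[OF \<psi> f] by simp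
    let ?\<chi> = "\<lambda>x. \<phi> x + (\<psi> (f x) - \<psi> x)"
    have c: "continuous_on UNIV ?\<chi>" by (intro continuous_intros \<phi> \<psi> cf)
    have "entropy_map f \<mu> \<le> P_top f ?\<chi> - ereal (\<integral>x. ?\<chi> x \<partial>\<mu>)" by (rule entropy_map_le[OF c])
    moreover have "pressure ?\<chi> \<le> pressure \<phi>"
      using P_top_coboundary[OF \<phi> \<psi>] by (simp add: P_top_pressure[OF \<phi>] P_top_pressure[OF c])
    moreover have "(\<integral>x. ?\<chi> x \<partial>\<mu>) = (\<integral>x. \<phi> x \<partial>\<mu>) + ((\<integral>x. \<psi> (f x) \<partial>\<mu>) - (\<integral>x. \<psi> x \<partial>\<mu>))"
      using continuous_integrable[OF cpt \<mu>] \<phi> \<psi> cf by simp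
    ultimately show ?thesis by (simp add: em P_top_pressure[OF c])
  qed
  have "(\<integral>x. \<psi> (f x) \<partial>\<mu>) = (\<integral>x. \<psi> x \<partial>\<mu>)" if \<psi>: "continuous_on UNIV \<psi>" for \<psi> :: "'a \<Rightarrow> real"
    using le[OF \<psi>] le[of "\<lambda>x. - \<psi> x"] \<psi> by (simp add: continuous_on_minus)
  then show ?thesis using invariant_probs_iff[OF cpt f \<mu>] by blast
qed

text \<open>The point of the graph of \<open>T\<close> above \<open>\<mu>\<close>, raised by \<open>\<delta>\<close>, is separated from the whole graph by a functional that
depends on finitely many integrals and on the height. Evaluated at \<open>\<mu>\<close> itself, the separation shows that the height has a
negative coefficient, so the separating hyperplane is the graph of an affine function \<open>\<nu> \<mapsto> \<integral>\<psi> d\<nu> + const\<close>.\<close>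

lemma affine_majorant:
  assumes T: "continuous_map (subtopology weak_star (invariant_probs f)) euclideanreal T"
    and aff: "affine_on_probs (invariant_probs f) T"
    and \<mu>: "\<mu> \<in> invariant_probs f" and \<delta>: "\<delta> > 0"
  obtains \<psi> :: "'a \<Rightarrow> real" where "continuous_on UNIV \<psi>"
    "\<And>\<nu>. \<nu> \<in> invariant_probs f \<Longrightarrow> T \<nu> \<le> T \<mu> + \<delta> + ((\<integral>x. \<psi> x \<partial>\<nu>) - (\<integral>x. \<psi> x \<partial>\<mu>))"
proof -
  let ?K = "invariant_probs f"
  have Kb: "\<nu> \<in> borel_probs" if "\<nu> \<in> ?K" for \<nu> using that by (simp add: invariant_probs_def)
  have tops: "topspace (subtopology weak_star ?K) = ?K"
    using Kb by (auto simp: topspace_weak_star)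
  have "openin (subtopology weak_star ?K) {\<nu> \<in> topspace (subtopology weak_star ?K). T \<nu> \<in> ball (T \<mu>) \<delta>}"
    by (rule openin_continuous_map_preimage[OF T]) simp
  then obtain W where W: "openin weak_star W" "{\<nu> \<in> ?K. T \<nu> \<in> ball (T \<mu>) \<delta>} = W \<inter> ?K"
    unfolding tops openin_subtopology by blast
  have "\<mu> \<in> {\<nu> \<in> ?K. T \<nu> \<in> ball (T \<mu>) \<delta>}" using \<mu> \<delta> by simp
  then have "\<mu> \<in> W" unfolding W(2) by (rule IntD1)
  obtain F e where F: "finite F" "\<forall>\<phi>\<in>F. continuous_on UNIV (\<phi> :: 'a \<Rightarrow> real)" "e > 0"
    "\<forall>\<nu>\<in>borel_probs. (\<forall>\<phi>\<in>F. \<bar>(\<integral>x. \<phi> x \<partial>\<nu>) - (\<integral>x. \<phi> x \<partial>\<mu>)\<bar> < e) \<longrightarrow> \<nu> \<in> W"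
    using weak_star_basic_neighbourhood[OF W(1) \<open>\<mu> \<in> W\<close>] by (elim exE conjE)
  note Fc = F(2)[rule_format]
  define X where "X j \<nu> = (case j of None \<Rightarrow> T \<nu> - (T \<mu> + \<delta>) | Some \<phi> \<Rightarrow> (\<integral>x. \<phi> x \<partial>\<nu>) - (\<integral>x. \<phi> x \<partial>\<mu>))" for j \<nu>
  \<comment> \<open>\<open>None\<close> indexes the height above the raised point, \<open>Some \<phi>\<close> the integral of \<open>\<phi>\<close>.\<close>
  define J where "J = insert None (Some ` F)"
  obtain c where c: "\<And>\<nu>. \<nu> \<in> ?K \<Longrightarrow> 0 < (\<Sum>j\<in>J. c j * X j \<nu>)"
  proof (rule compact_convex_separation[where J=J and X=X and K="?K" and T=weak_star])
    show "compactin weak_star ?K" by (rule compactin_invariant_probs[OF cpt f])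
    show "?K \<noteq> {}" using \<mu> by blast
    show "finite J" using F(1) by (simp add: J_def)
    show "continuous_map (subtopology weak_star ?K) euclideanreal (X j)" if "j \<in> J" for j
    proof (cases j)
      case None
      have "continuous_map (subtopology weak_star ?K) euclideanreal (\<lambda>\<nu>. T \<nu> - (T \<mu> + \<delta>))"
        by (intro continuous_map_diff T continuous_map_const[THEN iffD2]) simp
      then show ?thesis using None by (simp add: X_def[abs_def])
    next
      case (Some \<phi>)
      then have "\<phi> \<in> F" using that by (auto simp: J_def)
      then have "continuous_map (subtopology weak_star ?K) euclideanreal (\<lambda>\<nu>. (\<integral>x. \<phi> x \<partial>\<nu>) - (\<integral>x. \<phi> x \<partial>\<mu>))"
        by (intro continuous_map_diff continuous_map_from_subtopology continuous_map_integral Fc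
            continuous_map_const[THEN iffD2]) simp_all
      then show ?thesis using Some by (simp add: X_def[abs_def])
    qed
    show "affine_on_probs ?K (X j)" if "j \<in> J" for j
    proof (cases j)
      case None
      then show ?thesis using aff by (simp add: affine_on_probs_def X_def algebra_simps)
    next
      case (Some \<phi>)
      then have "continuous_on UNIV \<phi>" using that Fc by (auto simp: J_def)
      then show ?thesis using Some Kb
        by (simp add: affine_on_probs_def X_def integral_convex_comb[OF cpt] algebra_simps)
    qed
    show "\<exists>j\<in>J. X j \<nu> \<noteq> 0" if \<nu>: "\<nu> \<in> ?K" for \<nu>
    proof (rule ccontr)
      assume a: "\<not> (\<exists>j\<in>J. X j \<nu> \<noteq> 0)"
      then have "(\<integral>x. \<phi> x \<partial>\<nu>) - (\<integral>x. \<phi> x \<partial>\<mu>) = 0" if "\<phi> \<in> F" for \<phi>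
        using that by (force simp: J_def X_def)
      then have "\<nu> \<in> W" using F(3,4) Kb[OF \<nu>] by simp
      then have "T \<nu> \<in> ball (T \<mu>) \<delta>" using W(2) \<nu> by blast
      moreover have "X None \<nu> = 0" using a by (simp add: J_def)
      ultimately show False using \<delta> by (simp add: X_def dist_real_def)
    qed
  qed (use convex_comb_invariant in blast)+
  have sumJ: "(\<Sum>j\<in>J. c j * X j \<nu>) = c None * (T \<nu> - (T \<mu> + \<delta>)) +
      (\<Sum>\<phi>\<in>F. c (Some \<phi>) * ((\<integral>x. \<phi> x \<partial>\<nu>) - (\<integral>x. \<phi> x \<partial>\<mu>)))" for \<nu>
    unfolding J_def using F(1) by (subst sum.insert) (auto simp: X_def sum.reindex)
  have "0 < c None * - \<delta>" using c[OF \<mu>] unfolding sumJ by simp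
  then have neg: "c None < 0" using \<delta> by (simp add: mult_less_0_iff)
  define b where "b = - c None"
  have b: "b > 0" using neg by (simp add: b_def)
  define \<psi> where "\<psi> x = (\<Sum>\<phi>\<in>F. c (Some \<phi>) / b * \<phi> x)" for x
  have "continuous_on UNIV \<psi>" unfolding \<psi>_def by (intro continuous_intros Fc)
  moreover have "T \<nu> \<le> T \<mu> + \<delta> + ((\<integral>x. \<psi> x \<partial>\<nu>) - (\<integral>x. \<psi> x \<partial>\<mu>))" if \<nu>: "\<nu> \<in> ?K" for \<nu>
  proof -
    have int: "(\<integral>x. \<psi> x \<partial>\<kappa>) = (\<Sum>\<phi>\<in>F. c (Some \<phi>) * (\<integral>x. \<phi> x \<partial>\<kappa>)) / b" if "\<kappa> \<in> ?K" for \<kappa>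
    proof -
      have "(\<integral>x. \<psi> x \<partial>\<kappa>) = (\<Sum>\<phi>\<in>F. \<integral>x. c (Some \<phi>) / b * \<phi> x \<partial>\<kappa>)"
        unfolding \<psi>_def using Fc Kb[OF that]
        by (intro Bochner_Integration.integral_sum continuous_integrable[OF cpt] continuous_on_mult_left) auto
      then show ?thesis by (simp add: sum_divide_distrib)
    qed
    have "b * (T \<nu> - (T \<mu> + \<delta>)) < (\<Sum>\<phi>\<in>F. c (Some \<phi>) * ((\<integral>x. \<phi> x \<partial>\<nu>) - (\<integral>x. \<phi> x \<partial>\<mu>)))"
      using c[OF \<nu>] unfolding sumJ by (simp add: b_def)
    also have "\<dots> = b * ((\<integral>x. \<psi> x \<partial>\<nu>) - (\<integral>x. \<psi> x \<partial>\<mu>))"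
      unfolding int[OF \<nu>] int[OF \<mu>] using b by (simp add: right_diff_distrib sum_subtractf)
    finally have "T \<nu> - (T \<mu> + \<delta>) < (\<integral>x. \<psi> x \<partial>\<nu>) - (\<integral>x. \<psi> x \<partial>\<mu>)" using b by simp
    then show ?thesis by simp
  qed
  ultimately show ?thesis by (rule that)
qed

text \<open>With \<open>\<psi>\<close> from \<open>affine_majorant\<close>, the quantity \<open>h\<^sub>\<nu>(f) - \<integral>\<psi> d\<nu>\<close> is at most \<open>T \<mu> + \<delta> - \<integral>\<psi> d\<mu>\<close> for every invariant
\<open>\<nu>\<close>. By the lower bound in the variational principle this constant also bounds the pressure of \<open>-\<psi>\<close>, and testing the entropy map
against \<open>-\<psi>\<close> gives \<open>T \<mu> + \<delta>\<close>.\<close>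

lemma entropy_map_le_affine:
  assumes T: "continuous_map (subtopology weak_star (invariant_probs f)) euclideanreal T"
    and aff: "affine_on_probs (invariant_probs f) T"
    and maj: "\<And>\<nu>. \<nu> \<in> invariant_probs f \<Longrightarrow> metric_entropy \<nu> f \<le> ereal (T \<nu>)"
    and \<mu>: "\<mu> \<in> invariant_probs f"
  shows "entropy_map f \<mu> \<le> ereal (T \<mu>)"
proof (rule ereal_le_epsilon2)
  fix \<delta> :: real assume \<delta>: "0 < \<delta>"
  obtain \<psi> :: "'a \<Rightarrow> real" where \<psi>: "continuous_on UNIV \<psi>"
    "\<And>\<nu>. \<nu> \<in> invariant_probs f \<Longrightarrow> T \<nu> \<le> T \<mu> + \<delta> + ((\<integral>x. \<psi> x \<partial>\<nu>) - (\<integral>x. \<psi> x \<partial>\<mu>))"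
    using affine_majorant[OF T aff \<mu> \<delta>] by blast
  have n: "continuous_on UNIV (\<lambda>x. - \<psi> x)" using \<psi>(1) by (rule continuous_on_minus)
  have "pressure (\<lambda>x. - \<psi> x) \<le> T \<mu> + \<delta> - (\<integral>x. \<psi> x \<partial>\<mu>)"
  proof (rule dense_le)
    fix c assume "c < pressure (\<lambda>x. - \<psi> x)"
    then have "ereal c < P_top f (\<lambda>x. - \<psi> x)" by (simp add: P_top_pressure[OF n])
    then obtain \<nu> where \<nu>: "\<nu> \<in> invariant_probs f" "ereal (c - (\<integral>x. - \<psi> x \<partial>\<nu>)) \<le> metric_entropy \<nu> f"
      using variational_lower_bound[OF n] by blast
    then have "ereal (c - (\<integral>x. - \<psi> x \<partial>\<nu>)) \<le> ereal (T \<nu>)" using maj order_trans by blast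
    then show "c \<le> T \<mu> + \<delta> - (\<integral>x. \<psi> x \<partial>\<mu>)" using \<psi>(2)[OF \<nu>(1)] by simp
  qed
  then have "P_top f (\<lambda>x. - \<psi> x) - ereal (\<integral>x. - \<psi> x \<partial>\<mu>) \<le> ereal (T \<mu>) + ereal \<delta>"
    by (simp add: P_top_pressure[OF n])
  then show "entropy_map f \<mu> \<le> ereal (T \<mu>) + ereal \<delta>"
    using entropy_map_le[OF n, of \<mu>] by (rule order_trans[rotated])
qed

theorem entropy_map_eq_envelope:
  assumes \<mu>: "\<mu> \<in> invariant_probs f"
  shows "entropy_map f \<mu> = entropy_envelope f \<mu>"
proof (rule antisym)
  show "entropy_map f \<mu> \<le> entropy_envelope f \<mu>"
    unfolding entropy_envelope_def by (intro INF_greatest entropy_map_le_affine \<mu>) auto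
  show "entropy_envelope f \<mu> \<le> entropy_map f \<mu>"
    unfolding entropy_map_def
  proof (rule INF_greatest, clarify)
    fix \<phi> :: "'a \<Rightarrow> real" assume \<phi>: "continuous_on UNIV \<phi>"
    define T where "T \<nu> = pressure \<phi> - (\<integral>x. \<phi> x \<partial>\<nu>)" for \<nu>
    have "continuous_map (subtopology weak_star (invariant_probs f)) euclideanreal T"
      unfolding T_def
      by (intro continuous_map_diff continuous_map_from_subtopology continuous_map_integral \<phi>
            continuous_map_const[THEN iffD2]) simp
    moreover have "affine_on_probs (invariant_probs f) T"
      unfolding affine_on_probs_def T_def
      by (auto simp: invariant_probs_def integral_convex_comb[OF cpt _ _ _ \<phi>] algebra_simps)
    moreover have "metric_entropy \<nu> f \<le> ereal (T \<nu>)" if "\<nu> \<in> invariant_probs f" for \<nu>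
      using variational_upper_bound[OF that \<phi>] by (simp add: T_def P_top_pressure[OF \<phi>])
    ultimately have "entropy_envelope f \<mu> \<le> ereal (T \<mu>)"
      unfolding entropy_envelope_def by (intro INF_lower) auto
    then show "entropy_envelope f \<mu> \<le> P_top f \<phi> - ereal (\<integral>x. \<phi> x \<partial>\<mu>)"
      by (simp add: T_def P_top_pressure[OF \<phi>])
  qed
qed

end

theorem theorem5:
  fixes f :: "'a::metric_space \<Rightarrow> 'a"
  assumes "compact (UNIV :: 'a set)"
    and "continuous_on UNIV f"
    and "h_top f < \<infinity>"
  shows "(\<forall>\<mu>\<in>borel_probs. entropy_map f \<mu> < \<infinity>)
    \<and> upper_semicontinuous_map weak_star (entropy_map f)
    \<and> (\<forall>\<mu>\<in>invariant_probs f. 0 \<le> metric_entropy \<mu> f \<and> metric_entropy \<mu> f \<le> entropy_map f \<mu>)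
    \<and> (\<forall>\<phi> :: 'a \<Rightarrow> real. continuous_on UNIV \<phi> \<longrightarrow>
          is_maximum ((\<lambda>\<mu>. entropy_map f \<mu> + ereal (\<integral>x. \<phi> x \<partial>\<mu>)) ` borel_probs) (P_top f \<phi>)
        \<and> is_maximum ((\<lambda>\<mu>. entropy_map f \<mu> + ereal (\<integral>x. \<phi> x \<partial>\<mu>)) ` invariant_probs f) (P_top f \<phi>))
    \<and> (\<forall>\<phi> :: 'a \<Rightarrow> real. continuous_on UNIV \<phi> \<longrightarrow>
          (\<forall>\<mu>\<in>borel_probs. entropy_map f \<mu> + ereal (\<integral>x. \<phi> x \<partial>\<mu>) = P_top f \<phi> \<longrightarrow>
              \<mu> \<in> invariant_probs f))
    \<and> (\<forall>\<mu>\<in>invariant_probs f. entropy_map f \<mu> = entropy_envelope f \<mu>)"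
proof -
  interpret finite_entropy_dynamics f by unfold_locales (fact assms)+
  have finite: "entropy_map f \<mu> < \<infinity>" for \<mu>
    using entropy_map_le[of "\<lambda>_. 0" \<mu>] h_top_finite unfolding h_top_def by (auto intro: le_less_trans)
  have maximum: "is_maximum ((\<lambda>\<mu>. entropy_map f \<mu> + ereal (\<integral>x. \<phi> x \<partial>\<mu>)) ` K) (P_top f \<phi>)"
    if c: "continuous_on UNIV \<phi>" and sub: "invariant_probs f \<subseteq> K" for \<phi> :: "'a \<Rightarrow> real" and K
  proof -
    obtain \<mu> where \<mu>: "\<mu> \<in> invariant_probs f" "entropy_map f \<mu> + ereal (\<integral>x. \<phi> x \<partial>\<mu>) = P_top f \<phi>"
      by (rule equilibrium_exists[OF c])
    then have "P_top f \<phi> \<in> (\<lambda>\<mu>. entropy_map f \<mu> + ereal (\<integral>x. \<phi> x \<partial>\<mu>)) ` K"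
      using sub by (metis (no_types, lifting) image_eqI subsetD)
    then show ?thesis
      using entropy_map_add_le[OF c] by (auto simp: is_maximum_def)
  qed
  have sub: "invariant_probs f \<subseteq> borel_probs" by (auto simp: invariant_probs_def)
  show ?thesis
    by (intro conjI ballI allI impI finite entropy_map_upper_semicontinuous metric_entropy_nonneg
        metric_entropy_le_entropy_map maximum[OF _ sub] maximum[OF _ order_refl]
        entropy_map_eq_envelope) (assumption | (rule equilibrium_invariant, assumption+))+
qed

end
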